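(* Every homogeneous holomorphic Poisson manifold is the Poissonization of a canonical holomorphic Jacobi manifold around a non-singular point of the homogeneity vector field. That is: let $Y$ be a complex manifold with a homogeneous holomorphic Poisson structure $(\Pi_N,H_N)$, and let $x\in Y$ with $(H_N)_x\neq0$. Then there exist an open neighborhood $U$ of $x$ in $Y$, a canonical holomorphic Jacobi manifold $(X,L,J)$, and a biholomorphism of $U$ onto an open subset of the Poissonization $(\widetilde X,\Pi,H)$ of $(X,L,J)$ that identifies $\Pi_N|_U$ with the restriction of $\Pi$ and $H_N|_U$ with the restriction of $H$.
   Context: A homogeneous holomorphic Poisson structure on a complex manifold is a pair $(\Pi,H)$ where $\Pi$ is a holomorphic Poisson bivector ($\Pi\in\Gamma(\wedge^2T^{1,0})$, $\overline\partial\Pi=0$, Schouten bracket $[\Pi,\Pi]=0$) and $H$ is a holomorphic vector field (the homogeneity vector field) with $\mathcal L_H\Pi=-\Pi$. A holomorphic Jacobi manifold is a triple $(X,L,J)$ where $X=(M,j)$ is a complex manifold, $L\to X$ a holomorphic line bundle, and $J\equiv\{-,-\}$ a holomorphic Jacobi bi-derivation of $L$: a skew-symmetric $\mathbb{C}$-bilinear map $\Gamma(L)\times\Gamma(L)\to\Gamma(L)$ on smooth sections, a first order differential operator in each entry, such that the symbol of $J(\lambda,-)$ is a section of $T^{1,0}M$ for each $\lambda$ (where the symbol is the vector field $X_\lambda$ with $J(\lambda,f\mu)=X_\lambda(f)\mu+fJ(\lambda,\mu)$), mapping pairs of local holomorphic sections to holomorphic sections, and satisfying the Jacobi identity. The Poissonization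 of $(X,L,J)$ is $(\widetilde X,\Pi,H)$ where $\widetilde X=L^\ast\smallsetminus\{0\}$ is the slit complex dual of $L$, $H$ is the restriction of the holomorphic Euler vector field of $L^\ast$, and $\Pi$ is the unique holomorphic bivector on $\widetilde X$ with $\Pi(\partial\widetilde\lambda_1,\partial\widetilde\lambda_2)=\widetilde{\{\lambda_1,\lambda_2\}}$ for all local holomorphic sections $\lambda_1,\lambda_2$ of $L$, $\widetilde\lambda$ being the fiber-wise linear holomorphic function on $\widetilde X$ corresponding to $\lambda$. It is a homogeneous holomorphic Poisson manifold. "Canonical" means: after shrinking $U$, $X$ is the local leaf space of the complex rank one foliation generated by $H_N$ on $U$, holomorphic sections of $L$ are the holomorphic functions $f$ with $\mathcal L_{H_N}f=f$, and $J$ is the restriction of the Poisson bracket to such functions. *)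

theory Defs
  imports "HOL-Analysis.Analysis"
begin

section \<open>Calculus on coordinate spaces\<close>

text \<open>For a set \<open>I\<close> of indices, \<open>coord_space I\<close> is a copy of the complex space of dimension
  \<open>card I\<close>, realised inside \<open>complex ^ 'n\<close>.  This allows manifolds of different dimensions
  (including dimension 0, for \<open>I = {}\<close>) to be treated over the same index type.\<close>

definition coord_space :: "'n::finite set \<Rightarrow> (complex ^ 'n) set" where
  "coord_space I = {z. \<forall>i. i \<notin> I \<longrightarrow> z $ i = 0}"

text \<open>Holomorphy in several variables: complex-linear Frechet derivative at every point.
  The set \<open>S\<close> is always a relatively open subset of \<open>coord_space I\<close>.\<close>

definition holo_on :: "'n::finite set \<Rightarrow> (complex ^ 'n) set \<Rightarrow> (complex ^ 'n \<Rightarrow> complex) \<Rightarrow> bool" where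
  "holo_on I S f \<longleftrightarrow>
     (\<forall>z\<in>S. \<exists>a. (f has_derivative (\<lambda>h. \<Sum>i\<in>I. a i * h $ i)) (at z within S))"

definition cpartial :: "'n::finite \<Rightarrow> (complex ^ 'n \<Rightarrow> complex) \<Rightarrow> complex ^ 'n \<Rightarrow> complex" where
  "cpartial i f z = deriv (\<lambda>w. f (z + axis i w)) 0"

definition dir_deriv ::
  "complex ^ 'n::finite \<Rightarrow> (complex ^ 'n \<Rightarrow> complex) \<Rightarrow> complex ^ 'n \<Rightarrow> complex" where
  "dir_deriv u f z = vector_derivative (\<lambda>s::real. f (z + s *\<^sub>R u)) (at 0)"

definition real_directions :: "'n::finite set \<Rightarrow> (complex ^ 'n) set" where
  "real_directions I = {axis i u | i u. i \<in> I \<and> u \<in> {1, \<i>}}"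

text \<open>Continuous differentiability up to order \<open>k\<close> in the \<open>2 * card I\<close> real coordinates.\<close>

primrec ck_on :: "'n::finite set \<Rightarrow> nat \<Rightarrow> (complex ^ 'n) set \<Rightarrow> (complex ^ 'n \<Rightarrow> complex) \<Rightarrow> bool" where
  "ck_on I 0 S f \<longleftrightarrow> continuous_on S f"
| "ck_on I (Suc k) S f \<longleftrightarrow> continuous_on S f \<and>
     (\<forall>u\<in>real_directions I.
        (\<forall>z\<in>S. (\<lambda>s::real. f (z + s *\<^sub>R u)) differentiable (at 0)) \<and> ck_on I k S (dir_deriv u f))"

definition smooth_on :: "'n::finite set \<Rightarrow> (complex ^ 'n) set \<Rightarrow> (complex ^ 'n \<Rightarrow> complex) \<Rightarrow> bool" where
  "smooth_on I S f \<longleftrightarrow> (\<forall>k. ck_on I k S f)"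

text \<open>The Wirtinger derivative with respect to the \<open>i\<close>-th holomorphic coordinate.\<close>

definition wirtinger :: "'n::finite \<Rightarrow> (complex ^ 'n \<Rightarrow> complex) \<Rightarrow> complex ^ 'n \<Rightarrow> complex" where
  "wirtinger i f z = (dir_deriv (axis i 1) f z - \<i> * dir_deriv (axis i \<i>) f z) / 2"


section \<open>Complex manifolds\<close>

text \<open>A complex manifold is given by a holomorphic atlas; a chart is a pair of its domain and its
  coordinate map.  The underlying set and the topology are those determined by the atlas.\<close>

type_synonym ('a, 'n) chart = "'a set \<times> ('a \<Rightarrow> complex ^ 'n)"
type_synonym ('a, 'n) atlas = "('a, 'n) chart set"

definition points :: "('a, 'n::finite) atlas \<Rightarrow> 'a set" where
  "points A = (\<Union>c\<in>A. fst c)"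

definition atlas_topology :: "('a, 'n::finite) atlas \<Rightarrow> 'a topology" where
  "atlas_topology A =
     topology_generated_by {{p \<in> fst c. snd c p \<in> S} | c S. c \<in> A \<and> open S}"

definition in_chart :: "('a, 'n::finite) chart \<Rightarrow> ('a \<Rightarrow> 'b) \<Rightarrow> complex ^ 'n \<Rightarrow> 'b" where
  "in_chart c f z = f (inv_into (fst c) (snd c) z)"

definition complex_manifold :: "'n::finite set \<Rightarrow> ('a, 'n) atlas \<Rightarrow> bool" where
  "complex_manifold I A \<longleftrightarrow>
     (\<forall>c\<in>A. inj_on (snd c) (fst c) \<and>
             openin (top_of_set (coord_space I)) (snd c ` fst c)) \<and>
     (\<forall>c\<in>A. \<forall>d\<in>A.
        openin (top_of_set (coord_space I)) (snd c ` (fst c \<inter> fst d)) \<and>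
        (\<forall>i\<in>I. holo_on I (snd c ` (fst c \<inter> fst d)) (in_chart c (\<lambda>p. snd d p $ i)))) \<and>
     Hausdorff_space (atlas_topology A) \<and>
     second_countable (atlas_topology A)"

definition holo_fun :: "'n::finite set \<Rightarrow> ('a, 'n) atlas \<Rightarrow> 'a set \<Rightarrow> ('a \<Rightarrow> complex) \<Rightarrow> bool" where
  "holo_fun I A W f \<longleftrightarrow> (\<forall>c\<in>A. holo_on I (snd c ` (fst c \<inter> W)) (in_chart c f))"

definition smooth_fun :: "'n::finite set \<Rightarrow> ('a, 'n) atlas \<Rightarrow> 'a set \<Rightarrow> ('a \<Rightarrow> complex) \<Rightarrow> bool" where
  "smooth_fun I A W f \<longleftrightarrow> (\<forall>c\<in>A. smooth_on I (snd c ` (fst c \<inter> W)) (in_chart c f))"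

definition holo_map ::
  "'n::finite set \<Rightarrow> ('a, 'n) atlas \<Rightarrow> 'a set \<Rightarrow> 'm::finite set \<Rightarrow> ('b, 'm) atlas \<Rightarrow> ('a \<Rightarrow> 'b) \<Rightarrow> bool" where
  "holo_map I A W K B F \<longleftrightarrow>
     continuous_map (subtopology (atlas_topology A) W) (atlas_topology B) F \<and>
     (\<forall>c\<in>A. \<forall>d\<in>B. \<forall>i\<in>K.
        holo_on I (snd c ` {p \<in> fst c \<inter> W. F p \<in> fst d}) (in_chart c (\<lambda>p. snd d (F p) $ i)))"

definition open_embedding ::
  "'n::finite set \<Rightarrow> ('a, 'n) atlas \<Rightarrow> 'a set \<Rightarrow> 'm::finite set \<Rightarrow> ('b, 'm) atlas \<Rightarrow> ('a \<Rightarrow> 'b) \<Rightarrow> bool" where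
  "open_embedding I A W K B F \<longleftrightarrow>
     holo_map I A W K B F \<and> inj_on F W \<and> openin (atlas_topology B) (F ` W) \<and>
     holo_map K B (F ` W) I A (inv_into W F)"


section \<open>Vector fields and bivector fields\<close>

text \<open>A tensor field assigns to every chart and every point of its domain the components of the
  tensor in that chart, subject to the transformation law under change of charts.  The holomorphic
  Jacobian matrix of \<open>F\<close> in charts \<open>c\<close>, \<open>d\<close> acts on components by \<open>push_vec\<close> and \<open>push_biv\<close>;
  the transformation law is the case where \<open>F\<close> is the identity.\<close>

type_synonym ('a, 'n) vfield = "('a, 'n) chart \<Rightarrow> 'a \<Rightarrow> complex ^ 'n"
type_synonym ('a, 'n) bfield = "('a, 'n) chart \<Rightarrow> 'a \<Rightarrow> complex ^ 'n ^ 'n"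

definition jac ::
  "('a \<Rightarrow> 'b) \<Rightarrow> ('a, 'n::finite) chart \<Rightarrow> ('b, 'm::finite) chart \<Rightarrow> 'a \<Rightarrow> 'm \<Rightarrow> 'n \<Rightarrow> complex" where
  "jac F c d p i j = cpartial j (in_chart c (\<lambda>q. snd d (F q) $ i)) (snd c p)"

definition push_vec ::
  "'n::finite set \<Rightarrow> ('a \<Rightarrow> 'b) \<Rightarrow> ('a, 'n) chart \<Rightarrow> ('b, 'm::finite) chart \<Rightarrow> 'a \<Rightarrow>
   complex ^ 'n \<Rightarrow> complex ^ 'm" where
  "push_vec I F c d p v = (\<chi> i. \<Sum>j\<in>I. jac F c d p i j * v $ j)"

definition push_biv ::
  "'n::finite set \<Rightarrow> ('a \<Rightarrow> 'b) \<Rightarrow> ('a, 'n) chart \<Rightarrow> ('b, 'm::finite) chart \<Rightarrow> 'a \<Rightarrow>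
   complex ^ 'n ^ 'n \<Rightarrow> complex ^ 'm ^ 'm" where
  "push_biv I F c d p b =
     (\<chi> i j. \<Sum>k\<in>I. \<Sum>l\<in>I. jac F c d p i k * jac F c d p j l * b $ k $ l)"

definition vf_related ::
  "'n::finite set \<Rightarrow> ('a, 'n) atlas \<Rightarrow> 'a set \<Rightarrow> ('b, 'm::finite) atlas \<Rightarrow> ('a \<Rightarrow> 'b) \<Rightarrow>
   ('a, 'n) vfield \<Rightarrow> ('b, 'm) vfield \<Rightarrow> bool" where
  "vf_related I A W B F v w \<longleftrightarrow>
     (\<forall>c\<in>A. \<forall>d\<in>B. \<forall>p\<in>fst c \<inter> W. F p \<in> fst d \<longrightarrow> w d (F p) = push_vec I F c d p (v c p))"

definition bf_related ::
  "'n::finite set \<Rightarrow> ('a, 'n) atlas \<Rightarrow> 'a set \<Rightarrow> ('b, 'm::finite) atlas \<Rightarrow> ('a \<Rightarrow> 'b) \<Rightarrow>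
   ('a, 'n) bfield \<Rightarrow> ('b, 'm) bfield \<Rightarrow> bool" where
  "bf_related I A W B F b b' \<longleftrightarrow>
     (\<forall>c\<in>A. \<forall>d\<in>B. \<forall>p\<in>fst c \<inter> W. F p \<in> fst d \<longrightarrow> b' d (F p) = push_biv I F c d p (b c p))"

definition vector_field ::
  "'n::finite set \<Rightarrow> ('a, 'n) atlas \<Rightarrow> 'a set \<Rightarrow> ('a, 'n) vfield \<Rightarrow> bool" where
  "vector_field I A W v \<longleftrightarrow>
     (\<forall>c\<in>A. \<forall>p\<in>fst c \<inter> W. v c p \<in> coord_space I) \<and> vf_related I A W A (\<lambda>p. p) v v"

definition holo_vector_field ::
  "'n::finite set \<Rightarrow> ('a, 'n) atlas \<Rightarrow> 'a set \<Rightarrow> ('a, 'n) vfield \<Rightarrow> bool" where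
  "holo_vector_field I A W v \<longleftrightarrow> vector_field I A W v \<and>
     (\<forall>c\<in>A. \<forall>i\<in>I. holo_on I (snd c ` (fst c \<inter> W)) (in_chart c (\<lambda>p. v c p $ i)))"

text \<open>Smooth sections of \<open>T\<^sup>1\<^sup>,\<^sup>0\<close> over \<open>W\<close>.\<close>

definition smooth_vector_field ::
  "'n::finite set \<Rightarrow> ('a, 'n) atlas \<Rightarrow> 'a set \<Rightarrow> ('a, 'n) vfield \<Rightarrow> bool" where
  "smooth_vector_field I A W v \<longleftrightarrow> vector_field I A W v \<and>
     (\<forall>c\<in>A. \<forall>i\<in>I. smooth_on I (snd c ` (fst c \<inter> W)) (in_chart c (\<lambda>p. v c p $ i)))"

text \<open>The skew matrix \<open>b\<close> stands for the bivector
  \<open>1/2 * (\<Sum>i j. b $ i $ j * \<partial>\<^sub>i \<and> \<partial>\<^sub>j)\<close>.\<close>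

definition holo_bivector_field ::
  "'n::finite set \<Rightarrow> ('a, 'n) atlas \<Rightarrow> 'a set \<Rightarrow> ('a, 'n) bfield \<Rightarrow> bool" where
  "holo_bivector_field I A W b \<longleftrightarrow>
     (\<forall>c\<in>A. \<forall>p\<in>fst c \<inter> W.
        (\<forall>i j. b c p $ i $ j = - b c p $ j $ i) \<and>
        (\<forall>i j. i \<notin> I \<longrightarrow> b c p $ i $ j = 0)) \<and>
     bf_related I A W A (\<lambda>p. p) b b \<and>
     (\<forall>c\<in>A. \<forall>i\<in>I. \<forall>j\<in>I.
        holo_on I (snd c ` (fst c \<inter> W)) (in_chart c (\<lambda>p. b c p $ i $ j)))"

text \<open>In the chart \<open>c\<close> at \<open>p\<close>: the derivative \<open>v(f)\<close> of a holomorphic function, the derivative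
  \<open>v(f)\<close> of a smooth function along a field of type (1,0), and \<open>b(\<partial>f, \<partial>g)\<close> for holomorphic
  functions.  The values do not depend on the chart.\<close>

definition vf_holo ::
  "'n::finite set \<Rightarrow> ('a, 'n) vfield \<Rightarrow> ('a, 'n) chart \<Rightarrow> ('a \<Rightarrow> complex) \<Rightarrow> 'a \<Rightarrow> complex" where
  "vf_holo I v c f p = (\<Sum>i\<in>I. v c p $ i * cpartial i (in_chart c f) (snd c p))"

definition vf_smooth ::
  "'n::finite set \<Rightarrow> ('a, 'n) vfield \<Rightarrow> ('a, 'n) chart \<Rightarrow> ('a \<Rightarrow> complex) \<Rightarrow> 'a \<Rightarrow> complex" where
  "vf_smooth I v c f p = (\<Sum>i\<in>I. v c p $ i * wirtinger i (in_chart c f) (snd c p))"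

definition bf_pair ::
  "'n::finite set \<Rightarrow> ('a, 'n) bfield \<Rightarrow> ('a, 'n) chart \<Rightarrow> ('a \<Rightarrow> complex) \<Rightarrow> ('a \<Rightarrow> complex) \<Rightarrow>
   'a \<Rightarrow> complex" where
  "bf_pair I b c f g p =
     (\<Sum>i\<in>I. \<Sum>j\<in>I. b c p $ i $ j *
        cpartial i (in_chart c f) (snd c p) * cpartial j (in_chart c g) (snd c p))"


section \<open>Homogeneous holomorphic Poisson structures\<close>

text \<open>Components of the Schouten bracket of two bivector fields, and of the Lie derivative of a
  bivector field, in a chart.\<close>

definition schouten ::
  "'n::finite set \<Rightarrow> ('a, 'n) bfield \<Rightarrow> ('a, 'n) bfield \<Rightarrow> ('a, 'n) chart \<Rightarrow> 'a \<Rightarrow>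
   'n \<Rightarrow> 'n \<Rightarrow> 'n \<Rightarrow> complex" where
  "schouten I P Q c p i j k =
     (let term = (\<lambda>R S r s t. \<Sum>l\<in>I. R c p $ l $ r * cpartial l (in_chart c (\<lambda>q. S c q $ s $ t)) (snd c p))
      in (term P Q i j k + term Q P i j k) + (term P Q j k i + term Q P j k i)
         + (term P Q k i j + term Q P k i j))"

definition lie_bivector ::
  "'n::finite set \<Rightarrow> ('a, 'n) vfield \<Rightarrow> ('a, 'n) bfield \<Rightarrow> ('a, 'n) chart \<Rightarrow> 'a \<Rightarrow> 'n \<Rightarrow> 'n \<Rightarrow> complex" where
  "lie_bivector I h b c p i j =
     (\<Sum>l\<in>I. h c p $ l * cpartial l (in_chart c (\<lambda>q. b c q $ i $ j)) (snd c p)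
             - b c p $ l $ j * cpartial l (in_chart c (\<lambda>q. h c q $ i)) (snd c p)
             - b c p $ i $ l * cpartial l (in_chart c (\<lambda>q. h c q $ j)) (snd c p))"

definition homogeneous_poisson ::
  "'n::finite set \<Rightarrow> ('a, 'n) atlas \<Rightarrow> ('a, 'n) bfield \<Rightarrow> ('a, 'n) vfield \<Rightarrow> bool" where
  "homogeneous_poisson I A b h \<longleftrightarrow>
     holo_bivector_field I A (points A) b \<and>
     holo_vector_field I A (points A) h \<and>
     (\<forall>c\<in>A. \<forall>p\<in>fst c. \<forall>i\<in>I. \<forall>j\<in>I. \<forall>k\<in>I. schouten I b b c p i j k = 0) \<and>
     (\<forall>c\<in>A. \<forall>p\<in>fst c. \<forall>i\<in>I. \<forall>j\<in>I. lie_bivector I h b c p i j = - b c p $ i $ j)"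

definition nonzero_at :: "('a, 'n::finite) atlas \<Rightarrow> ('a, 'n) vfield \<Rightarrow> 'a \<Rightarrow> bool" where
  "nonzero_at A v p \<longleftrightarrow> (\<forall>c\<in>A. p \<in> fst c \<longrightarrow> v c p \<noteq> 0)"


section \<open>Holomorphic line bundles and Jacobi bi-derivations\<close>

text \<open>The trivializations of a line bundle are pairs of an open subset \<open>V\<close> of the base and a map
  to the complex numbers that is a linear isomorphism on each fibre over \<open>V\<close>.\<close>

record ('x, 'e) line_bundle =
  total :: "'e set"
  proj :: "'e \<Rightarrow> 'x"
  fadd :: "'e \<Rightarrow> 'e \<Rightarrow> 'e"
  fscale :: "complex \<Rightarrow> 'e \<Rightarrow> 'e"
  triv :: "('x set \<times> ('e \<Rightarrow> complex)) set"

definition fibre :: "('x, 'e) line_bundle \<Rightarrow> 'x \<Rightarrow> 'e set" where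
  "fibre L x = {v \<in> total L. proj L v = x}"

text \<open>The local frame determined by a trivialization.\<close>

definition frame :: "('x, 'e) line_bundle \<Rightarrow> ('e \<Rightarrow> complex) \<Rightarrow> 'x \<Rightarrow> 'e" where
  "frame L \<tau> x = inv_into (fibre L x) \<tau> 1"

definition fibre_linear :: "('x, 'e) line_bundle \<Rightarrow> 'x \<Rightarrow> ('e \<Rightarrow> complex) \<Rightarrow> bool" where
  "fibre_linear L x \<xi> \<longleftrightarrow>
     (\<forall>u\<in>fibre L x. \<forall>v\<in>fibre L x. \<xi> (fadd L u v) = \<xi> u + \<xi> v) \<and>
     (\<forall>a. \<forall>u\<in>fibre L x. \<xi> (fscale L a u) = a * \<xi> u)"

text \<open>The vector space axioms in the fibres follow from the existence of the fibrewise linear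
  bijections.\<close>

definition holo_line_bundle ::
  "'n::finite set \<Rightarrow> ('x, 'n) atlas \<Rightarrow> ('x, 'e) line_bundle \<Rightarrow> bool" where
  "holo_line_bundle I A L \<longleftrightarrow>
     proj L ` total L = points A \<and>
     (\<forall>x\<in>points A. \<forall>u\<in>fibre L x.
        (\<forall>v\<in>fibre L x. fadd L u v \<in> fibre L x) \<and> (\<forall>a. fscale L a u \<in> fibre L x)) \<and>
     (\<Union>t\<in>triv L. fst t) = points A \<and>
     (\<forall>(V, \<tau>)\<in>triv L. openin (atlas_topology A) V \<and>
        (\<forall>x\<in>V. bij_betw \<tau> (fibre L x) UNIV \<and> fibre_linear L x \<tau>)) \<and>
     (\<forall>(V, \<tau>)\<in>triv L. \<forall>(V', \<tau>')\<in>triv L. holo_fun I A (V \<inter> V') (\<lambda>x. \<tau>' (frame L \<tau> x)))"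

definition smooth_sections ::
  "'n::finite set \<Rightarrow> ('x, 'n) atlas \<Rightarrow> ('x, 'e) line_bundle \<Rightarrow> 'x set \<Rightarrow> ('x \<Rightarrow> 'e) set" where
  "smooth_sections I A L W =
     {s \<in> Pi\<^sub>E W (fibre L). \<forall>(V, \<tau>)\<in>triv L. smooth_fun I A (V \<inter> W) (\<lambda>x. \<tau> (s x))}"

definition holo_sections ::
  "'n::finite set \<Rightarrow> ('x, 'n) atlas \<Rightarrow> ('x, 'e) line_bundle \<Rightarrow> 'x set \<Rightarrow> ('x \<Rightarrow> 'e) set" where
  "holo_sections I A L W =
     {s \<in> Pi\<^sub>E W (fibre L). \<forall>(V, \<tau>)\<in>triv L. holo_fun I A (V \<inter> W) (\<lambda>x. \<tau> (s x))}"

definition sec_add ::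
  "('x, 'e) line_bundle \<Rightarrow> 'x set \<Rightarrow> ('x \<Rightarrow> 'e) \<Rightarrow> ('x \<Rightarrow> 'e) \<Rightarrow> 'x \<Rightarrow> 'e" where
  "sec_add L W s t = (\<lambda>x\<in>W. fadd L (s x) (t x))"

definition sec_scale ::
  "('x, 'e) line_bundle \<Rightarrow> 'x set \<Rightarrow> ('x \<Rightarrow> complex) \<Rightarrow> ('x \<Rightarrow> 'e) \<Rightarrow> 'x \<Rightarrow> 'e" where
  "sec_scale L W f s = (\<lambda>x\<in>W. fscale L (f x) (s x))"

text \<open>Differential operators are local, so a bi-derivation acts compatibly on the sections over
  every open set; \<open>J W\<close> is its action on sections over \<open>W\<close>.\<close>

type_synonym ('x, 'e) bracket = "'x set \<Rightarrow> ('x \<Rightarrow> 'e) \<Rightarrow> ('x \<Rightarrow> 'e) \<Rightarrow> 'x \<Rightarrow> 'e"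

text \<open>\<open>D\<close> is a first order differential operator on the sections over \<open>W\<close> whose symbol is the
  vector field \<open>v\<close>.\<close>

definition has_symbol ::
  "'n::finite set \<Rightarrow> ('x, 'n) atlas \<Rightarrow> ('x, 'e) line_bundle \<Rightarrow> 'x set \<Rightarrow>
   (('x \<Rightarrow> 'e) \<Rightarrow> 'x \<Rightarrow> 'e) \<Rightarrow> ('x, 'n) vfield \<Rightarrow> bool" where
  "has_symbol I A L W D v \<longleftrightarrow>
     (\<forall>t\<in>smooth_sections I A L W. \<forall>f. smooth_fun I A W f \<longrightarrow>
        (\<forall>c\<in>A. \<forall>x\<in>fst c \<inter> W.
           D (sec_scale L W f t) x =
             fadd L (fscale L (vf_smooth I v c f x) (t x)) (fscale L (f x) (D t x))))"

definition holo_jacobi_biderivation ::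
  "'n::finite set \<Rightarrow> ('x, 'n) atlas \<Rightarrow> ('x, 'e) line_bundle \<Rightarrow> ('x, 'e) bracket \<Rightarrow> bool" where
  "holo_jacobi_biderivation I A L J \<longleftrightarrow>
     (\<forall>W. openin (atlas_topology A) W \<longrightarrow>
       (let \<Gamma> = smooth_sections I A L W; \<O> = holo_sections I A L W in
         (\<forall>s\<in>\<Gamma>. \<forall>t\<in>\<Gamma>. J W s t \<in> \<Gamma>) \<and>
         (\<forall>W'. openin (atlas_topology A) W' \<and> W' \<subseteq> W \<longrightarrow>
            (\<forall>s\<in>\<Gamma>. \<forall>t\<in>\<Gamma>. J W' (restrict s W') (restrict t W') = restrict (J W s t) W')) \<and>
         (\<forall>s\<in>\<Gamma>. \<forall>t\<in>\<Gamma>. J W s t = sec_scale L W (\<lambda>_. - 1) (J W t s)) \<and>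
         (\<forall>s\<in>\<Gamma>. \<forall>t\<in>\<Gamma>. \<forall>u\<in>\<Gamma>. J W (sec_add L W s t) u = sec_add L W (J W s u) (J W t u) \<and>
                                J W u (sec_add L W s t) = sec_add L W (J W u s) (J W u t)) \<and>
         (\<forall>a. \<forall>s\<in>\<Gamma>. \<forall>t\<in>\<Gamma>.
            J W (sec_scale L W (\<lambda>_. a) s) t = sec_scale L W (\<lambda>_. a) (J W s t) \<and>
            J W s (sec_scale L W (\<lambda>_. a) t) = sec_scale L W (\<lambda>_. a) (J W s t)) \<and>
         (\<forall>s\<in>\<Gamma>. \<exists>v. smooth_vector_field I A W v \<and> has_symbol I A L W (J W s) v) \<and>
         (\<forall>s\<in>\<O>. \<forall>t\<in>\<O>. J W s t \<in> \<O>) \<and>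
         (\<forall>s\<in>\<Gamma>. \<forall>t\<in>\<Gamma>. \<forall>u\<in>\<Gamma>.
            sec_add L W (sec_add L W (J W s (J W t u)) (J W t (J W u s))) (J W u (J W s t))
              = sec_scale L W (\<lambda>_. 0) s)))"

definition holo_jacobi_manifold ::
  "'n::finite set \<Rightarrow> ('x, 'n) atlas \<Rightarrow> ('x, 'e) line_bundle \<Rightarrow> ('x, 'e) bracket \<Rightarrow> bool" where
  "holo_jacobi_manifold I A L J \<longleftrightarrow>
     complex_manifold I A \<and> holo_line_bundle I A L \<and> holo_jacobi_biderivation I A L J"


section \<open>Poissonization\<close>

text \<open>Points of the slit dual are pairs of a base point and a nonzero functional on the fibre.
  A chart of the base and a trivialization give a chart of the slit dual, modelled on
  \<open>coord_space (insert k I)\<close> with \<open>k \<notin> I\<close>: the base coordinates together with the coordinate of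
  the functional with respect to the dual frame, placed at index \<open>k\<close>.\<close>

definition slit_dual :: "('x, 'n::finite) atlas \<Rightarrow> ('x, 'e) line_bundle \<Rightarrow> ('x \<times> ('e \<Rightarrow> complex)) set" where
  "slit_dual A L =
     {(x, \<xi>). x \<in> points A \<and> \<xi> \<in> extensional (fibre L x) \<and> fibre_linear L x \<xi> \<and>
              (\<exists>v\<in>fibre L x. \<xi> v \<noteq> 0)}"

definition slit_dual_chart ::
  "'n::finite \<Rightarrow> ('x, 'n) atlas \<Rightarrow> ('x, 'e) line_bundle \<Rightarrow> ('x, 'n) chart \<Rightarrow>
   'x set \<times> ('e \<Rightarrow> complex) \<Rightarrow> ('x \<times> ('e \<Rightarrow> complex), 'n) chart" where
  "slit_dual_chart k A L c t =
     ({P \<in> slit_dual A L. fst P \<in> fst c \<inter> fst t},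
      \<lambda>(x, \<xi>). \<chi> i. if i = k then \<xi> (frame L (snd t) x) else snd c x $ i)"

definition slit_dual_atlas ::
  "'n::finite \<Rightarrow> ('x, 'n) atlas \<Rightarrow> ('x, 'e) line_bundle \<Rightarrow> ('x \<times> ('e \<Rightarrow> complex), 'n) atlas" where
  "slit_dual_atlas k A L = {slit_dual_chart k A L c t | c t. c \<in> A \<and> t \<in> triv L}"

text \<open>The fibrewise linear function on the dual corresponding to a section.\<close>

definition lin_fun :: "('x \<Rightarrow> 'e) \<Rightarrow> 'x \<times> ('e \<Rightarrow> complex) \<Rightarrow> complex" where
  "lin_fun s P = snd P (s (fst P))"

text \<open>In every chart of the slit dual the Euler vector field is \<open>w \<partial>/\<partial>w\<close>, where \<open>w\<close> is the
  fibre coordinate.\<close>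

definition euler_field :: "'n::finite \<Rightarrow> ('a, 'n) vfield" where
  "euler_field k c P = axis k (snd c P $ k)"

text \<open>\<open>b\<close> and \<open>h\<close> are the structures of the Poissonization.  The condition determines
  \<open>b\<close> in every chart, since differentials of fibrewise linear holomorphic functions span the
  holomorphic cotangent spaces of the slit dual.\<close>

definition is_poissonization ::
  "'n::finite set \<Rightarrow> 'n \<Rightarrow> ('x, 'n) atlas \<Rightarrow> ('x, 'e) line_bundle \<Rightarrow> ('x, 'e) bracket \<Rightarrow>
   ('x \<times> ('e \<Rightarrow> complex), 'n) bfield \<Rightarrow> ('x \<times> ('e \<Rightarrow> complex), 'n) vfield \<Rightarrow> bool" where
  "is_poissonization I k A L J b h \<longleftrightarrow>
     holo_bivector_field (insert k I) (slit_dual_atlas k A L) (slit_dual A L) b \<and>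
     (\<forall>W. openin (atlas_topology A) W \<longrightarrow>
       (\<forall>s\<in>holo_sections I A L W. \<forall>t\<in>holo_sections I A L W.
         \<forall>c\<in>slit_dual_atlas k A L. \<forall>P\<in>fst c. fst P \<in> W \<longrightarrow>
           bf_pair (insert k I) b c (lin_fun s) (lin_fun t) P = lin_fun (J W s t) P)) \<and>
     h = euler_field k"


section \<open>The leaf space of the foliation generated by a vector field\<close>

text \<open>The leaf in \<open>U\<close> through \<open>p\<close> of the complex rank one foliation generated by a nowhere
  vanishing \<open>h\<close>: all points joined to \<open>p\<close> by a curve in \<open>U\<close> whose velocity is at each time a
  complex multiple of \<open>h\<close>.\<close>

definition leaf :: "('a, 'n::finite) atlas \<Rightarrow> ('a, 'n) vfield \<Rightarrow> 'a set \<Rightarrow> 'a \<Rightarrow> 'a set" where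
  "leaf A h U p =
     {q. \<exists>(\<gamma> :: real \<Rightarrow> 'a) (a :: real \<Rightarrow> complex).
        continuous_map (top_of_set {0..1}) (subtopology (atlas_topology A) U) \<gamma> \<and>
        continuous_on {0..1} a \<and> \<gamma> 0 = p \<and> \<gamma> 1 = q \<and>
        (\<forall>c\<in>A. \<forall>t\<in>{0..1}. \<gamma> t \<in> fst c \<longrightarrow>
           ((\<lambda>r. snd c (\<gamma> r)) has_vector_derivative (a t *s h c (\<gamma> t))) (at t within {0..1}))}"

text \<open>\<open>X\<close> is the space of leaves, with the complex structure for which the projection from \<open>U\<close>
  is a holomorphic submersion.\<close>

definition is_leaf_space ::
  "'n::finite set \<Rightarrow> ('a, 'n) atlas \<Rightarrow> ('a, 'n) vfield \<Rightarrow> 'a set \<Rightarrow>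
   'n set \<Rightarrow> ('a set, 'n) atlas \<Rightarrow> bool" where
  "is_leaf_space I A h U K X \<longleftrightarrow>
     (\<forall>p\<in>U. nonzero_at A h p) \<and>
     points X = leaf A h U ` U \<and>
     holo_map I A U K X (leaf A h U) \<and>
     (\<forall>c\<in>A. \<forall>d\<in>X. \<forall>p\<in>fst c \<inter> U. leaf A h U p \<in> fst d \<longrightarrow>
        push_vec I (leaf A h U) c d p ` coord_space I = coord_space K)"

text \<open>The Jacobi manifold \<open>(X, L, J)\<close> is the canonical one determined by \<open>b\<close> and \<open>h\<close> on \<open>U\<close>.
  The map \<open>\<Phi>\<close> from \<open>U\<close> to the slit dual of \<open>L\<close> lies over the projection to the leaf space and
  turns sections \<open>s\<close> of \<open>L\<close> into functions on \<open>U\<close>, namely \<open>lin_fun s \<circ> \<Phi>\<close>.\<close>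

definition canonical_jacobi ::
  "'n::finite set \<Rightarrow> ('a, 'n) atlas \<Rightarrow> ('a, 'n) bfield \<Rightarrow> ('a, 'n) vfield \<Rightarrow> 'a set \<Rightarrow>
   'n set \<Rightarrow> ('a set, 'n) atlas \<Rightarrow> ('a set, 'e) line_bundle \<Rightarrow> ('a set, 'e) bracket \<Rightarrow>
   ('a \<Rightarrow> 'a set \<times> ('e \<Rightarrow> complex)) \<Rightarrow> bool" where
  "canonical_jacobi I A b h U K X L J \<Phi> \<longleftrightarrow>
     is_leaf_space I A h U K X \<and>
     (\<forall>p\<in>U. fst (\<Phi> p) = leaf A h U p) \<and>
     (\<forall>V. openin (atlas_topology X) V \<longrightarrow>
        (let W = {p \<in> U. leaf A h U p \<in> V} in
          bij_betw (\<lambda>s. \<lambda>p\<in>W. lin_fun s (\<Phi> p)) (holo_sections K X L V)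
            {f \<in> extensional W. holo_fun I A W f \<and>
               (\<forall>c\<in>A. \<forall>p\<in>fst c \<inter> W. vf_holo I h c f p = f p)} \<and>
          (\<forall>s\<in>holo_sections K X L V. \<forall>t\<in>holo_sections K X L V. \<forall>c\<in>A. \<forall>p\<in>fst c \<inter> W.
             lin_fun (J V s t) (\<Phi> p) =
               bf_pair I b c (\<lambda>q. lin_fun s (\<Phi> q)) (\<lambda>q. lin_fun t (\<Phi> q)) p)))"

end

theory Submission
  imports Defs "HOL-Complex_Analysis.Cauchy_Integral_Formula"
begin

text \<open>Choose coordinates near \<open>x\<close> in which \<open>H = w \<partial>\<^sub>w\<close> and \<open>w\<close> is near 1; they come from a Picard iteration
  and the inverse function theorem.  The leaves are then the slices \<open>z = const\<close>.  The equation
  \<open>L\<^sub>H P = - P\<close> forces the \<open>z z\<close> components of \<open>P\<close> to be \<open>\<beta>(z) / w\<close> and the \<open>w z\<close> components to be independent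
  of \<open>w\<close>, so the functions \<open>w f(z)\<close>, which are the solutions of \<open>H f = f\<close>, are closed under the Poisson bracket.
  On the trivial line bundle over the \<open>z\<close> space this is the Jacobi bracket, and its Jacobi identity, also
  on smooth sections, reduces algebraically to the vanishing of the Schouten bracket.\<close>

section \<open>Holomorphic functions on coordinate spaces\<close>

text \<open>The field is normalised to w d/dw near w = 1 and not to a constant field, because w d/dw
  is the Euler field of the slit dual and w is nonzero there. The box coordinates are thus at once
  coordinates of the Poissonization, and the required biholomorphism is the identity in coordinates.

  The Jacobi identity is required for smooth sections, which have no holomorphic homogeneous
  counterpart, so it is not transported from functions on the box. Instead a coefficient f is
  treated as w f(z) at w = 1, whose derivative in direction k is f itself
  (\<open>ext_deriv\<close>). Poisson and Jacobi bracket then have the same shape, and one algebraic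
  identity, which asks only for symmetric second derivatives, serves both. That symmetry is
  therefore proved for Wirtinger derivatives of smooth functions.

  The fibres of the box in the w direction are discs: leaves are exactly slices, and an equation
  along the fibre determines a function from its values at w = 1. Over such a box the leaf space and
  the slit dual have a single chart each, and the line bundle is trivial.\<close>

lemma coord_space_0 [simp]: "0 \<in> coord_space I"
  by (simp add: coord_space_def)

lemma coord_space_add: "x \<in> coord_space I \<Longrightarrow> y \<in> coord_space I \<Longrightarrow> x + y \<in> coord_space I"
  by (simp add: coord_space_def)

lemma coord_space_diff: "x \<in> coord_space I \<Longrightarrow> y \<in> coord_space I \<Longrightarrow> x - y \<in> coord_space I"
  by (simp add: coord_space_def)

lemma coord_space_scaleR: "x \<in> coord_space I \<Longrightarrow> a *\<^sub>R x \<in> coord_space I"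
  by (simp add: coord_space_def)

lemma axis_in_coord_space: "i \<in> I \<Longrightarrow> axis i w \<in> coord_space I"
  by (auto simp: coord_space_def axis_def)

lemma coord_space_UNIV [simp]: "coord_space UNIV = UNIV"
  by (simp add: coord_space_def)

lemma axis_add: "axis i (a + b) = axis i a + (axis i b :: complex ^ 'n::finite)"
  by (simp add: vec_eq_iff axis_def)

lemma axis_0 [simp]: "axis i 0 = (0 :: complex ^ 'n::finite)"
  by (simp add: vec_eq_iff axis_def)

lemma axis_nth_eq: "axis i w $ j = (if j = i then w else 0)"
  by (simp add: axis_def)

lemma bounded_linear_axis: "bounded_linear (axis i :: complex \<Rightarrow> complex ^ 'n::finite)"
  unfolding linear_conv_bounded_linear[symmetric]
  by (auto intro!: linearI simp: vec_eq_iff axis_def)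

lemmas continuous_on_axis [continuous_intros] = bounded_linear.continuous_on[OF bounded_linear_axis]

lemma norm_axis_complex [simp]: "norm (axis i w :: complex ^ 'n::finite) = norm w"
proof -
  have "(\<Sum>j\<in>UNIV. (norm (if j = i then w else 0))\<^sup>2) = (\<Sum>j\<in>UNIV. if j = i then (norm w)\<^sup>2 else 0)"
    by (rule sum.cong) auto
  then show ?thesis by (simp add: norm_vec_def L2_set_def axis_nth_eq)
qed

abbreviation rel_open :: "'n::finite set \<Rightarrow> (complex ^ 'n) set \<Rightarrow> bool" where
  "rel_open I S \<equiv> openin (top_of_set (coord_space I)) S"

lemma rel_open_subset: "rel_open I S \<Longrightarrow> S \<subseteq> coord_space I"
  using openin_imp_subset by auto

lemma rel_openE:
  assumes "rel_open I S" "z \<in> S"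
  obtains e where "e > 0" "\<And>h. h \<in> coord_space I \<Longrightarrow> norm h < e \<Longrightarrow> z + h \<in> S"
proof -
  from assms obtain e where e: "e > 0" "ball z e \<inter> coord_space I \<subseteq> S"
    and z: "z \<in> coord_space I"
    by (force simp: openin_contains_ball)
  show ?thesis
    by (rule that[OF e(1)]) (use e(2) z in \<open>auto simp: coord_space_add dist_norm intro!: subsetD[OF e(2)]\<close>)
qed

lemma rel_open_axisE:
  assumes "rel_open I S" "z \<in> S" "i \<in> I"
  obtains e where "e > 0" "\<And>w. norm w < e \<Longrightarrow> z + axis i w \<in> S"
proof -
  obtain e where e: "e > 0" "\<And>h. h \<in> coord_space I \<Longrightarrow> norm h < e \<Longrightarrow> z + h \<in> S"
    by (rule rel_openE[OF assms(1,2)]) (rule that; blast)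
  show ?thesis
    by (rule that[OF e(1)]) (simp add: e(2) axis_in_coord_space assms(3))
qed

text \<open>Relative openness puts a small disc of the coordinate line into \<open>S\<close>, so the
  derivative within \<open>S\<close> becomes a full complex derivative there. In particular the
  coefficients of the Frechet derivative are determined.\<close>

lemma has_derivative_axis_line:
  assumes "(f has_derivative (\<lambda>h. \<Sum>j\<in>I. a j * h $ j)) (at z within S)"
    and "rel_open I S" "z \<in> S" "i \<in> I"
  shows "((\<lambda>w. f (z + axis i w)) has_field_derivative a i) (at 0)"
proof -
  obtain e where e: "e > 0" "\<And>w. norm w < e \<Longrightarrow> z + axis i w \<in> S"
    by (rule rel_open_axisE[OF assms(2-4)]) (rule that; blast)
  have 1: "((\<lambda>w. z + axis i w) has_derivative (\<lambda>w. 0 + axis i w)) (at 0 within ball 0 e)"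
    by (intro has_derivative_add has_derivative_const bounded_linear_imp_has_derivative bounded_linear_axis)
  have "(f has_derivative (\<lambda>h. \<Sum>j\<in>I. a j * h $ j)) (at z within (\<lambda>w. z + axis i w) ` ball 0 e)"
    by (rule has_derivative_subset[OF assms(1)]) (use e(2) in auto)
  then have 2: "(f has_derivative (\<lambda>h. \<Sum>j\<in>I. a j * h $ j))
      (at (z + axis i 0) within (\<lambda>w. z + axis i w) ` ball 0 e)"
    by simp
  have 3: "(\<lambda>w. \<Sum>j\<in>I. a j * (0 + axis i w) $ j) = (*) (a i)"
  proof
    fix w
    have "(\<Sum>j\<in>I. a j * (0 + axis i w) $ j) = (\<Sum>j\<in>I. if j = i then a i * w else 0)"
      by (rule sum.cong) (auto simp: axis_nth_eq)
    then show "(\<Sum>j\<in>I. a j * (0 + axis i w) $ j) = a i * w"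
      using assms(4) by simp
  qed
  have 4: "at 0 within ball 0 e = at (0::complex)"
    by (rule at_within_open) (use e(1) in auto)
  show ?thesis
    using has_derivative_in_compose[OF 1 2] unfolding has_field_derivative_def 3 4 .
qed

lemma has_field_derivative_cpartial:
  "((\<lambda>w. f (z + axis i w)) has_field_derivative D) (at 0) \<Longrightarrow> cpartial i f z = D"
  unfolding cpartial_def by (rule DERIV_imp_deriv)

lemma holo_on_axis_derivative:
  assumes "holo_on I S f" "rel_open I S" "z \<in> S" "i \<in> I"
  shows "((\<lambda>w. f (z + axis i w)) has_field_derivative cpartial i f z) (at 0)"
proof -
  obtain a where "(f has_derivative (\<lambda>h. \<Sum>i\<in>I. a i * h $ i)) (at z within S)"
    using assms by (auto simp: holo_on_def)
  from has_derivative_axis_line[OF this assms(2-4)] show ?thesis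
    by (simp add: has_field_derivative_cpartial)
qed

lemma holo_on_has_derivative:
  assumes "holo_on I S f" "rel_open I S" "z \<in> S"
  shows "(f has_derivative (\<lambda>h. \<Sum>i\<in>I. cpartial i f z * h $ i)) (at z within S)"
proof -
  obtain a where a: "(f has_derivative (\<lambda>h. \<Sum>i\<in>I. a i * h $ i)) (at z within S)"
    using assms by (auto simp: holo_on_def)
  have "cpartial i f z = a i" if "i \<in> I" for i
    by (rule has_field_derivative_cpartial[OF has_derivative_axis_line[OF a assms(2,3) that]])
  then show ?thesis using a by simp
qed

lemma holo_on_continuous: "holo_on I S f \<Longrightarrow> continuous_on S f"
  unfolding holo_on_def continuous_on_eq_continuous_within
  by (blast intro: has_derivative_continuous)

text \<open>The hypothesis of Osgood's lemma. In this form closure under differentiation and under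
  uniform limits reduces to one complex variable; \<open>holo_on_iff_axis_holo\<close> shows that on
  relatively open sets nothing has changed.\<close>

definition axis_holo :: "'n::finite set \<Rightarrow> (complex ^ 'n) set \<Rightarrow> (complex ^ 'n \<Rightarrow> complex) \<Rightarrow> bool" where
  "axis_holo I S f \<longleftrightarrow> continuous_on S f \<and>
     (\<forall>z\<in>S. \<forall>i\<in>I. (\<lambda>w. f (z + axis i w)) field_differentiable (at 0))"

lemma axis_holo_cpartial:
  assumes "axis_holo I S f" "z \<in> S" "i \<in> I"
  shows "((\<lambda>w. f (z + axis i w)) has_field_derivative cpartial i f z) (at 0)"
  using assms unfolding axis_holo_def cpartial_def
  by (simp add: DERIV_deriv_iff_field_differentiable)

lemma axis_holo_line:
  assumes "axis_holo I S f" "z + axis i w \<in> S" "i \<in> I"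
  shows "((\<lambda>w. f (z + axis i w)) has_field_derivative cpartial i f (z + axis i w)) (at w)"
proof -
  have "((\<lambda>u. f (z + axis i w + axis i u)) has_field_derivative cpartial i f (z + axis i w)) (at 0)"
    by (rule axis_holo_cpartial[OF assms])
  then have "((\<lambda>u. (\<lambda>w. f (z + axis i w)) (u + w)) has_field_derivative cpartial i f (z + axis i w)) (at 0)"
    by (simp add: axis_add add_ac)
  then show ?thesis
    using DERIV_shift[of "\<lambda>w. f (z + axis i w)" _ 0 w] by simp
qed

text \<open>Cauchy's formula for the derivative: the velocity of \<open>c\<close> is 2 pi \<i> times
  \<open>c\<close>, which cancels one factor of the squared denominator and the constant in front.
  An integral over a fixed real interval is ready for the theorems on integrals with
  parameters.\<close>

lemma deriv_circle_average:
  fixes g :: "complex \<Rightarrow> complex"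
  assumes "continuous_on (cball 0 r) g" "g holomorphic_on ball 0 r" "r > 0"
  defines "c \<equiv> \<lambda>t::real. of_real r * exp (2 * of_real pi * \<i> * of_real t)"
  shows "deriv g 0 = integral (cbox 0 1) (\<lambda>t. g (c t) / c t)"
proof -
  have "(g has_field_derivative 1 / (2 * complex_of_real pi * \<i>) *
        contour_integral (circlepath 0 r) (\<lambda>u. g u / (u - 0)\<^sup>2)) (at 0)"
    by (rule Cauchy_derivative_integral_circlepath(2)) (use assms in auto)
  then have "deriv g 0 = 1 / (2 * complex_of_real pi * \<i>) *
        contour_integral (circlepath 0 r) (\<lambda>u. g u / u\<^sup>2)"
    by (simp add: DERIV_imp_deriv)
  also have "contour_integral (circlepath 0 r) (\<lambda>u. g u / u\<^sup>2) =
     integral (cbox 0 1) (\<lambda>t. g (circlepath 0 r t) / (circlepath 0 r t)\<^sup>2 * vector_derivative (circlepath 0 r) (at t))"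
    by (simp add: contour_integral_integral)
  also have "\<dots> = integral (cbox 0 1) (\<lambda>t. (2 * of_real pi * \<i>) * (g (c t) / c t))"
  proof (rule integral_cong)
    fix t :: real
    have ct: "circlepath 0 r t = c t" by (simp add: c_def circlepath)
    have c0: "c t \<noteq> 0" using assms(3) by (simp add: c_def)
    have "vector_derivative (circlepath 0 r) (at t) = 2 * of_real pi * \<i> * c t"
      unfolding vector_derivative_circlepath c_def by (simp add: mult_ac)
    then show "g (circlepath 0 r t) / (circlepath 0 r t)\<^sup>2 * vector_derivative (circlepath 0 r) (at t)
        = 2 * of_real pi * \<i> * (g (c t) / c t)"
      using c0 unfolding ct by (simp add: power2_eq_square)
  qed
  also have "\<dots> = (2 * of_real pi * \<i>) * integral (cbox 0 1) (\<lambda>t. g (c t) / c t)"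
    by (rule integral_mult_right)
  finally have "deriv g 0 = 1 / (2 * of_real pi * \<i>) * ((2 * of_real pi * \<i>) * integral (cbox 0 1) (\<lambda>t. g (c t) / c t))" .
  moreover have "1 / (2 * of_real pi * \<i>) * ((2 * of_real pi * \<i>) * x) = x" for x :: complex
    by (simp add: field_simps)
  ultimately show ?thesis by simp
qed

context
  fixes I :: "'n::finite set" and S f
  assumes S: "rel_open I S" and f: "axis_holo I S f"
begin

text \<open>A single circle serves for all points near \<open>z0\<close>, so that there the partial
  derivative is an integral over a fixed interval whose integrand depends on the point only through
  \<open>f\<close>.\<close>

lemma cpartial_circle_average:
  assumes "z0 \<in> S" "i \<in> I"
  obtains r and c :: "real \<Rightarrow> complex" where "r > 0" "continuous_on UNIV c" "\<And>t. norm (c t) = r"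
    "\<And>z. z \<in> coord_space I \<Longrightarrow> norm (z - z0) \<le> r \<Longrightarrow> z \<in> S"
    "\<And>z t. z \<in> coord_space I \<Longrightarrow> norm (z - z0) \<le> r \<Longrightarrow> z + axis i (c t) \<in> S"
    "\<And>z. z \<in> coord_space I \<Longrightarrow> norm (z - z0) \<le> r \<Longrightarrow>
       cpartial i f z = integral (cbox 0 1) (\<lambda>t. f (z + axis i (c t)) / c t)"
proof -
  obtain e where e: "e > 0" "\<And>h. h \<in> coord_space I \<Longrightarrow> norm h < e \<Longrightarrow> z0 + h \<in> S"
    by (rule rel_openE[OF S assms(1)]) (rule that; blast)
  \<comment> \<open>The point may move by r and the circle adds another r; 2 r stays below
    e.\<close>
  define r where "r = e / 3"
  define c where "c = (\<lambda>t::real. of_real r * exp (2 * of_real pi * \<i> * of_real t))"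
  have r: "r > 0" using e(1) by (simp add: r_def)
  have z0: "z0 \<in> coord_space I" using rel_open_subset[OF S] assms(1) by auto
  have inS: "z + axis i w \<in> S" if "z \<in> coord_space I" "norm (z - z0) \<le> r" "norm w \<le> r" for z w
  proof -
    have "norm (z - z0 + axis i w) \<le> r + r"
      by (rule order_trans[OF norm_triangle_ineq]) (use that in \<open>simp add: add_mono\<close>)
    also have "\<dots> < e" using e(1) by (simp add: r_def)
    finally have "z0 + (z - z0 + axis i w) \<in> S"
      by (intro e(2) coord_space_add coord_space_diff z0 that axis_in_coord_space assms)
    then show ?thesis by (simp add: algebra_simps)
  qed
  have nc: "norm (c t) = r" for t
    using r by (simp add: c_def norm_mult)
  show ?thesis
  proof (rule that[OF r _ nc])
    show "continuous_on UNIV c" unfolding c_def by (intro continuous_intros)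
    show "z \<in> S" if "z \<in> coord_space I" "norm (z - z0) \<le> r" for z
      using inS[OF that, of 0] r by simp
    show "z + axis i (c t) \<in> S" if "z \<in> coord_space I" "norm (z - z0) \<le> r" for z t
      using inS[OF that] nc by simp
    fix z assume z: "z \<in> coord_space I" "norm (z - z0) \<le> r"
    have "deriv (\<lambda>w. f (z + axis i w)) 0 = integral (cbox 0 1) (\<lambda>t. f (z + axis i (c t)) / c t)"
      unfolding c_def
    proof (rule deriv_circle_average[OF _ _ r])
      have "continuous_on S f" using f by (simp add: axis_holo_def)
      then show "continuous_on (cball 0 r) (\<lambda>w. f (z + axis i w))"
        by (rule continuous_on_compose2) (auto intro!: continuous_intros inS z)
      show "(\<lambda>w. f (z + axis i w)) holomorphic_on ball 0 r"
        unfolding holomorphic_on_def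
      proof
        fix w assume "w \<in> ball (0::complex) r"
        then have "z + axis i w \<in> S" by (intro inS z) auto
        from axis_holo_line[OF f this assms(2)]
        have "(\<lambda>w. f (z + axis i w)) field_differentiable at w"
          unfolding field_differentiable_def by (rule exI)
        then show "(\<lambda>w. f (z + axis i w)) field_differentiable at w within ball 0 r"
          by (rule field_differentiable_at_within)
      qed
    qed
    then show "cpartial i f z = integral (cbox 0 1) (\<lambda>t. f (z + axis i (c t)) / c t)"
      by (simp add: cpartial_def)
  qed
qed

text \<open>The circle average has a jointly continuous integrand, so it depends continuously on the
  point.\<close>

lemma continuous_on_cpartial_aux:
  assumes "i \<in> I"
  shows "continuous_on S (cpartial i f)"
  unfolding continuous_on_eq_continuous_within
proof
  fix z0 assume z0: "z0 \<in> S"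
  show "continuous (at z0 within S) (cpartial i f)"
  proof (rule cpartial_circle_average[OF z0 assms])
  fix r and c :: "real \<Rightarrow> complex" assume r: "r > 0" "continuous_on UNIV c" "\<And>t. norm (c t) = r"
    "\<And>z. z \<in> coord_space I \<Longrightarrow> norm (z - z0) \<le> r \<Longrightarrow> z \<in> S"
    "\<And>z t. z \<in> coord_space I \<Longrightarrow> norm (z - z0) \<le> r \<Longrightarrow> z + axis i (c t) \<in> S"
    "\<And>z. z \<in> coord_space I \<Longrightarrow> norm (z - z0) \<le> r \<Longrightarrow>
       cpartial i f z = integral (cbox 0 1) (\<lambda>t. f (z + axis i (c t)) / c t)"
  define N0 where "N0 = coord_space I \<inter> ball z0 r"
  have N: "z \<in> coord_space I" "norm (z - z0) \<le> r" if "z \<in> N0" for z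
    using that by (auto simp: N0_def dist_norm norm_minus_commute)
  have c0: "c t \<noteq> 0" for t using r(1) r(3)[of t] by auto
  have "continuous_on S f" using f by (simp add: axis_holo_def)
  then have "continuous_on (N0 \<times> cbox 0 1) (\<lambda>x. f (fst x + axis i (c (snd x))))"
    by (rule continuous_on_compose2)
      (auto intro!: continuous_intros continuous_on_compose2[OF r(2)] r(5) N)
  then have "continuous_on (N0 \<times> cbox 0 1) (\<lambda>(z, t). f (z + axis i (c t)) / c t)"
    unfolding case_prod_unfold
    by (intro continuous_intros continuous_on_compose2[OF r(2)]) (auto simp: c0)
  then have "continuous_on N0 (\<lambda>z. integral (cbox 0 1) (\<lambda>t. f (z + axis i (c t)) / c t))"
    by (rule integral_continuous_on_param)
  then have "continuous_on N0 (cpartial i f)"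
    by (rule continuous_on_eq) (simp only: r(6) N)
  moreover have z0N: "z0 \<in> N0" using r(1) z0 rel_open_subset[OF S] by (auto simp: N0_def)
  ultimately have "continuous (at z0 within N0) (cpartial i f)"
    by (simp add: continuous_on_eq_continuous_within)
  moreover have "at z0 within N0 = at z0 within S"
    by (rule at_within_nhd[of _ "ball z0 r"]) (use r(1) rel_open_subset[OF S] N r(4) in \<open>auto simp: N0_def\<close>)
  ultimately show "continuous (at z0 within S) (cpartial i f)" by simp
  qed
qed

text \<open>Differentiation of the circle average under the integral sign. The differentiated
  integrand contains the j-th partial derivative of \<open>f\<close>, whose continuity is the
  preceding lemma.\<close>

lemma axis_holo_cpartial_aux:
  assumes "i \<in> I"
  shows "axis_holo I S (cpartial i f)"
  unfolding axis_holo_def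
proof (intro conjI ballI continuous_on_cpartial_aux assms)
  fix z j assume z0: "z \<in> S" and j: "j \<in> I"
  show "(\<lambda>w. cpartial i f (z + axis j w)) field_differentiable at 0"
  proof (rule cpartial_circle_average[OF z0 assms])
  fix r and c :: "real \<Rightarrow> complex" assume r: "r > 0" "continuous_on UNIV c" "\<And>t. norm (c t) = r"
    "\<And>y. y \<in> coord_space I \<Longrightarrow> norm (y - z) \<le> r \<Longrightarrow> y \<in> S"
    "\<And>y t. y \<in> coord_space I \<Longrightarrow> norm (y - z) \<le> r \<Longrightarrow> y + axis i (c t) \<in> S"
    "\<And>y. y \<in> coord_space I \<Longrightarrow> norm (y - z) \<le> r \<Longrightarrow>
       cpartial i f y = integral (cbox 0 1) (\<lambda>t. f (y + axis i (c t)) / c t)"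
  have c0: "c t \<noteq> 0" for t using r(1) r(3)[of t] by auto
  have zc: "z \<in> coord_space I" using z0 rel_open_subset[OF S] by auto
  have N: "z + axis j w \<in> coord_space I" "norm (z + axis j w - z) \<le> r" if "w \<in> ball 0 r" for w
    using that j zc by (auto intro!: coord_space_add axis_in_coord_space)
  have contf: "continuous_on S f" using f by (simp add: axis_holo_def)
  have sw: "z + axis i v + axis j w = z + axis j w + axis i v" for v w by (simp add: add_ac)
  have "(\<lambda>w. integral (cbox 0 1) (\<lambda>t. f (z + axis j w + axis i (c t)) / c t)) field_differentiable
      at 0 within ball 0 r"
  proof (rule leibniz_rule_field_differentiable
      [where fx = "\<lambda>w t. cpartial j f (z + axis j w + axis i (c t)) / c t"])
    fix w t assume w: "w \<in> ball (0::complex) r" "t \<in> cbox 0 (1::real)"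
    have "((\<lambda>w. f (z + axis i (c t) + axis j w)) has_field_derivative
        cpartial j f (z + axis i (c t) + axis j w)) (at w)"
      by (rule axis_holo_line[OF f _ j]) (simp only: sw r(5) N w(1))
    then have "((\<lambda>w. f (z + axis j w + axis i (c t))) has_field_derivative
        cpartial j f (z + axis j w + axis i (c t))) (at w within ball 0 r)"
      by (simp add: sw has_field_derivative_at_within)
    then show "((\<lambda>w. f (z + axis j w + axis i (c t)) / c t) has_field_derivative
        cpartial j f (z + axis j w + axis i (c t)) / c t) (at w within ball 0 r)"
      by (rule DERIV_cdivide)
  next
    fix w assume w: "w \<in> ball (0::complex) r"
    have "continuous_on (cbox 0 1) (\<lambda>t. f (z + axis j w + axis i (c t)))"
      by (rule continuous_on_compose2[OF contf])
        (auto intro!: continuous_intros continuous_on_compose2[OF r(2)] r(5) N w)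
    then show "(\<lambda>t. f (z + axis j w + axis i (c t)) / c t) integrable_on cbox 0 1"
      by (intro integrable_continuous continuous_intros continuous_on_compose2[OF r(2)]) (auto simp: c0)
  next
    have "continuous_on (ball 0 r \<times> cbox 0 1) (\<lambda>x. cpartial j f (z + axis j (fst x) + axis i (c (snd x))))"
      by (rule continuous_on_compose2[OF continuous_on_cpartial_aux[OF j]])
        (auto intro!: continuous_intros continuous_on_compose2[OF r(2)] r(5) N)
    then show "continuous_on (ball 0 r \<times> cbox 0 1) (\<lambda>(w, t). cpartial j f (z + axis j w + axis i (c t)) / c t)"
      unfolding case_prod_unfold
      by (intro continuous_intros continuous_on_compose2[OF r(2)]) (auto simp: c0)
  qed (use r(1) in auto)
  moreover have at0: "at 0 within ball 0 r = at (0::complex)"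
    by (rule at_within_open) (use r(1) in auto)
  ultimately have "(\<lambda>w. integral (cbox 0 1) (\<lambda>t. f (z + axis j w + axis i (c t)) / c t)) field_differentiable at 0"
    unfolding at0 by -
  then show "(\<lambda>w. cpartial i f (z + axis j w)) field_differentiable at 0"
  proof (rule field_differentiable_transform_within[OF r(1) UNIV_I, rotated])
    fix w :: complex assume "w \<in> UNIV" "dist w 0 < r"
    then have w: "w \<in> ball 0 r" by simp
    from r(6)[OF N(1)[OF w] N(2)[OF w]]
    show "integral (cbox 0 1) (\<lambda>t. f (z + axis j w + axis i (c t)) / c t) = cpartial i f (z + axis j w)" ..
  qed
qed
qed

text \<open>Changing the coordinates of \<open>z\<close> to those of \<open>z + h\<close> one at a time, each step is controlled
  by the one-variable mean value inequality and the continuity of the partial derivatives.\<close>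

lemma axis_holo_has_derivative:
  assumes z: "z \<in> S"
  shows "(f has_derivative (\<lambda>h. \<Sum>i\<in>I. cpartial i f z * h $ i)) (at z within S)"
proof -
  have bl: "bounded_linear (\<lambda>h::complex^'n. \<Sum>i\<in>I. cpartial i f z * h $ i)"
    by (intro bounded_linear_sum bounded_linear_const_mult bounded_linear_vec_nth)
  have zc: "z \<in> coord_space I" using z rel_open_subset[OF S] by auto
  have "\<exists>d>0. \<forall>y\<in>S. norm (y - z) < d \<longrightarrow>
      norm (f y - f z - (\<Sum>i\<in>I. cpartial i f z * (y - z) $ i)) \<le> e * norm (y - z)" if e: "e > 0" for e
  proof -
    \<comment> \<open>Each of the \<open>card I\<close> coordinate steps is allowed this share of
      the error; the 1 covers an empty \<open>I\<close>.\<close>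
    define \<epsilon> where "\<epsilon> = e / (card I + 1)"
    have \<epsilon>: "\<epsilon> > 0" using e by (simp add: \<epsilon>_def)
    obtain d0 where d0: "d0 > 0" "\<And>h. h \<in> coord_space I \<Longrightarrow> norm h < d0 \<Longrightarrow> z + h \<in> S"
      by (rule rel_openE[OF S z]) (rule that; blast)
    have "\<forall>i\<in>I. \<exists>d>0. \<forall>y\<in>S. norm (y - z) < d \<longrightarrow> norm (cpartial i f y - cpartial i f z) \<le> \<epsilon>"
    proof
      fix i assume that: "i \<in> I"
      have "\<exists>d>0. \<forall>y\<in>S. dist y z < d \<longrightarrow> dist (cpartial i f y) (cpartial i f z) < \<epsilon>"
        using continuous_on_cpartial_aux[OF that] z \<epsilon> unfolding continuous_on_iff by blast
      then show "\<exists>d>0. \<forall>y\<in>S. norm (y - z) < d \<longrightarrow> norm (cpartial i f y - cpartial i f z) \<le> \<epsilon>"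
        unfolding dist_norm by (meson less_imp_le)
    qed
    from bchoice[OF this] obtain D where D: "\<And>i. i \<in> I \<Longrightarrow> D i > 0"
      "\<And>i y. i \<in> I \<Longrightarrow> y \<in> S \<Longrightarrow> norm (y - z) < D i \<Longrightarrow> norm (cpartial i f y - cpartial i f z) \<le> \<epsilon>"
      by blast
    define d where "d = Min (insert d0 (D ` I))"
    have d: "d > 0" "d \<le> d0" "\<And>i. i \<in> I \<Longrightarrow> d \<le> D i"
      using d0 D(1) by (simp_all add: d_def Min_gr_iff)
    have est: "norm (f (z + h) - f z - (\<Sum>i\<in>I. cpartial i f z * h $ i)) \<le> e * norm h"
      if h: "h \<in> coord_space I" "norm h < d" for h
    proof -
      define hh where "hh J = (\<chi> i. if i \<in> J then h $ i else 0)" for J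
      have "norm (f (z + hh J) - f z - (\<Sum>i\<in>J. cpartial i f z * h $ i)) \<le> card J * (\<epsilon> * norm h)" if "J \<subseteq> I" for J
        using finite[of J] that
      proof (induction J rule: finite_induct)
        case empty
        then show ?case by (simp add: hh_def zero_vec_def[symmetric])
      next
        case (insert i J)
        have hins: "hh (insert i J) = hh J + axis i (h $ i)"
          using insert(2) by (auto simp: hh_def vec_eq_iff axis_nth_eq)
        have inS: "z + hh J + axis i w \<in> S" "norm (hh J + axis i w) < d" if "w \<in> closed_segment 0 (h $ i)" for w
        proof -
          have "norm w \<le> norm (h $ i)"
            using that segment_bound1[of w 0 "h $ i"] by simp
          then have "norm (hh J + axis i w) \<le> norm h"
            using insert(2) by (intro norm_le_componentwise_cart) (auto simp: hh_def axis_nth_eq)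
          then show *: "norm (hh J + axis i w) < d" using h(2) by simp
          have "hh J + axis i w \<in> coord_space I"
            using insert(4) by (auto simp: coord_space_def hh_def axis_nth_eq)
          from d0(2)[OF this] * d(2) show "z + hh J + axis i w \<in> S" by (simp add: add_ac)
        qed
        \<comment> \<open>With the linear part subtracted, the derivative along this coordinate is
          the variation of the partial derivative, which is small.\<close>
        let ?\<phi> = "\<lambda>w. f (z + hh J + axis i w) - cpartial i f z * w"
        have "norm (?\<phi> (h $ i) - ?\<phi> 0) \<le> \<epsilon> * norm (h $ i - 0)"
        proof (rule field_differentiable_bound[where S = "closed_segment 0 (h $ i)"
              and f' = "\<lambda>w. cpartial i f (z + hh J + axis i w) - cpartial i f z"])
          fix w assume w: "w \<in> closed_segment 0 (h $ i)"
          have "((\<lambda>w. f (z + hh J + axis i w)) has_field_derivative cpartial i f (z + hh J + axis i w)) (at w)"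
            by (rule axis_holo_line[OF f]) (use inS w insert in auto)
          then show "(?\<phi> has_field_derivative cpartial i f (z + hh J + axis i w) - cpartial i f z)
              (at w within closed_segment 0 (h $ i))"
            by (rule has_field_derivative_at_within[OF DERIV_diff[OF _ DERIV_cmult_Id]])
          show "norm (cpartial i f (z + hh J + axis i w) - cpartial i f z) \<le> \<epsilon>"
            using inS[OF w] d(3)[of i] insert(4) by (intro D(2)) (auto simp: add.assoc)
        qed auto
        also have "\<dots> \<le> \<epsilon> * norm h"
          using \<epsilon> Finite_Cartesian_Product.norm_nth_le[of h i] by simp
        finally have 1: "norm (?\<phi> (h $ i) - ?\<phi> 0) \<le> \<epsilon> * norm h" .
        have "f (z + hh (insert i J)) - f z - (\<Sum>i\<in>insert i J. cpartial i f z * h $ i) =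
           (f (z + hh J) - f z - (\<Sum>i\<in>J. cpartial i f z * h $ i)) + (?\<phi> (h $ i) - ?\<phi> 0)"
          using insert(1,2) by (simp add: hins add_ac)
        also have "norm \<dots> \<le> card J * (\<epsilon> * norm h) + \<epsilon> * norm h"
          using insert(3,4) 1 by (intro norm_triangle_le add_mono) auto
        finally show ?case using insert(1,2) by (simp add: algebra_simps)
      qed
      from this[OF subset_refl] have "norm (f (z + hh I) - f z - (\<Sum>i\<in>I. cpartial i f z * h $ i)) \<le> card I * (\<epsilon> * norm h)" .
      also have "hh I = h" using h(1) by (auto simp: hh_def coord_space_def vec_eq_iff)
      also have "card I * (\<epsilon> * norm h) \<le> e * norm h"
      proof -
        have "card I * \<epsilon> \<le> e" using e by (simp add: \<epsilon>_def field_simps)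
        from mult_right_mono[OF this, of "norm h"] show ?thesis by (simp add: mult_ac)
      qed
      finally show ?thesis .
    qed
    show ?thesis
    proof (intro exI[of _ d] conjI ballI impI d)
      fix y assume y: "y \<in> S" "norm (y - z) < d"
      have "y - z \<in> coord_space I" using y(1) zc rel_open_subset[OF S] by (auto intro: coord_space_diff)
      from est[OF this y(2)] show "norm (f y - f z - (\<Sum>i\<in>I. cpartial i f z * (y - z) $ i)) \<le> e * norm (y - z)"
        by simp
    qed
  qed
  then show ?thesis
    unfolding has_derivative_within_alt by (intro conjI bl allI impI) simp
qed

end

lemma holo_on_iff_axis_holo:
  assumes "rel_open I S"
  shows "holo_on I S f \<longleftrightarrow> axis_holo I S f"
proof
  assume "holo_on I S f"
  then show "axis_holo I S f"
    unfolding axis_holo_def field_differentiable_def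
    by (intro conjI ballI exI) (rule holo_on_continuous holo_on_axis_derivative[OF _ assms]; assumption)+
next
  assume "axis_holo I S f"
  then show "holo_on I S f"
    unfolding holo_on_def by (intro ballI exI) (rule axis_holo_has_derivative[OF assms])
qed

lemma holo_on_cpartial:
  assumes "rel_open I S" "holo_on I S f" "i \<in> I"
  shows "holo_on I S (cpartial i f)"
  using axis_holo_cpartial_aux[OF assms(1) _ assms(3)] assms(2) by (simp add: holo_on_iff_axis_holo[OF assms(1)])

lemma holo_onI:
  assumes "rel_open I S" "continuous_on S f"
    and "\<And>z i. z \<in> S \<Longrightarrow> i \<in> I \<Longrightarrow> \<exists>D. ((\<lambda>w. f (z + axis i w)) has_field_derivative D) (at 0)"
  shows "holo_on I S f"
  using assms(2,3) by (simp add: holo_on_iff_axis_holo[OF assms(1)] axis_holo_def field_differentiable_def)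

section \<open>Algebra of holomorphic functions and the chain rule\<close>

lemma holo_on_subset:
  assumes "holo_on I S f" "T \<subseteq> S"
  shows "holo_on I T f"
  unfolding holo_on_def
proof
  fix z assume "z \<in> T"
  with assms obtain a where "(f has_derivative (\<lambda>h. \<Sum>i\<in>I. a i * h $ i)) (at z within S)"
    by (auto simp: holo_on_def)
  from has_derivative_subset[OF this assms(2)]
  show "\<exists>a. (f has_derivative (\<lambda>h. \<Sum>i\<in>I. a i * h $ i)) (at z within T)" by (rule exI[of _ a])
qed

lemma holo_on_cong:
  assumes "\<And>z. z \<in> S \<Longrightarrow> f z = g z"
  shows "holo_on I S f \<longleftrightarrow> holo_on I S g"
proof -
  have "(f has_derivative D) (at z within S) \<longleftrightarrow> (g has_derivative D) (at z within S)" if "z \<in> S" for z D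
    by (rule iffI; rule has_derivative_transform[OF that]) (simp_all add: assms)
  then show ?thesis by (simp add: holo_on_def)
qed

lemma cpartial_cong:
  assumes "rel_open I S" "z \<in> S" "i \<in> I" "\<And>z. z \<in> S \<Longrightarrow> f z = g z"
  shows "cpartial i f z = cpartial i g z"
proof -
  obtain e where e: "e > 0" "\<And>w. norm w < e \<Longrightarrow> z + axis i w \<in> S"
    using rel_open_axisE[OF assms(1-3)] by blast
  have "\<forall>\<^sub>F w in nhds 0. f (z + axis i w) = g (z + axis i w)"
    unfolding eventually_nhds_metric using e assms(4) by (auto intro!: exI[of _ e])
  then show ?thesis
    unfolding cpartial_def by (intro deriv_cong_ev refl)
qed

lemma cpartial_const [simp]: "cpartial i (\<lambda>z. c) z = 0"
  by (simp add: cpartial_def)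

lemma axis_derivative_coord: "((\<lambda>w. (z + axis i w) $ j) has_field_derivative (if i = j then 1 else 0)) (at a)"
proof -
  have "(\<lambda>w. (z + axis i w) $ j) = (if i = j then (\<lambda>w. z $ j + w) else (\<lambda>w. z $ j))"
    by (auto simp: axis_nth_eq)
  then show ?thesis by (auto intro!: derivative_eq_intros)
qed

lemma cpartial_coord: "cpartial i (\<lambda>z. z $ j) z = (if i = j then 1 else 0)"
  by (rule has_field_derivative_cpartial[OF axis_derivative_coord])

lemma holo_on_const: "holo_on I S (\<lambda>z. c)"
  unfolding holo_on_def by (intro ballI exI[of _ "\<lambda>_. 0"]) simp

lemma holo_on_coord:
  assumes "rel_open I S"
  shows "holo_on I S (\<lambda>z. z $ j)"
proof (rule holo_onI[OF assms])
  show "\<exists>D. ((\<lambda>w. (z + axis i w) $ j) has_field_derivative D) (at 0)" for z i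
    by (rule exI, rule axis_derivative_coord)
qed (intro continuous_intros)

context
  fixes I :: "'n::finite set" and S f g
  assumes S: "rel_open I S" and f: "holo_on I S f" and g: "holo_on I S g"
begin

private lemma cont: "continuous_on S f" "continuous_on S g"
  using f g by (auto intro: holo_on_continuous)

private lemma der:
  assumes "z \<in> S" "i \<in> I"
  shows "((\<lambda>w. f (z + axis i w)) has_field_derivative cpartial i f z) (at 0)"
    "((\<lambda>w. g (z + axis i w)) has_field_derivative cpartial i g z) (at 0)"
  using assms holo_on_axis_derivative[OF _ S] f g by auto

lemma holo_on_add: "holo_on I S (\<lambda>z. f z + g z)"
  by (rule holo_onI[OF S]) (use cont in \<open>auto intro!: continuous_intros exI DERIV_add der\<close>)

lemma holo_on_diff: "holo_on I S (\<lambda>z. f z - g z)"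
  by (rule holo_onI[OF S]) (use cont in \<open>auto intro!: continuous_intros exI DERIV_diff der\<close>)

lemma holo_on_mult: "holo_on I S (\<lambda>z. f z * g z)"
  by (rule holo_onI[OF S]) (use cont in \<open>auto intro!: continuous_intros exI DERIV_mult' der\<close>)

lemma cpartial_add: "z \<in> S \<Longrightarrow> i \<in> I \<Longrightarrow> cpartial i (\<lambda>z. f z + g z) z = cpartial i f z + cpartial i g z"
  by (intro has_field_derivative_cpartial DERIV_add der)

lemma cpartial_mult:
  "z \<in> S \<Longrightarrow> i \<in> I \<Longrightarrow> cpartial i (\<lambda>z. f z * g z) z = f z * cpartial i g z + cpartial i f z * g z"
  using has_field_derivative_cpartial[OF DERIV_mult'[OF der]] by simp

lemma holo_on_divide:
  assumes "\<And>z. z \<in> S \<Longrightarrow> g z \<noteq> 0"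
  shows "holo_on I S (\<lambda>z. f z / g z)"
proof (rule holo_onI[OF S])
  show "continuous_on S (\<lambda>z. f z / g z)" using cont assms by (intro continuous_intros) auto
  show "\<exists>D. ((\<lambda>w. f (z + axis i w) / g (z + axis i w)) has_field_derivative D) (at 0)" if "z \<in> S" "i \<in> I" for z i
    by (rule exI, rule DERIV_divide[OF der[OF that]]) (simp add: assms that)
qed

lemma cpartial_divide:
  assumes "z \<in> S" "i \<in> I" "g z \<noteq> 0"
  shows "cpartial i (\<lambda>z. f z / g z) z = (cpartial i f z * g z - f z * cpartial i g z) / (g z * g z)"
proof -
  have "((\<lambda>w. f (z + axis i w) / g (z + axis i w)) has_field_derivative
      (cpartial i f z * g (z + axis i 0) - f (z + axis i 0) * cpartial i g z) / (g (z + axis i 0) * g (z + axis i 0))) (at 0)"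
    by (rule DERIV_divide[OF der[OF assms(1,2)]]) (simp add: assms)
  from has_field_derivative_cpartial[OF this] show ?thesis by simp
qed

end

lemma holo_on_sum:
  assumes "rel_open I S" "\<And>a. a \<in> A \<Longrightarrow> holo_on I S (f a)"
  shows "holo_on I S (\<lambda>z. \<Sum>a\<in>A. f a z)"
  using assms(2) by (induction A rule: infinite_finite_induct) (auto intro!: holo_on_const holo_on_add[OF assms(1)])

lemma cpartial_sum:
  assumes "rel_open I S" "\<And>a. a \<in> A \<Longrightarrow> holo_on I S (f a)" "z \<in> S" "i \<in> I"
  shows "cpartial i (\<lambda>z. \<Sum>a\<in>A. f a z) z = (\<Sum>a\<in>A. cpartial i (f a) z)"
  by (intro has_field_derivative_cpartial DERIV_sum holo_on_axis_derivative[OF assms(2) assms(1,3,4)])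

lemma vec_eq_sum_axis: "v = (\<Sum>j\<in>UNIV. axis j (v $ j))" for v :: "complex ^ 'n::finite"
proof -
  have "(\<Sum>j\<in>UNIV. axis j (v $ j)) $ i = v $ i" for i
  proof -
    have "(\<Sum>j\<in>UNIV. axis j (v $ j)) $ i = (\<Sum>j\<in>UNIV. if j = i then v $ i else 0)"
      unfolding sum_component by (rule sum.cong) (auto simp: axis_nth_eq)
    then show ?thesis by simp
  qed
  then show ?thesis by (simp add: vec_eq_iff)
qed

lemma has_derivative_vec_componentwise:
  fixes F :: "'a::real_normed_vector \<Rightarrow> complex ^ 'm::finite"
  assumes "\<And>j. ((\<lambda>z. F z $ j) has_derivative (\<lambda>h. F' h $ j)) net"
  shows "(F has_derivative F') net"
proof -
  have "((\<lambda>z. \<Sum>j\<in>UNIV. axis j (F z $ j)) has_derivative (\<lambda>h. \<Sum>j\<in>UNIV. axis j (F' h $ j))) net"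
    by (intro has_derivative_sum bounded_linear.has_derivative[OF bounded_linear_axis] assms)
  then show ?thesis unfolding vec_eq_sum_axis[symmetric] .
qed

lemma holo_map_has_derivative:
  fixes F :: "complex ^ 'n::finite \<Rightarrow> complex ^ 'm::finite"
  assumes "rel_open I S" "\<And>j. j \<in> K \<Longrightarrow> holo_on I S (\<lambda>z. F z $ j)" "F ` S \<subseteq> coord_space K" "z \<in> S"
  shows "(F has_derivative (\<lambda>h. \<chi> j. if j \<in> K then \<Sum>i\<in>I. cpartial i (\<lambda>z. F z $ j) z * h $ i else 0)) (at z within S)"
proof (rule has_derivative_vec_componentwise)
  fix j
  show "((\<lambda>z. F z $ j) has_derivative
      (\<lambda>h. (\<chi> j. if j \<in> K then \<Sum>i\<in>I. cpartial i (\<lambda>z. F z $ j) z * h $ i else 0) $ j)) (at z within S)"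
  proof (cases "j \<in> K")
    case True
    then show ?thesis using holo_on_has_derivative[OF assms(2) assms(1,4)] by simp
  next
    case False
    have "((\<lambda>z. 0) has_derivative (\<lambda>h. 0)) (at z within S)" by simp
    then have "((\<lambda>z. F z $ j) has_derivative (\<lambda>h. 0)) (at z within S)"
      by (rule has_derivative_transform[OF assms(4), rotated])
        (use assms(3) False in \<open>auto simp: coord_space_def\<close>)
    with False show ?thesis by simp
  qed
qed

lemma
  fixes F :: "complex ^ 'n::finite \<Rightarrow> complex ^ 'm::finite"
  assumes "rel_open I S" "rel_open K T" "\<And>j. j \<in> K \<Longrightarrow> holo_on I S (\<lambda>z. F z $ j)" "F ` S \<subseteq> T" "holo_on K T f"
  shows holo_on_compose: "holo_on I S (\<lambda>z. f (F z))"
    and cpartial_compose: "\<And>z i. z \<in> S \<Longrightarrow> i \<in> I \<Longrightarrow>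
        cpartial i (\<lambda>z. f (F z)) z = (\<Sum>j\<in>K. cpartial j f (F z) * cpartial i (\<lambda>z. F z $ j) z)"
proof -
  have *: "((\<lambda>z. f (F z)) has_derivative
      (\<lambda>h. \<Sum>i\<in>I. (\<Sum>j\<in>K. cpartial j f (F z) * cpartial i (\<lambda>z. F z $ j) z) * h $ i)) (at z within S)" if z: "z \<in> S" for z
  proof -
    have 1: "(F has_derivative (\<lambda>h. \<chi> j. if j \<in> K then \<Sum>i\<in>I. cpartial i (\<lambda>z. F z $ j) z * h $ i else 0)) (at z within S)"
      by (rule holo_map_has_derivative[OF assms(1,3) _ z]) (use assms(4) rel_open_subset[OF assms(2)] in auto)
    have 2: "(f has_derivative (\<lambda>h. \<Sum>i\<in>K. cpartial i f (F z) * h $ i)) (at (F z) within F ` S)"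
      by (rule has_derivative_subset[OF holo_on_has_derivative[OF assms(5,2)] assms(4)]) (use assms(4) z in auto)
    have 3: "(\<Sum>i\<in>K. cpartial i f (F z) * (\<chi> j. if j \<in> K then \<Sum>i\<in>I. cpartial i (\<lambda>z. F z $ j) z * h $ i else 0) $ i)
       = (\<Sum>i\<in>I. (\<Sum>j\<in>K. cpartial j f (F z) * cpartial i (\<lambda>z. F z $ j) z) * h $ i)" for h
      unfolding sum_distrib_right by (subst sum.swap) (simp add: sum_distrib_left mult.assoc)
    show ?thesis using has_derivative_in_compose[OF 1 2] unfolding 3 .
  qed
  show "holo_on I S (\<lambda>z. f (F z))"
    unfolding holo_on_def by (intro ballI exI, rule *)
  show "cpartial i (\<lambda>z. f (F z)) z = (\<Sum>j\<in>K. cpartial j f (F z) * cpartial i (\<lambda>z. F z $ j) z)"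
    if "z \<in> S" "i \<in> I" for z i
    by (rule has_field_derivative_cpartial[OF has_derivative_axis_line[OF *[OF that(1)] assms(1) that]])
qed

section \<open>Smooth functions and their directional derivatives\<close>

lemma real_directions_subset: "real_directions I \<subseteq> coord_space I"
  by (auto simp: real_directions_def axis_in_coord_space)

lemma scaleR_axis: "s *\<^sub>R axis i u = axis i (of_real s * u :: complex)"
  by (auto simp: vec_eq_iff axis_nth_eq) (simp add: scaleR_conv_of_real)

lemma norm_real_direction: "u \<in> real_directions I \<Longrightarrow> norm u = 1"
  by (auto simp: real_directions_def)

lemma dir_deriv_eqI:
  "((\<lambda>s. f (z + s *\<^sub>R u)) has_vector_derivative D) (at 0) \<Longrightarrow> dir_deriv u f z = D"
  unfolding dir_deriv_def by (rule vector_derivative_at)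

lemma rel_open_lineE:
  assumes "rel_open I S" "z \<in> S" "u \<in> coord_space I"
  obtains e where "e > 0" "\<And>s::real. \<bar>s\<bar> < e \<Longrightarrow> z + s *\<^sub>R u \<in> S"
proof -
  obtain e where e: "e > 0" "\<And>h. h \<in> coord_space I \<Longrightarrow> norm h < e \<Longrightarrow> z + h \<in> S"
    using rel_openE[OF assms(1,2)] by blast
  show ?thesis
  proof (rule that)
    show "e / (norm u + 1) > 0" using e(1) by (simp add: add_nonneg_pos)
    fix s :: real assume s: "\<bar>s\<bar> < e / (norm u + 1)"
    have pos: "norm u + 1 > 0" by (simp add: add_nonneg_pos)
    have "norm (s *\<^sub>R u) \<le> \<bar>s\<bar> * (norm u + 1)" by (simp add: mult_left_mono)
    also have "\<dots> < e" using s pos by (simp add: pos_less_divide_eq)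
    finally show "z + s *\<^sub>R u \<in> S" by (intro e(2) coord_space_scaleR assms(3))
  qed
qed

lemma line_derivative_cong:
  assumes "rel_open I S" "z \<in> S" "u \<in> coord_space I" "\<And>z. z \<in> S \<Longrightarrow> f z = g z"
  shows "((\<lambda>s::real. f (z + s *\<^sub>R u)) has_vector_derivative D) (at 0) \<longleftrightarrow>
         ((\<lambda>s. g (z + s *\<^sub>R u)) has_vector_derivative D) (at 0)"
proof -
  obtain e where e: "e > 0" "\<And>s::real. \<bar>s\<bar> < e \<Longrightarrow> z + s *\<^sub>R u \<in> S"
    using rel_open_lineE[OF assms(1-3)] by blast
  have ev: "\<forall>\<^sub>F s in nhds (0::real). f (z + s *\<^sub>R u) = g (z + s *\<^sub>R u)"
    unfolding eventually_nhds_metric using e assms(4) by (auto intro!: exI[of _ e])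
  show ?thesis
    by (rule has_vector_derivative_cong_ev) (use ev assms(2,4) in auto)
qed

lemma dir_deriv_cong:
  assumes "rel_open I S" "z \<in> S" "u \<in> coord_space I" "\<And>z. z \<in> S \<Longrightarrow> f z = g z"
  shows "dir_deriv u f z = dir_deriv u g z"
  unfolding dir_deriv_def vector_derivative_def
  by (simp only: line_derivative_cong[OF assms(1-3), of f g, OF assms(4)])

lemma line_differentiable_cong:
  fixes f g :: "complex ^ 'n::finite \<Rightarrow> complex"
  assumes "rel_open I S" "z \<in> S" "u \<in> coord_space I" "\<And>z. z \<in> S \<Longrightarrow> f z = g z"
  shows "(\<lambda>s::real. f (z + s *\<^sub>R u)) differentiable (at 0) \<longleftrightarrow>
         (\<lambda>s. g (z + s *\<^sub>R u)) differentiable (at 0)"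
proof -
  have h: "h differentiable (at 0) \<longleftrightarrow> (\<exists>D. (h has_vector_derivative D) (at 0))" for h :: "real \<Rightarrow> complex"
  proof
    assume "h differentiable (at 0)"
    then show "\<exists>D. (h has_vector_derivative D) (at 0)"
      unfolding vector_derivative_works by (rule exI)
  next
    assume "\<exists>D. (h has_vector_derivative D) (at 0)"
    then show "h differentiable (at 0)" by (elim exE) (rule differentiableI_vector)
  qed
  show ?thesis
    using h[of "\<lambda>s. f (z + s *\<^sub>R u)"] h[of "\<lambda>s. g (z + s *\<^sub>R u)"]
      line_derivative_cong[OF assms(1-3), of f g, OF assms(4)] by simp
qed

lemma ck_on_cong:
  assumes "rel_open I S" "\<And>z. z \<in> S \<Longrightarrow> f z = g z"
  shows "ck_on I k S f \<longleftrightarrow> ck_on I k S g"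
  using assms(2)
proof (induction k arbitrary: f g)
  case 0
  then show ?case by (simp add: continuous_on_cong[OF refl 0])
next
  case (Suc k)
  have u: "u \<in> coord_space I" if "u \<in> real_directions I" for u
    using that real_directions_subset by auto
  have 1: "continuous_on S f \<longleftrightarrow> continuous_on S g" by (rule continuous_on_cong[OF refl Suc.prems])
  have 2: "ck_on I k S (dir_deriv u f) \<longleftrightarrow> ck_on I k S (dir_deriv u g)" if "u \<in> real_directions I" for u
    by (rule Suc.IH) (rule dir_deriv_cong[OF assms(1) _ u[OF that] Suc.prems])
  have 3: "(\<lambda>s::real. f (z + s *\<^sub>R u)) differentiable (at 0) \<longleftrightarrow>
         (\<lambda>s. g (z + s *\<^sub>R u)) differentiable (at 0)" if "u \<in> real_directions I" "z \<in> S" for u z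
    by (rule line_differentiable_cong[OF assms(1) that(2) u[OF that(1)] Suc.prems])
  show ?case by (simp add: 1 2 3)
qed

lemma ck_on_SucD: "ck_on I (Suc k) S f \<Longrightarrow> ck_on I k S f"
proof (induction k arbitrary: f)
  case (Suc k)
  have "continuous_on S f \<and> (\<forall>u\<in>real_directions I.
      (\<forall>z\<in>S. (\<lambda>s::real. f (z + s *\<^sub>R u)) differentiable (at 0)) \<and> ck_on I (Suc k) S (dir_deriv u f))"
    using Suc.prems unfolding ck_on.simps(2)[of I "Suc k" S f] .
  then show ?case
    unfolding ck_on.simps(2)[of I k S f] using Suc.IH by blast
qed simp

lemma ck_on_line:
  assumes "ck_on I (Suc k) S f" "z \<in> S" "u \<in> real_directions I"
  shows "((\<lambda>s. f (z + s *\<^sub>R u)) has_vector_derivative dir_deriv u f z) (at 0)"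
  using assms by (simp add: dir_deriv_def vector_derivative_works)

context
  fixes I :: "'n::finite set" and S
  assumes S: "rel_open I S"
begin

text \<open>Allows the derivatives to be given by formulas: \<open>dir_deriv u f\<close> and
  \<open>f' u\<close> agree only on \<open>S\<close>, which suffices by \<open>ck_on_cong\<close>
  because \<open>S\<close> is relatively open.\<close>

lemma ck_on_SucI:
  assumes "continuous_on S f"
    and "\<And>u z. u \<in> real_directions I \<Longrightarrow> z \<in> S \<Longrightarrow> ((\<lambda>s. f (z + s *\<^sub>R u)) has_vector_derivative f' u z) (at 0)"
    and "\<And>u. u \<in> real_directions I \<Longrightarrow> ck_on I k S (f' u)"
  shows "ck_on I (Suc k) S f"
  unfolding ck_on.simps
proof (intro conjI ballI assms(1))
  fix u assume u: "u \<in> real_directions I"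
  show "(\<lambda>s::real. f (z + s *\<^sub>R u)) differentiable at 0" if "z \<in> S" for z
    using assms(2)[OF u that] by (rule differentiableI_vector)
  have "ck_on I k S (dir_deriv u f) \<longleftrightarrow> ck_on I k S (f' u)"
    by (rule ck_on_cong[OF S]) (rule dir_deriv_eqI[OF assms(2)[OF u]])
  then show "ck_on I k S (dir_deriv u f)" using assms(3)[OF u] by simp
qed

lemma ck_on_const: "ck_on I k S (\<lambda>z. c)"
proof (induction k arbitrary: c)
  case (Suc k)
  show ?case
    by (rule ck_on_SucI[where f' = "\<lambda>_ _. 0"]) (auto intro: Suc.IH)
qed auto

lemma ck_on_add: "ck_on I k S f \<Longrightarrow> ck_on I k S g \<Longrightarrow> ck_on I k S (\<lambda>z. f z + g z)"
proof (induction k arbitrary: f g)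
  case (Suc k)
  show ?case
  proof (rule ck_on_SucI[where f' = "\<lambda>u z. dir_deriv u f z + dir_deriv u g z"])
    show "ck_on I k S (\<lambda>z. dir_deriv u f z + dir_deriv u g z)" if "u \<in> real_directions I" for u
      using Suc.prems that by (intro Suc.IH) auto
    show "((\<lambda>s. f (z + s *\<^sub>R u) + g (z + s *\<^sub>R u)) has_vector_derivative
        dir_deriv u f z + dir_deriv u g z) (at 0)" if "u \<in> real_directions I" "z \<in> S" for u z
      by (rule has_vector_derivative_add[OF ck_on_line[OF Suc.prems(1) that(2,1)] ck_on_line[OF Suc.prems(2) that(2,1)]])
  qed (use Suc.prems in \<open>auto intro!: continuous_intros\<close>)
qed (auto intro: continuous_intros)

lemma ck_on_mult: "ck_on I k S f \<Longrightarrow> ck_on I k S g \<Longrightarrow> ck_on I k S (\<lambda>z. f z * g z)"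
proof (induction k arbitrary: f g)
  case (Suc k)
  show ?case
  proof (rule ck_on_SucI[where f' = "\<lambda>u z. f z * dir_deriv u g z + dir_deriv u f z * g z"])
    show "ck_on I k S (\<lambda>z. f z * dir_deriv u g z + dir_deriv u f z * g z)" if "u \<in> real_directions I" for u
      using Suc.prems that ck_on_SucD[OF Suc.prems(1)] ck_on_SucD[OF Suc.prems(2)]
      by (intro ck_on_add Suc.IH) auto
    show "((\<lambda>s. f (z + s *\<^sub>R u) * g (z + s *\<^sub>R u)) has_vector_derivative
        f z * dir_deriv u g z + dir_deriv u f z * g z) (at 0)" if "u \<in> real_directions I" "z \<in> S" for u z
      using has_vector_derivative_mult[OF ck_on_line[OF Suc.prems(1) that(2,1)] ck_on_line[OF Suc.prems(2) that(2,1)]]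
      by simp
  qed (use Suc.prems in \<open>auto intro!: continuous_intros\<close>)
qed (auto intro: continuous_intros)

lemma smooth_on_const: "smooth_on I S (\<lambda>z. c)"
  by (simp add: smooth_on_def ck_on_const)

lemma smooth_on_add: "smooth_on I S f \<Longrightarrow> smooth_on I S g \<Longrightarrow> smooth_on I S (\<lambda>z. f z + g z)"
  by (simp add: smooth_on_def ck_on_add)

lemma smooth_on_mult: "smooth_on I S f \<Longrightarrow> smooth_on I S g \<Longrightarrow> smooth_on I S (\<lambda>z. f z * g z)"
  by (simp add: smooth_on_def ck_on_mult)

lemma smooth_on_sum: "(\<And>a. a \<in> A \<Longrightarrow> smooth_on I S (f a)) \<Longrightarrow> smooth_on I S (\<lambda>z. \<Sum>a\<in>A. f a z)"
  by (induction A rule: infinite_finite_induct) (auto intro!: smooth_on_const smooth_on_add)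

lemma smooth_on_cong: "(\<And>z. z \<in> S \<Longrightarrow> f z = g z) \<Longrightarrow> smooth_on I S f \<longleftrightarrow> smooth_on I S g"
  unfolding smooth_on_def by (intro all_cong1 ck_on_cong[OF S])

lemma smooth_on_line:
  assumes "smooth_on I S f" "z \<in> S" "u \<in> real_directions I"
  shows "((\<lambda>s. f (z + s *\<^sub>R u)) has_vector_derivative dir_deriv u f z) (at 0)"
  by (rule ck_on_line[where k = 0 and S = S and I = I]) (use assms in \<open>simp_all only: smooth_on_def\<close>)

lemma smooth_on_dir_deriv:
  assumes "smooth_on I S f" "u \<in> real_directions I"
  shows "smooth_on I S (dir_deriv u f)"
  unfolding smooth_on_def
proof
  fix k
  have "ck_on I (Suc k) S f" using assms(1) by (simp only: smooth_on_def)
  then show "ck_on I k S (dir_deriv u f)" using assms(2) by simp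
qed

lemma smooth_on_continuous:
  assumes "smooth_on I S f"
  shows "continuous_on S f"
proof -
  have "ck_on I 0 S f" using assms by (simp only: smooth_on_def)
  then show ?thesis by simp
qed

lemma holo_on_line:
  assumes "holo_on I S f" "z \<in> S" "i \<in> I"
  shows "((\<lambda>s. f (z + s *\<^sub>R axis i u)) has_vector_derivative u * cpartial i f z) (at 0)"
proof -
  have "((\<lambda>s. of_real s * u) has_vector_derivative u) (at (0::real))"
    using bounded_linear_imp_has_derivative[OF bounded_linear_scaleR_left[of u]]
    by (simp add: has_vector_derivative_def scaleR_conv_of_real)
  moreover have "((\<lambda>w. f (z + axis i w)) has_field_derivative cpartial i f z) (at (of_real 0 * u))"
    using holo_on_axis_derivative[OF assms(1) S assms(2,3)] by simp
  ultimately show ?thesis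
    using field_vector_diff_chain_at[of "\<lambda>s. of_real s * u" u 0 "\<lambda>w. f (z + axis i w)"]
    by (simp add: o_def scaleR_axis)
qed

text \<open>Along \<open>axis i u\<close> the derivative is \<open>u * cpartial i f\<close>, again
  holomorphic, so the induction on the order repeats itself.\<close>

lemma holo_on_imp_smooth_on:
  assumes "holo_on I S f"
  shows "smooth_on I S f"
  unfolding smooth_on_def
proof
  fix k
  show "ck_on I k S f" using assms
  proof (induction k arbitrary: f)
    case 0
    then show ?case by (simp add: holo_on_continuous)
  next
    case (Suc k)
    have dd: "dir_deriv (axis i u) f z = u * cpartial i f z" if "z \<in> S" "i \<in> I" for i u z
      by (rule dir_deriv_eqI[OF holo_on_line[OF Suc.prems that]])
    show ?case
    proof (rule ck_on_SucI[where f' = "\<lambda>u. dir_deriv u f"])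
      fix v assume "v \<in> real_directions I"
      then obtain i u where v: "v = axis i u" "i \<in> I" by (auto simp: real_directions_def)
      show "((\<lambda>s. f (z + s *\<^sub>R v)) has_vector_derivative dir_deriv v f z) (at 0)" if "z \<in> S" for z
        using holo_on_line[OF Suc.prems that v(2)] dd[OF that v(2)] v(1) by simp
      have "ck_on I k S (\<lambda>z. u * cpartial i f z)"
        by (intro Suc.IH holo_on_mult holo_on_const S holo_on_cpartial Suc.prems v)
      then show "ck_on I k S (dir_deriv v f)"
        using ck_on_cong[OF S, of "dir_deriv v f" "\<lambda>z. u * cpartial i f z" k] dd v by simp
    qed (use Suc.prems in \<open>simp add: holo_on_continuous\<close>)
  qed
qed

end

section \<open>Symmetry of second derivatives; Wirtinger derivatives\<close>

context
  fixes I :: "'n::finite set" and S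
  assumes S: "rel_open I S"
begin

lemma smooth_on_line_at:
  assumes "smooth_on I S f" "z + s *\<^sub>R u \<in> S" "u \<in> real_directions I"
  shows "((\<lambda>s. f (z + s *\<^sub>R u)) has_vector_derivative dir_deriv u f (z + s *\<^sub>R u)) (at s)"
proof -
  have 1: "((\<lambda>r. r - s) has_vector_derivative 1) (at s)"
    using has_vector_derivative_diff[OF has_vector_derivative_id has_vector_derivative_const] by simp
  have "((\<lambda>r. f (z + s *\<^sub>R u + r *\<^sub>R u)) has_vector_derivative dir_deriv u f (z + s *\<^sub>R u)) (at ((\<lambda>r. r - s) s))"
    using smooth_on_line[OF S assms] by simp
  from vector_diff_chain_at[OF 1 this] show ?thesis
    by (simp add: o_def algebra_simps)
qed

text \<open>Schwarz's theorem by integration. The increment of \<open>f\<close> along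
  \<open>u\<close> is the integral of its derivative \<open>A\<close>. Differentiating this in the
  direction \<open>v\<close> under the integral sign expresses the increment of \<open>B\<close>
  along \<open>u\<close> as the integral of the mixed derivative \<open>C\<close>, and the
  derivative in s at 0 is read off.\<close>

lemma dir_deriv_commute:
  assumes f: "smooth_on I S f" and z: "z \<in> S" and u: "u \<in> real_directions I" and v: "v \<in> real_directions I"
  shows "dir_deriv u (dir_deriv v f) z = dir_deriv v (dir_deriv u f) z"
proof -
  obtain e where e: "e > 0" "\<And>h. h \<in> coord_space I \<Longrightarrow> norm h < e \<Longrightarrow> z + h \<in> S"
    using rel_openE[OF S z] by blast
  define \<delta> where "\<delta> = e / 3"
  have \<delta>: "\<delta> > 0" using e(1) by (simp add: \<delta>_def)
  have inS: "z + t *\<^sub>R v + s *\<^sub>R u \<in> S" "z + s *\<^sub>R u + t *\<^sub>R v \<in> S" if "\<bar>s\<bar> \<le> \<delta>" "\<bar>t\<bar> \<le> \<delta>" for s t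
  proof -
    have "norm (t *\<^sub>R v + s *\<^sub>R u) \<le> \<bar>t\<bar> + \<bar>s\<bar>"
      by (rule order_trans[OF norm_triangle_ineq]) (simp add: norm_real_direction[OF u] norm_real_direction[OF v])
    also have "\<dots> < e" using that e(1) by (simp add: \<delta>_def)
    finally have "z + (t *\<^sub>R v + s *\<^sub>R u) \<in> S"
      using u v real_directions_subset by (intro e(2) coord_space_add coord_space_scaleR) auto
    then show "z + t *\<^sub>R v + s *\<^sub>R u \<in> S" "z + s *\<^sub>R u + t *\<^sub>R v \<in> S" by (simp_all add: add_ac)
  qed
  have sw: "z + s *\<^sub>R u + t *\<^sub>R v = z + t *\<^sub>R v + s *\<^sub>R u" for s t by (simp add: add_ac)
  define A where "A = dir_deriv u f"
  define B where "B = dir_deriv v f"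
  define C where "C = dir_deriv v A"
  have sA: "smooth_on I S A" and sB: "smooth_on I S B"
    unfolding A_def B_def by (rule smooth_on_dir_deriv[OF S f u], rule smooth_on_dir_deriv[OF S f v])
  have sC: "smooth_on I S C" unfolding C_def by (rule smooth_on_dir_deriv[OF S sA v])
  have cA: "continuous_on S A" and cC: "continuous_on S C"
    using smooth_on_continuous[OF S] sA sC by auto
  have ftc: "((\<lambda>\<sigma>. A (z + t *\<^sub>R v + \<sigma> *\<^sub>R u)) has_integral (f (z + t *\<^sub>R v + s *\<^sub>R u) - f (z + t *\<^sub>R v))) {0..s}"
    if s: "0 \<le> s" "s \<le> \<delta>" and t: "\<bar>t\<bar> \<le> \<delta>" for s t
  proof -
    have "((\<lambda>\<sigma>. A (z + t *\<^sub>R v + \<sigma> *\<^sub>R u)) has_integral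
        (f (z + t *\<^sub>R v + s *\<^sub>R u) - f (z + t *\<^sub>R v + 0 *\<^sub>R u))) {0..s}"
    proof (rule fundamental_theorem_of_calculus[OF s(1)])
      fix \<sigma> assume "\<sigma> \<in> {0..s}"
      then have "z + t *\<^sub>R v + \<sigma> *\<^sub>R u \<in> S" using s t by (intro inS) auto
      from smooth_on_line_at[OF f this u]
      show "((\<lambda>\<sigma>. f (z + t *\<^sub>R v + \<sigma> *\<^sub>R u)) has_vector_derivative A (z + t *\<^sub>R v + \<sigma> *\<^sub>R u)) (at \<sigma> within {0..s})"
        unfolding A_def by (rule has_vector_derivative_at_within)
    qed
    then show ?thesis by simp
  qed
  have key: "B (z + s *\<^sub>R u) - B z = integral {0..s} (\<lambda>\<sigma>. C (z + \<sigma> *\<^sub>R u))" if s: "s \<in> {0..\<delta>}" for s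
  proof -
    define T where "T = {-\<delta><..<\<delta>}"
    have T: "0 \<in> T" "convex T" and aT: "at 0 within T = at 0"
      using \<delta> by (auto simp: T_def intro: at_within_open)
    have "((\<lambda>t. integral (cbox 0 s) (\<lambda>\<sigma>. A (z + t *\<^sub>R v + \<sigma> *\<^sub>R u))) has_vector_derivative
        integral (cbox 0 s) (\<lambda>\<sigma>. C (z + 0 *\<^sub>R v + \<sigma> *\<^sub>R u))) (at 0 within T)"
    proof (rule leibniz_rule_vector_derivative[OF _ _ _ T])
      fix t \<sigma> assume t: "t \<in> T" and \<sigma>: "\<sigma> \<in> cbox 0 s"
      have "z + \<sigma> *\<^sub>R u + t *\<^sub>R v \<in> S" using s t \<sigma> by (intro inS) (auto simp: T_def)
      from smooth_on_line_at[OF sA this v]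
      show "((\<lambda>t. A (z + t *\<^sub>R v + \<sigma> *\<^sub>R u)) has_vector_derivative C (z + t *\<^sub>R v + \<sigma> *\<^sub>R u)) (at t within T)"
        unfolding C_def sw by (rule has_vector_derivative_at_within)
    next
      fix t assume "t \<in> T"
      then have "\<bar>t\<bar> \<le> \<delta>" by (auto simp: T_def)
      with s show "(\<lambda>\<sigma>. A (z + t *\<^sub>R v + \<sigma> *\<^sub>R u)) integrable_on cbox 0 s"
        unfolding cbox_interval by (intro has_integral_integrable[OF ftc]) auto
    next
      show "continuous_on (T \<times> cbox 0 s) (\<lambda>(t, \<sigma>). C (z + t *\<^sub>R v + \<sigma> *\<^sub>R u))"
        unfolding case_prod_unfold
      proof (rule continuous_on_compose2[OF cC])
        show "continuous_on (T \<times> cbox 0 s) (\<lambda>x. z + fst x *\<^sub>R v + snd x *\<^sub>R u)"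
          by (intro continuous_intros)
        show "(\<lambda>x. z + fst x *\<^sub>R v + snd x *\<^sub>R u) ` (T \<times> cbox 0 s) \<subseteq> S"
          using s by (auto simp: T_def intro!: inS)
      qed
    qed
    moreover have "((\<lambda>t. f (z + s *\<^sub>R u + t *\<^sub>R v) - f (z + t *\<^sub>R v)) has_vector_derivative
        B (z + s *\<^sub>R u) - B z) (at 0)"
      unfolding B_def
      by (intro has_vector_derivative_diff smooth_on_line[OF S f _ v] z)
        (use inS(1)[of s 0] s \<delta> in auto)
    then have "((\<lambda>t. integral (cbox 0 s) (\<lambda>\<sigma>. A (z + t *\<^sub>R v + \<sigma> *\<^sub>R u))) has_vector_derivative
        B (z + s *\<^sub>R u) - B z) (at 0 within T)"
    proof (rule has_vector_derivative_transform[OF T(1) _ has_vector_derivative_at_within, rotated])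
      fix t assume "t \<in> T"
      then show "integral (cbox 0 s) (\<lambda>\<sigma>. A (z + t *\<^sub>R v + \<sigma> *\<^sub>R u)) = f (z + s *\<^sub>R u + t *\<^sub>R v) - f (z + t *\<^sub>R v)"
        using ftc[of s t] s by (auto simp: T_def sw integral_unique)
    qed
    ultimately have "integral (cbox 0 s) (\<lambda>\<sigma>. C (z + 0 *\<^sub>R v + \<sigma> *\<^sub>R u)) = B (z + s *\<^sub>R u) - B z"
      unfolding aT by (rule vector_derivative_unique_at)
    then show ?thesis by simp
  qed
  have "((\<lambda>s. B (z + s *\<^sub>R u) - B z) has_vector_derivative dir_deriv u B z - 0) (at 0)"
    by (intro has_vector_derivative_diff has_vector_derivative_const smooth_on_line[OF S sB z u])
  then have 1: "((\<lambda>s. B (z + s *\<^sub>R u) - B z) has_vector_derivative dir_deriv u B z) (at 0 within {0..\<delta>})"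
    by (simp add: has_vector_derivative_at_within)
  have "continuous_on {0..\<delta>} (\<lambda>\<sigma>. C (z + \<sigma> *\<^sub>R u))"
  proof (rule continuous_on_compose2[OF cC])
    show "continuous_on {0..\<delta>} (\<lambda>\<sigma>. z + \<sigma> *\<^sub>R u)" by (intro continuous_intros)
    show "(\<lambda>\<sigma>. z + \<sigma> *\<^sub>R u) ` {0..\<delta>} \<subseteq> S" using inS(1)[of _ 0] \<delta> by auto
  qed
  then have "((\<lambda>s. integral {0..s} (\<lambda>\<sigma>. C (z + \<sigma> *\<^sub>R u))) has_vector_derivative C (z + 0 *\<^sub>R u)) (at 0 within {0..\<delta>})"
    by (rule integral_has_vector_derivative) (use \<delta> in auto)
  then have 2: "((\<lambda>s. B (z + s *\<^sub>R u) - B z) has_vector_derivative C z) (at 0 within {0..\<delta>})"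
    by (intro has_vector_derivative_transform[OF _ key]) (use \<delta> in auto)
  \<comment> \<open>Both derivatives at 0 are one-sided; on a nondegenerate interval they are still
    unique.\<close>
  have "dir_deriv u B z = C z"
    by (rule vector_derivative_unique_within_closed_interval[OF \<delta> _ 1[folded cbox_interval] 2[folded cbox_interval]]) (use \<delta> in auto)
  then show ?thesis by (simp add: A_def B_def C_def)
qed

lemma axis_real_directions:
  assumes "i \<in> I"
  shows "axis i 1 \<in> real_directions I" "axis i \<i> \<in> real_directions I"
  using assms unfolding real_directions_def by blast+

lemma dir_deriv_add:
  assumes "smooth_on I S f" "smooth_on I S g" "z \<in> S" "u \<in> real_directions I"
  shows "dir_deriv u (\<lambda>z. f z + g z) z = dir_deriv u f z + dir_deriv u g z"
  by (rule dir_deriv_eqI, rule has_vector_derivative_add) (rule smooth_on_line[OF S]; fact assms)+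

lemma dir_deriv_mult:
  assumes "smooth_on I S f" "smooth_on I S g" "z \<in> S" "u \<in> real_directions I"
  shows "dir_deriv u (\<lambda>z. f z * g z) z = f z * dir_deriv u g z + dir_deriv u f z * g z"
  using has_vector_derivative_mult[OF smooth_on_line[OF S assms(1,3,4)] smooth_on_line[OF S assms(2,3,4)]]
  by (intro dir_deriv_eqI) simp

lemma dir_deriv_cmult:
  assumes "smooth_on I S f" "z \<in> S" "u \<in> real_directions I"
  shows "dir_deriv u (\<lambda>z. c * f z) z = c * dir_deriv u f z"
  by (rule dir_deriv_eqI, rule has_vector_derivative_mult_right, rule smooth_on_line[OF S assms])

lemma wirtinger_eq: "wirtinger i f = (\<lambda>z. (1/2) * dir_deriv (axis i 1) f z + (- \<i> / 2) * dir_deriv (axis i \<i>) f z)"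
  by (auto simp: wirtinger_def field_simps)

lemma smooth_on_wirtinger:
  assumes "smooth_on I S f" "i \<in> I"
  shows "smooth_on I S (wirtinger i f)"
  unfolding wirtinger_eq
  by (intro smooth_on_add smooth_on_mult smooth_on_const S smooth_on_dir_deriv assms axis_real_directions)

lemma wirtinger_add:
  assumes "smooth_on I S f" "smooth_on I S g" "z \<in> S" "i \<in> I"
  shows "wirtinger i (\<lambda>z. f z + g z) z = wirtinger i f z + wirtinger i g z"
  unfolding wirtinger_def by (simp add: dir_deriv_add[OF assms(1-3)] axis_real_directions[OF assms(4)] field_simps)

lemma wirtinger_mult:
  assumes "smooth_on I S f" "smooth_on I S g" "z \<in> S" "i \<in> I"
  shows "wirtinger i (\<lambda>z. f z * g z) z = f z * wirtinger i g z + wirtinger i f z * g z"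
  unfolding wirtinger_def by (simp add: dir_deriv_mult[OF assms(1-3)] axis_real_directions[OF assms(4)] field_simps)

lemma wirtinger_const [simp]: "wirtinger i (\<lambda>z. c) z = 0"
proof -
  have "dir_deriv u (\<lambda>z. c) z = 0" for u by (rule dir_deriv_eqI) simp
  then show ?thesis by (simp add: wirtinger_def)
qed

lemma wirtinger_sum:
  assumes "\<And>a. a \<in> A \<Longrightarrow> smooth_on I S (f a)" "z \<in> S" "i \<in> I"
  shows "wirtinger i (\<lambda>z. \<Sum>a\<in>A. f a z) z = (\<Sum>a\<in>A. wirtinger i (f a) z)"
  using assms(1)
proof (induction A rule: infinite_finite_induct)
  case (insert a A)
  have "smooth_on I S (\<lambda>z. \<Sum>a\<in>A. f a z)" by (intro smooth_on_sum S insert.prems) simp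
  then have "wirtinger i (\<lambda>z. f a z + (\<Sum>a\<in>A. f a z)) z = wirtinger i (f a) z + wirtinger i (\<lambda>z. \<Sum>a\<in>A. f a z) z"
    by (intro wirtinger_add insert.prems assms) simp_all
  with insert show ?case by simp
qed simp_all

lemma wirtinger_cong:
  assumes "z \<in> S" "i \<in> I" "\<And>z. z \<in> S \<Longrightarrow> f z = g z"
  shows "wirtinger i f z = wirtinger i g z"
  unfolding wirtinger_def
  using dir_deriv_cong[OF S assms(1) _ assms(3), of "axis i 1"] dir_deriv_cong[OF S assms(1) _ assms(3), of "axis i \<i>"]
  by (simp add: axis_in_coord_space assms(2))

lemma wirtinger_commute:
  assumes f: "smooth_on I S f" and z: "z \<in> S" and i: "i \<in> I" and j: "j \<in> I"
  shows "wirtinger i (wirtinger j f) z = wirtinger j (wirtinger i f) z"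
proof -
  have *: "dir_deriv u (wirtinger j f) z =
      (1/2) * dir_deriv u (dir_deriv (axis j 1) f) z + (- \<i> / 2) * dir_deriv u (dir_deriv (axis j \<i>) f) z"
    if "j \<in> I" "u \<in> real_directions I" for j u
  proof -
    have s: "smooth_on I S (dir_deriv (axis j 1) f)" "smooth_on I S (dir_deriv (axis j \<i>) f)"
      by (intro smooth_on_dir_deriv S f axis_real_directions that)+
    have m: "smooth_on I S (\<lambda>z. (1/2) * dir_deriv (axis j 1) f z)"
      "smooth_on I S (\<lambda>z. (- \<i> / 2) * dir_deriv (axis j \<i>) f z)"
      by (intro smooth_on_mult smooth_on_const S s)+
    show ?thesis
      unfolding wirtinger_eq dir_deriv_add[OF m z that(2)] dir_deriv_cmult[OF s(1) z that(2)]
        dir_deriv_cmult[OF s(2) z that(2)] ..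
  qed
  show ?thesis
    unfolding wirtinger_def[of i "wirtinger j f"] wirtinger_def[of j "wirtinger i f"]
    using dir_deriv_commute[OF f z] axis_real_directions i j
    by (simp add: *) (simp add: field_simps)
qed

text \<open>The directions \<open>axis i 1\<close> and \<open>axis i \<i>\<close> give the values c
  and \<i> c with the same c, so the two halves of the Wirtinger derivative add up.\<close>

lemma wirtinger_holo:
  assumes "holo_on I S f" "z \<in> S" "i \<in> I"
  shows "wirtinger i f z = cpartial i f z"
  using dir_deriv_eqI[OF holo_on_line[OF S assms]]
  by (simp add: wirtinger_def flip: mult.assoc)

end

text \<open>On a closed disc of each coordinate line this is the Weierstrass theorem in one
  variable; continuity, the other half of \<open>axis_holo\<close>, is kept by uniform
  limits.\<close>

lemma holo_on_uniform_limit: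
  assumes S: "rel_open I S" and F: "\<And>n::nat. holo_on I S (F n)" and lim: "uniform_limit S F f sequentially"
  shows "holo_on I S f"
proof (rule holo_onI[OF S])
  show "continuous_on S f"
    by (rule uniform_limit_theorem[OF _ lim]) (auto intro!: always_eventually holo_on_continuous F)
  fix z i assume z: "z \<in> S" and i: "i \<in> I"
  obtain e where e: "e > 0" "\<And>w. norm w < e \<Longrightarrow> z + axis i w \<in> S"
    using rel_open_axisE[OF S z i] by blast
  have inS: "z + axis i w \<in> S" if "w \<in> cball 0 (e/2)" for w
    using that e(1) by (intro e(2)) auto
  have 1: "\<forall>\<^sub>F n in sequentially. continuous_on (cball 0 (e/2)) (\<lambda>w. F n (z + axis i w)) \<and>
      (\<lambda>w. F n (z + axis i w)) holomorphic_on ball 0 (e/2)"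
  proof (intro always_eventually allI conjI)
    fix n
    show "continuous_on (cball 0 (e/2)) (\<lambda>w. F n (z + axis i w))"
      by (rule continuous_on_compose2[OF holo_on_continuous[OF F]]) (auto intro!: continuous_intros inS)
    show "(\<lambda>w. F n (z + axis i w)) holomorphic_on ball 0 (e/2)"
      unfolding holomorphic_on_def
    proof
      fix w assume "w \<in> ball (0::complex) (e/2)"
      then have "z + axis i w \<in> S" by (intro inS) auto
      from axis_holo_line[OF F[unfolded holo_on_iff_axis_holo[OF S]] this i]
      show "(\<lambda>w. F n (z + axis i w)) field_differentiable at w within ball 0 (e/2)"
        unfolding field_differentiable_def by (blast intro: has_field_derivative_at_within)
    qed
  qed
  have 2: "uniform_limit (cball 0 (e/2)) (\<lambda>n w. F n (z + axis i w)) (\<lambda>w. f (z + axis i w)) sequentially"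
    by (rule uniform_limit_compose'[OF lim]) (auto intro: inS)
  have "(\<lambda>w. f (z + axis i w)) holomorphic_on ball 0 (e/2)"
    by (rule holomorphic_uniform_limit[OF 1 2 trivial_limit_sequentially])
  then have "(\<lambda>w. f (z + axis i w)) field_differentiable at 0"
    using e(1) by (intro holomorphic_on_imp_differentiable_at[of _ "ball 0 (e/2)"]) auto
  then show "\<exists>D. ((\<lambda>w. f (z + axis i w)) has_field_derivative D) (at 0)"
    unfolding field_differentiable_def .
qed

section \<open>Flow boxes of holomorphic vector fields\<close>

text \<open>The centre has fibre coordinate 1 and all others 0; the Euler field does not vanish
  there. Since the bounds are imposed per coordinate, moving the fibre coordinate towards 1 never
  leaves the set.\<close>

definition polydisc :: "'n::finite \<Rightarrow> real \<Rightarrow> (complex ^ 'n) set" where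
  "polydisc k r = {\<zeta>. \<forall>i. norm (\<zeta> $ i - axis k 1 $ i) < r}"

lemma open_polydisc: "open (polydisc k r)"
proof -
  have "polydisc k r = (\<Inter>i. {\<zeta>. norm (\<zeta> $ i - axis k 1 $ i) < r})" by (auto simp: polydisc_def)
  moreover have "open \<dots>"
    by (intro open_INT) (auto intro!: open_Collect_less continuous_intros)
  ultimately show ?thesis by simp
qed

lemma rel_open_polydisc: "rel_open UNIV (polydisc k r)"
  by (simp add: open_polydisc)

lemma axis_in_polydisc: "r > 0 \<Longrightarrow> axis k 1 \<in> polydisc k r"
  by (simp add: polydisc_def)

lemma norm_le_sum_cart: "norm x \<le> (\<Sum>i\<in>UNIV. norm (x $ i))" for x :: "complex ^ 'n::finite"
  using norm_sum[of "\<lambda>i. axis i (x $ i)" UNIV] by (simp flip: vec_eq_sum_axis)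

lemma norm_le_card_cart:
  fixes x :: "complex ^ 'n::finite"
  assumes "\<And>i. norm (x $ i) \<le> a"
  shows "norm x \<le> real CARD('n) * a"
  using order_trans[OF norm_le_sum_cart sum_mono[of UNIV "\<lambda>i. norm (x $ i)" "\<lambda>_. a"]] assms by simp

lemma polydisc_subset_ball:
  fixes k :: "'n::finite"
  assumes "e > 0"
  shows "polydisc k (e / real CARD('n)) \<subseteq> cball (axis k 1) e"
proof
  fix \<zeta> assume "\<zeta> \<in> polydisc k (e / real CARD('n))"
  then have "norm (\<zeta> - axis k 1) \<le> real CARD('n) * (e / real CARD('n))"
    by (intro norm_le_card_cart) (auto simp: polydisc_def less_imp_le)
  then show "\<zeta> \<in> cball (axis k 1) e" by (simp add: dist_norm norm_minus_commute)
qed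

lemma polydisc_mono: "r \<le> r' \<Longrightarrow> polydisc k r \<subseteq> polydisc k r'"
  by (auto simp: polydisc_def intro: less_le_trans)

text \<open>The fibre coordinate w is moved to 1 + s (w - 1): s = 0 gives the slice w = 1, s = 1 the
  identity.\<close>

definition shrink :: "'n::finite \<Rightarrow> real \<Rightarrow> complex ^ 'n \<Rightarrow> complex ^ 'n" where
  "shrink k s \<zeta> = \<zeta> + axis k ((of_real s - 1) * (\<zeta> $ k - 1))"

lemma shrink_in_polydisc:
  assumes "\<zeta> \<in> polydisc k r" "0 \<le> s" "s \<le> 1"
  shows "shrink k s \<zeta> \<in> polydisc k r"
proof -
  have "norm (shrink k s \<zeta> $ i - axis k 1 $ i) \<le> norm (\<zeta> $ i - axis k 1 $ i)" for i
  proof (cases "i = k")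
    case True
    have "shrink k s \<zeta> $ k - 1 = of_real s * (\<zeta> $ k - 1)"
      by (simp add: shrink_def algebra_simps)
    then show ?thesis using True assms by (simp add: norm_mult mult_left_le_one_le)
  qed (simp add: shrink_def axis_nth_eq)
  then show ?thesis using assms(1) by (auto simp: polydisc_def intro: le_less_trans)
qed

lemma shrink_axis: "shrink k s (\<zeta> + axis i u) = shrink k s \<zeta> + axis i ((if i = k then of_real s else 1) * u)"
  by (auto simp: shrink_def vec_eq_iff axis_nth_eq algebra_simps)

lemma continuous_on_shrink: "continuous_on A (\<lambda>x. shrink k (snd x) (fst x))"
  unfolding shrink_def by (intro continuous_intros)

text \<open>The integral of \<open>F\<close> along the fibre from 1 to w, with the segment
  parametrised by 1 + s (w - 1). The fixed interval makes differentiation under the integral sign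
  available in every coordinate.\<close>

definition fibre_primitive :: "'n::finite \<Rightarrow> (complex ^ 'n \<Rightarrow> complex) \<Rightarrow> complex ^ 'n \<Rightarrow> complex" where
  "fibre_primitive k F \<zeta> = (\<zeta> $ k - 1) * integral (cbox 0 1) (\<lambda>s. F (shrink k s \<zeta>))"

context
  fixes k :: "'n::finite" and r and F :: "complex ^ 'n \<Rightarrow> complex"
  assumes F: "holo_on UNIV (polydisc k r) F"
begin

private lemma aF: "axis_holo UNIV (polydisc k r) F"
  using F unfolding holo_on_iff_axis_holo[OF rel_open_polydisc] .

private lemma shrink_integrand:
  assumes "\<zeta> \<in> polydisc k r"
  shows "continuous_on (cbox 0 1) (\<lambda>s. F (shrink k s \<zeta>))"
proof (rule continuous_on_compose2[OF holo_on_continuous[OF F]])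
  show "continuous_on (cbox 0 1) (\<lambda>s. shrink k s \<zeta>)" unfolding shrink_def by (intro continuous_intros)
qed (use shrink_in_polydisc[OF assms] in auto)

private lemma shrink_integral_derivative:
  assumes z: "\<zeta> \<in> polydisc k r"
  shows "((\<lambda>u. integral (cbox 0 1) (\<lambda>s. F (shrink k s (\<zeta> + axis i u)))) has_field_derivative
    integral (cbox 0 1) (\<lambda>s. (if i = k then of_real s else 1) * cpartial i F (shrink k s \<zeta>))) (at 0)"
proof -
  let ?c = "\<lambda>s::real. if i = k then of_real s else (1 :: complex)"
  obtain e where e: "e > 0" "\<And>w. norm w < e \<Longrightarrow> \<zeta> + axis i w \<in> polydisc k r"
    using rel_open_axisE[OF rel_open_polydisc z UNIV_I] by blast
  have at0: "at 0 within ball 0 e = at (0::complex)"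
    by (rule at_within_open) (use e(1) in auto)
  have inB: "shrink k s (\<zeta> + axis i u) \<in> polydisc k r" if "u \<in> ball 0 e" "s \<in> cbox 0 1" for u s
    using that by (intro shrink_in_polydisc e(2)) auto
  have cont_c: "continuous_on A (\<lambda>x. ?c (snd x))" for A :: "(complex \<times> real) set"
    by (cases "i = k") (auto intro!: continuous_intros)
  have "((\<lambda>u. integral (cbox 0 1) (\<lambda>s. F (shrink k s (\<zeta> + axis i u)))) has_field_derivative
    integral (cbox 0 1) (\<lambda>s. cpartial i F (shrink k s (\<zeta> + axis i 0)) * ?c s)) (at 0 within ball 0 e)"
  proof (rule leibniz_rule_field_derivative[where fx = "\<lambda>u s. cpartial i F (shrink k s (\<zeta> + axis i u)) * ?c s"])
    fix u s assume us: "u \<in> ball (0::complex) e" "s \<in> cbox 0 (1::real)"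
    have 1: "((\<lambda>w. F (shrink k s \<zeta> + axis i w)) has_field_derivative
       cpartial i F (shrink k s \<zeta> + axis i (?c s * u))) (at (?c s * u))"
      by (rule axis_holo_line[OF aF]) (use inB[OF us] in \<open>simp_all add: shrink_axis\<close>)
    have "((\<lambda>u. F (shrink k s (\<zeta> + axis i u))) has_field_derivative
        cpartial i F (shrink k s (\<zeta> + axis i u)) * ?c s) (at u)"
      using DERIV_chain2[OF 1 DERIV_cmult_Id] unfolding shrink_axis .
    then show "((\<lambda>u. F (shrink k s (\<zeta> + axis i u))) has_field_derivative
        cpartial i F (shrink k s (\<zeta> + axis i u)) * ?c s) (at u within ball 0 e)"
      by (rule has_field_derivative_at_within)
  next
    fix u assume "u \<in> ball (0::complex) e"
    then show "(\<lambda>s. F (shrink k s (\<zeta> + axis i u))) integrable_on cbox 0 1"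
      by (intro integrable_continuous shrink_integrand e(2)) simp
  next
    have "continuous_on (ball 0 e \<times> cbox 0 1) (\<lambda>x. cpartial i F (shrink k (snd x) (\<zeta> + axis i (fst x))))"
    proof (rule continuous_on_compose2[OF holo_on_continuous[OF holo_on_cpartial[OF rel_open_polydisc F UNIV_I]]])
      show "continuous_on (ball 0 e \<times> cbox 0 1) (\<lambda>x. shrink k (snd x) (\<zeta> + axis i (fst x)))"
        unfolding shrink_def by (intro continuous_intros)
    qed (use inB in auto)
    then show "continuous_on (ball 0 e \<times> cbox 0 1) (\<lambda>(u, s). cpartial i F (shrink k s (\<zeta> + axis i u)) * ?c s)"
      unfolding case_prod_unfold by (intro continuous_on_mult cont_c)
  qed (use e(1) in auto)
  then show ?thesis unfolding at0 by (simp add: mult.commute cong: if_cong)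
qed

private lemma shrink_integral_continuous:
  "continuous_on (polydisc k r) (\<lambda>\<zeta>. integral (cbox 0 1) (\<lambda>s. F (shrink k s \<zeta>)))"
proof (rule integral_continuous_on_param)
  show "continuous_on (polydisc k r \<times> cbox 0 1) (\<lambda>(\<zeta>, s). F (shrink k s \<zeta>))"
    unfolding case_prod_unfold
    by (rule continuous_on_compose2[OF holo_on_continuous[OF F] continuous_on_shrink])
      (auto intro: shrink_in_polydisc)
qed

lemma holo_on_fibre_primitive: "holo_on UNIV (polydisc k r) (fibre_primitive k F)"
  unfolding fibre_primitive_def
proof (intro holo_on_mult holo_on_diff holo_on_const holo_on_coord rel_open_polydisc)
  show "holo_on UNIV (polydisc k r) (\<lambda>\<zeta>. integral (cbox 0 1) (\<lambda>s. F (shrink k s \<zeta>)))"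
    by (rule holo_onI[OF rel_open_polydisc shrink_integral_continuous])
      (rule exI, rule shrink_integral_derivative)
qed

lemma cpartial_fibre_primitive:
  assumes z: "\<zeta> \<in> polydisc k r"
  shows "cpartial k (fibre_primitive k F) \<zeta> = F \<zeta>"
proof -
  let ?I = "\<lambda>\<zeta>. integral (cbox 0 1) (\<lambda>s. F (shrink k s \<zeta>))"
  let ?J = "integral (cbox 0 1) (\<lambda>s. of_real s * cpartial k F (shrink k s \<zeta>))"
  have inB: "shrink k s \<zeta> \<in> polydisc k r" if "s \<in> {0..1}" for s
    using that by (intro shrink_in_polydisc z) auto
  have 1: "((\<lambda>u. (\<zeta> + axis k u) $ k - 1) has_field_derivative 1) (at 0)"
    using DERIV_diff[OF axis_derivative_coord[of \<zeta> k k 0] DERIV_const[of 1]] by simp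
  have 2: "((\<lambda>u. ?I (\<zeta> + axis k u)) has_field_derivative ?J) (at 0)"
    using shrink_integral_derivative[OF z, of k] by simp
  have "((\<lambda>u. fibre_primitive k F (\<zeta> + axis k u)) has_field_derivative
      (\<zeta> $ k - 1) * ?J + 1 * ?I \<zeta>) (at 0)"
    unfolding fibre_primitive_def using DERIV_mult'[OF 1 2] by simp
  then have "cpartial k (fibre_primitive k F) \<zeta> = (\<zeta> $ k - 1) * ?J + ?I \<zeta>"
    by (simp add: has_field_derivative_cpartial)
  \<comment> \<open>The integrand is the s-derivative of s times
    \<open>F (shrink k s \<zeta>)\<close>.\<close>
  also have "((\<lambda>s. (\<zeta> $ k - 1) * (of_real s * cpartial k F (shrink k s \<zeta>)) + F (shrink k s \<zeta>))
      has_integral (of_real 1 * F (shrink k 1 \<zeta>) - of_real 0 * F (shrink k 0 \<zeta>))) {0..1}"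
  proof (rule fundamental_theorem_of_calculus)
    fix s :: real assume s: "s \<in> {0..1}"
    have sh: "shrink k t \<zeta> = shrink k 0 \<zeta> + axis k (of_real t * (\<zeta> $ k - 1))" for t
      by (simp add: shrink_def vec_eq_iff axis_nth_eq algebra_simps)
    have 1: "((\<lambda>w. F (shrink k 0 \<zeta> + axis k w)) has_field_derivative
       cpartial k F (shrink k s \<zeta>)) (at (of_real s * (\<zeta> $ k - 1)))"
      unfolding sh[of s] by (rule axis_holo_line[OF aF]) (use inB[OF s] sh[of s] in simp_all)
    have id: "((\<lambda>t. of_real t) has_vector_derivative (1::complex)) (at s within {0..1})"
      using has_vector_derivative_of_real[OF DERIV_ident] by simp
    have "((\<lambda>t. of_real t * (\<zeta> $ k - 1)) has_vector_derivative (\<zeta> $ k - 1)) (at s within {0..1})"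
      using has_vector_derivative_mult_left[OF id] by simp
    from field_vector_diff_chain_within[OF this has_field_derivative_at_within[OF 1]]
    have "((\<lambda>t. F (shrink k t \<zeta>)) has_vector_derivative (\<zeta> $ k - 1) * cpartial k F (shrink k s \<zeta>)) (at s within {0..1})"
      by (simp only: o_def sh[symmetric])
    from has_vector_derivative_mult[OF id this]
    show "((\<lambda>t. of_real t * F (shrink k t \<zeta>)) has_vector_derivative
       (\<zeta> $ k - 1) * (of_real s * cpartial k F (shrink k s \<zeta>)) + F (shrink k s \<zeta>)) (at s within {0..1})"
      by (simp add: mult_ac)
  qed simp
  then have "integral (cbox 0 1) (\<lambda>s. (\<zeta> $ k - 1) * (of_real s * cpartial k F (shrink k s \<zeta>)) + F (shrink k s \<zeta>)) = F \<zeta>"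
    by (simp add: integral_unique shrink_def)
  moreover have "continuous_on (cbox 0 1) (\<lambda>s. cpartial k F (shrink k s \<zeta>))"
  proof (rule continuous_on_compose2[OF holo_on_continuous[OF holo_on_cpartial[OF rel_open_polydisc F UNIV_I]]])
    show "continuous_on (cbox 0 1) (\<lambda>s. shrink k s \<zeta>)" unfolding shrink_def by (intro continuous_intros)
  qed (use inB in auto)
  then have "(\<lambda>s. (\<zeta> $ k - 1) * (of_real s * cpartial k F (shrink k s \<zeta>))) integrable_on cbox 0 1"
    by (intro integrable_continuous continuous_intros)
  from integral_add[OF this integrable_continuous[OF shrink_integrand[OF z]]]
  have "integral (cbox 0 1) (\<lambda>s. (\<zeta> $ k - 1) * (of_real s * cpartial k F (shrink k s \<zeta>)) + F (shrink k s \<zeta>))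
      = (\<zeta> $ k - 1) * ?J + ?I \<zeta>"
    unfolding integral_mult_right .
  ultimately show ?thesis by simp
qed

text \<open>The factor \<open>r\<close> bounds the length of the fibre segment; it is what turns the
  Picard operator into a contraction on a small polydisc.\<close>

lemma fibre_primitive_bound:
  assumes z: "\<zeta> \<in> polydisc k r" and H: "holo_on UNIV (polydisc k r) H"
    and b: "\<And>\<zeta>. \<zeta> \<in> polydisc k r \<Longrightarrow> norm (F \<zeta> - H \<zeta>) \<le> M"
  shows "norm (fibre_primitive k F \<zeta> - fibre_primitive k H \<zeta>) \<le> r * M"
proof -
  have inB: "shrink k s \<zeta> \<in> polydisc k r" if "s \<in> cbox 0 1" for s
    using that by (intro shrink_in_polydisc z) auto
  have M: "0 \<le> M" using b[OF z] norm_ge_zero order_trans by blast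
  have cH: "continuous_on (cbox 0 1) (\<lambda>s. H (shrink k s \<zeta>))"
  proof (rule continuous_on_compose2[OF holo_on_continuous[OF H]])
    show "continuous_on (cbox 0 1) (\<lambda>s. shrink k s \<zeta>)" unfolding shrink_def by (intro continuous_intros)
  qed (use inB in auto)
  have i: "(\<lambda>s. F (shrink k s \<zeta>)) integrable_on cbox 0 1" "(\<lambda>s. H (shrink k s \<zeta>)) integrable_on cbox 0 1"
    by (intro integrable_continuous shrink_integrand[OF z] cH)+
  have "fibre_primitive k F \<zeta> - fibre_primitive k H \<zeta> =
      (\<zeta> $ k - 1) * integral (cbox 0 1) (\<lambda>s. F (shrink k s \<zeta>) - H (shrink k s \<zeta>))"
    by (simp only: fibre_primitive_def integral_diff[OF i] right_diff_distrib)
  also have "norm \<dots> = norm (\<zeta> $ k - 1) * norm (integral (cbox 0 1) (\<lambda>s. F (shrink k s \<zeta>) - H (shrink k s \<zeta>)))"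
    by (rule norm_mult)
  also have "\<dots> \<le> r * (M * measure lborel (cbox 0 (1::real)))"
  proof (rule mult_mono)
    show "norm (\<zeta> $ k - 1) \<le> r" "0 \<le> r"
      using z by (auto simp: polydisc_def less_imp_le dest!: spec[of _ k]
        intro: order_trans[OF norm_ge_zero less_imp_le])
    show "norm (integral (cbox 0 1) (\<lambda>s. F (shrink k s \<zeta>) - H (shrink k s \<zeta>))) \<le> M * measure lborel (cbox 0 (1::real))"
      by (rule has_integral_bound[OF M integrable_integral[OF integrable_diff[OF i]]]) (use b inB in auto)
  qed simp
  finally show ?thesis by simp
qed

end

section \<open>Picard iteration along the fibre coordinate\<close>

lemma component_le_norm_complex: "norm (x $ i) \<le> norm x" for x :: "complex ^ 'n::finite"
  by (rule Finite_Cartesian_Product.norm_nth_le)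

text \<open>The partial derivatives are bounded on the compact ball, and the mean value inequality
  applies because the ball is convex.\<close>

lemma holo_on_lipschitz_cball:
  fixes f :: "complex ^ 'n::finite \<Rightarrow> complex"
  assumes "open S" "holo_on UNIV S f" "cball p R \<subseteq> S"
  obtains L where "L \<ge> 0" "\<And>x y. x \<in> cball p R \<Longrightarrow> y \<in> cball p R \<Longrightarrow> norm (f x - f y) \<le> L * norm (x - y)"
proof -
  have S: "rel_open UNIV S" using assms(1) by simp
  let ?D = "\<lambda>z. \<Sum>i\<in>UNIV. norm (cpartial i f z)"
  have "continuous_on (cball p R) ?D"
    by (intro continuous_on_sum continuous_on_norm
        continuous_on_subset[OF holo_on_continuous[OF holo_on_cpartial[OF S assms(2) UNIV_I]] assms(3)])
  then have "bounded (?D ` cball p R)"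
    by (intro compact_imp_bounded compact_continuous_image) simp_all
  then obtain L where L: "\<And>x. x \<in> cball p R \<Longrightarrow> norm (?D x) \<le> L"
    unfolding bounded_iff by blast
  \<comment> \<open>The maximum keeps the constant nonnegative even when the ball is empty.\<close>
  have "norm (f x - f y) \<le> max L 0 * norm (x - y)" if xy: "x \<in> cball p R" "y \<in> cball p R" for x y
  proof (rule differentiable_bound[OF convex_cball _ _ xy])
    fix z assume z: "z \<in> cball p R"
    show "(f has_derivative (\<lambda>h. \<Sum>i\<in>UNIV. cpartial i f z * h $ i)) (at z within cball p R)"
      by (rule has_derivative_subset[OF holo_on_has_derivative[OF assms(2) S] assms(3)]) (use z assms(3) in auto)
    show "onorm (\<lambda>h. \<Sum>i\<in>UNIV. cpartial i f z * h $ i) \<le> max L 0"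
    proof (rule onorm_le)
      fix h
      have "norm (\<Sum>i\<in>UNIV. cpartial i f z * h $ i) \<le> (\<Sum>i\<in>UNIV. norm (cpartial i f z) * norm h)"
        by (intro sum_norm_le) (simp add: norm_mult mult_left_mono component_le_norm_complex)
      also have "\<dots> = ?D z * norm h" by (simp add: sum_distrib_right)
      also have "\<dots> \<le> max L 0 * norm h"
        using L[OF z] by (intro mult_right_mono) auto
      finally show "norm (\<Sum>i\<in>UNIV. cpartial i f z * h $ i) \<le> max L 0 * norm h" .
    qed
  qed
  then show ?thesis using that[of "max L 0"] by auto
qed

text \<open>The increments are dominated by a geometric series, and their partial sums
  telescope.\<close>

lemma uniform_limit_telescope:
  fixes G :: "nat \<Rightarrow> 'a \<Rightarrow> 'b::banach"
  assumes "\<And>m x. x \<in> B \<Longrightarrow> norm (G (Suc m) x - G m x) \<le> c * (1/2) ^ m"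
  obtains g where "uniform_limit B G g sequentially"
proof -
  have "summable (\<lambda>m. c * (1/2) ^ m :: real)" by (intro summable_mult summable_geometric) simp
  with assms have "uniform_limit B (\<lambda>n x. \<Sum>m<n. G (Suc m) x - G m x) (\<lambda>x. suminf (\<lambda>m. G (Suc m) x - G m x)) sequentially"
    by (rule Weierstrass_m_test)
  then have "uniform_limit B (\<lambda>n x. G 0 x + (\<Sum>m<n. G (Suc m) x - G m x)) (\<lambda>x. G 0 x + suminf (\<lambda>m. G (Suc m) x - G m x)) sequentially"
    by (intro uniform_limit_add uniform_limit_const)
  moreover have "G 0 x + (\<Sum>m<n. G (Suc m) x - G m x) = G n x" for n x
    by (subst sum_lessThan_telescope) simp
  ultimately show ?thesis using that by simp
qed

text \<open>Picard iteration for \<open>w \<partial>G/\<partial>w = V(G)\<close> with \<open>w = \<zeta> $ k\<close> and initial values on the slice \<open>w = 1\<close>.\<close>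

lemma euler_flow:
  fixes V :: "complex ^ 'n::finite \<Rightarrow> complex ^ 'n"
  assumes S: "open S" and p: "p \<in> S" and V: "\<And>i. holo_on UNIV S (\<lambda>z. V z $ i)"
  obtains r G where "0 < r" "r \<le> 1/2" "G ` polydisc k r \<subseteq> S"
    "\<And>i. holo_on UNIV (polydisc k r) (\<lambda>\<zeta>. G \<zeta> $ i)"
    "\<And>\<zeta> i. \<zeta> \<in> polydisc k r \<Longrightarrow> \<zeta> $ k * cpartial k (\<lambda>\<zeta>. G \<zeta> $ i) \<zeta> = V (G \<zeta>) $ i"
    "\<And>\<zeta>. \<zeta> \<in> polydisc k r \<Longrightarrow> \<zeta> $ k = 1 \<Longrightarrow> G \<zeta> = p + \<zeta> - axis k 1"
proof -
  have rS: "rel_open UNIV S" using S by simp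
  obtain R where R: "R > 0" "cball p R \<subseteq> S" using S p open_contains_cball by blast
  have "\<exists>L\<ge>0. \<forall>x\<in>cball p R. \<forall>y\<in>cball p R. norm (V x $ i - V y $ i) \<le> L * norm (x - y)" for i
    by (rule holo_on_lipschitz_cball[OF S V[of i] R(2)]) blast
  then have "\<forall>i. \<exists>L\<ge>0. \<forall>x\<in>cball p R. \<forall>y\<in>cball p R. norm (V x $ i - V y $ i) \<le> L * norm (x - y)" ..
  from choice[OF this] obtain L' where L': "\<And>i. L' i \<ge> 0"
    "\<And>i x y. x \<in> cball p R \<Longrightarrow> y \<in> cball p R \<Longrightarrow> norm (V x $ i - V y $ i) \<le> L' i * norm (x - y)"
    by blast
  define L where "L = (\<Sum>i\<in>UNIV. L' i)"
  have L0: "L \<ge> 0" unfolding L_def by (intro sum_nonneg L')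
  have L: "norm (V x $ i - V y $ i) \<le> L * norm (x - y)" if "x \<in> cball p R" "y \<in> cball p R" for i x y
  proof -
    have "L' i \<le> L" unfolding L_def by (rule member_le_sum) (auto intro: L')
    from order_trans[OF L'(2)[OF that] mult_right_mono[OF this norm_ge_zero]] show ?thesis .
  qed
  define M where "M = norm (V p) + L * R"
  have M0: "M \<ge> 0" using L0 R by (simp add: M_def)
  have M: "norm (V x $ i) \<le> M" if "x \<in> cball p R" for x i
  proof -
    have "norm (V x $ i - V p $ i) \<le> L * norm (x - p)" using R by (intro L that) simp
    also have "\<dots> \<le> L * R" using that L0 by (intro mult_left_mono) (auto simp: dist_norm norm_minus_commute)
    finally show ?thesis
      using component_le_norm_complex[of "V p" i] norm_triangle_ineq[of "V x $ i - V p $ i" "V p $ i"]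
      by (simp add: M_def)
  qed
  define N where "N = real CARD('n)"
  have N: "N \<ge> 1" by (simp add: N_def Suc_leI)
  \<comment> \<open>1/2 keeps w away from 0, the second bound keeps the iterates in the ball of
    radius \<open>R\<close>, and the third makes the Picard operator halve distances.
    \<open>N\<close> pays for estimating a norm by its components.\<close>
  define r where "r = min (1/2) (min (R / (N * (1 + 2 * M))) (1 / (4 * N * (L + 1))))"
  have r: "r > 0" "r \<le> 1/2"
    using R N M0 L0 unfolding r_def by (simp_all only: min_less_iff_conj min.cobounded1) (simp add: add_pos_nonneg)
  have rR: "N * (r * (1 + 2 * M)) \<le> R"
  proof -
    have "r \<le> R / (N * (1 + 2 * M))" by (simp add: r_def)
    moreover have "N * (1 + 2 * M) > 0" using N M0 by simp
    ultimately show ?thesis by (simp add: pos_le_divide_eq mult_ac)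
  qed
  have rL: "N * (r * (2 * L)) \<le> 1/2"
  proof -
    have "r \<le> 1 / (4 * N * (L + 1))" by (simp add: r_def)
    moreover have "4 * N * (L + 1) > 0" using N L0 by simp
    ultimately have "r * (4 * N * (L + 1)) \<le> 1" by (simp add: pos_le_divide_eq)
    moreover have "4 * (N * (r * L)) \<le> r * (4 * N * (L + 1))"
      using r N by (simp add: algebra_simps)
    ultimately show ?thesis by (simp add: mult_ac)
  qed
  let ?B = "polydisc k r"
  note rB = rel_open_polydisc[of k r]
  have w: "norm (\<zeta> $ k) \<ge> 1/2" "\<zeta> $ k \<noteq> 0" if "\<zeta> \<in> ?B" for \<zeta>
  proof -
    have "norm (\<zeta> $ k - 1) < r" using that by (auto simp: polydisc_def dest!: spec[of _ k])
    then show "norm (\<zeta> $ k) \<ge> 1/2"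
      using norm_triangle_ineq2[of 1 "1 - \<zeta> $ k"] r by (simp add: norm_minus_commute)
    then show "\<zeta> $ k \<noteq> 0" by auto
  qed
  define E where "E G i \<zeta> = V (G \<zeta>) $ i / \<zeta> $ k" for G :: "complex ^ 'n \<Rightarrow> complex ^ 'n" and i \<zeta>
  \<comment> \<open>The differential equation as an integral equation: on the slice w = 1 the first
    terms are the prescribed initial value, and they do not depend on w; the primitive integrates
    \<open>V (G \<zeta>) / \<zeta> $ k\<close> from there.\<close>
  define T where "T G \<zeta> = p + (\<zeta> - axis k (\<zeta> $ k)) + (\<chi> i. fibre_primitive k (E G i) \<zeta>)"
    for G :: "complex ^ 'n \<Rightarrow> complex ^ 'n" and \<zeta>
  define ok where "ok G \<longleftrightarrow> (\<forall>i. holo_on UNIV ?B (\<lambda>\<zeta>. G \<zeta> $ i)) \<and> G ` ?B \<subseteq> cball p R"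
    for G :: "complex ^ 'n \<Rightarrow> complex ^ 'n"
  have hE: "holo_on UNIV ?B (E G i)" if "ok G" for G i
    unfolding E_def
  proof (rule holo_on_divide[OF rB _ holo_on_coord[OF rB]])
    show "holo_on UNIV ?B (\<lambda>\<zeta>. V (G \<zeta>) $ i)"
      by (rule holo_on_compose[OF rB rS _ _ V]) (use that R(2) in \<open>auto simp: ok_def\<close>)
  qed (use w in auto)
  have E_diff: "norm (E G i \<zeta> - E H i \<zeta>) \<le> 2 * L * e"
    if "ok G" "ok H" "\<zeta> \<in> ?B" "norm (G \<zeta> - H \<zeta>) \<le> e" for G H i \<zeta> e
  proof -
    have "norm (E G i \<zeta> - E H i \<zeta>) = norm (V (G \<zeta>) $ i - V (H \<zeta>) $ i) / norm (\<zeta> $ k)"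
      by (simp add: E_def norm_divide flip: diff_divide_distrib)
    also have "\<dots> \<le> (L * e) / (1/2)"
    proof (rule frac_le)
      have "norm (V (G \<zeta>) $ i - V (H \<zeta>) $ i) \<le> L * norm (G \<zeta> - H \<zeta>)"
        by (rule L) (use that in \<open>auto simp: ok_def\<close>)
      also have "\<dots> \<le> L * e" using that(4) L0 by (rule mult_left_mono)
      finally show "norm (V (G \<zeta>) $ i - V (H \<zeta>) $ i) \<le> L * e" .
      show "0 \<le> L * e" using L0 order_trans[OF norm_ge_zero that(4)] by simp
    qed (use w[OF that(3)] in auto)
    finally show ?thesis by simp
  qed
  have T_contract: "norm (T G \<zeta> - T H \<zeta>) \<le> e / 2"
    if "ok G" "ok H" "\<zeta> \<in> ?B" "\<And>\<zeta>. \<zeta> \<in> ?B \<Longrightarrow> norm (G \<zeta> - H \<zeta>) \<le> e" for G H \<zeta> e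
  proof -
    have e: "e \<ge> 0" using that(4)[OF that(3)] norm_ge_zero order_trans by blast
    have "norm (T G \<zeta> - T H \<zeta>) \<le> N * (r * (2 * L * e))"
      unfolding N_def
    proof (rule norm_le_card_cart)
      fix i
      have "norm (fibre_primitive k (E G i) \<zeta> - fibre_primitive k (E H i) \<zeta>) \<le> r * (2 * L * e)"
        by (rule fibre_primitive_bound[OF hE[OF that(1)] that(3) hE[OF that(2)]]) (rule E_diff[OF that(1,2) _ that(4)])
      then show "norm ((T G \<zeta> - T H \<zeta>) $ i) \<le> r * (2 * L * e)" by (simp add: T_def)
    qed
    also have "\<dots> = N * (r * (2 * L)) * e" by simp
    also have "\<dots> \<le> 1/2 * e" using rL e by (rule mult_right_mono)
    finally show ?thesis by simp
  qed
  have T_ok: "ok (T G)" if "ok G" for G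
    unfolding ok_def
  proof (intro conjI allI)
    show "holo_on UNIV ?B (\<lambda>\<zeta>. T G \<zeta> $ i)" for i
    proof -
      have *: "(\<lambda>\<zeta>. T G \<zeta> $ i) = (\<lambda>\<zeta>. p $ i + (if i = k then 0 else \<zeta> $ i) + fibre_primitive k (E G i) \<zeta>)"
        by (auto simp: T_def axis_nth_eq)
      have "holo_on UNIV ?B (\<lambda>\<zeta>. if i = k then 0 else \<zeta> $ i)"
        by (cases "i = k") (simp_all add: holo_on_const holo_on_coord[OF rB])
      then show ?thesis unfolding *
        by (intro holo_on_add holo_on_const holo_on_fibre_primitive hE that rB)
    qed
    show "T G ` ?B \<subseteq> cball p R"
    proof clarify
      fix \<zeta> assume z: "\<zeta> \<in> ?B"
      have "norm (T G \<zeta> - p) \<le> N * (r + r * (2 * M))"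
        unfolding N_def
      proof (rule norm_le_card_cart)
        fix i
        \<comment> \<open>Comparison with the zero function turns the estimate for differences of
          primitives into a bound on a single one.\<close>
        have z0: "fibre_primitive k (\<lambda>\<zeta>. 0) \<zeta> = 0" by (simp add: fibre_primitive_def)
        have "norm (E G i \<xi> - 0) \<le> 2 * M" if "\<xi> \<in> ?B" for \<xi>
        proof -
          have "norm (V (G \<xi>) $ i) / norm (\<xi> $ k) \<le> M / (1/2)"
            by (rule frac_le) (use w[OF that] M0 \<open>ok G\<close> that in \<open>auto simp: ok_def intro!: M\<close>)
          then show ?thesis by (simp add: E_def norm_divide)
        qed
        from fibre_primitive_bound[OF hE[OF that] z holo_on_const this]
        have 1: "norm (fibre_primitive k (E G i) \<zeta>) \<le> r * (2 * M)" unfolding z0 by simp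
        have 2: "norm ((\<zeta> - axis k (\<zeta> $ k)) $ i) \<le> r"
          using z r by (auto simp: polydisc_def axis_nth_eq less_imp_le dest!: spec[of _ i])
        have "(T G \<zeta> - p) $ i = (\<zeta> - axis k (\<zeta> $ k)) $ i + fibre_primitive k (E G i) \<zeta>"
          by (simp add: T_def)
        then show "norm ((T G \<zeta> - p) $ i) \<le> r + r * (2 * M)"
          using norm_triangle_mono[OF 2 1] by simp
      qed
      also have "\<dots> = N * (r * (1 + 2 * M))" by (simp add: algebra_simps)
      also have "\<dots> \<le> R" by (rule rR)
      finally show "T G \<zeta> \<in> cball p R" by (simp add: dist_norm norm_minus_commute)
    qed
  qed
  define G where "G m = (T ^^ m) (\<lambda>_. p)" for m
  have G_Suc: "G (Suc m) = T (G m)" for m by (simp add: G_def)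
  have G_ok: "ok (G m)" for m
  proof (induction m)
    case 0
    show ?case using R(1) by (auto simp: G_def ok_def holo_on_const)
  qed (simp add: G_Suc T_ok)
  \<comment> \<open>The first iterate lies in the ball of radius \<open>R\<close> around the
    constant start \<open>p\<close>; every further step halves the bound.\<close>
  have step: "norm (G (Suc m) \<zeta> - G m \<zeta>) \<le> R * (1/2) ^ m" if "\<zeta> \<in> ?B" for m \<zeta>
    using that
  proof (induction m arbitrary: \<zeta>)
    case 0
    have "G (Suc 0) \<zeta> \<in> cball p R" using G_ok[of "Suc 0"] 0 by (auto simp: ok_def)
    then show ?case by (simp add: G_def dist_norm norm_minus_commute)
  next
    case (Suc m)
    show ?case using T_contract[OF G_ok G_ok Suc.prems Suc.IH] by (simp add: G_Suc[symmetric])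
  qed
  obtain g where g: "uniform_limit ?B G g sequentially"
    using uniform_limit_telescope[OF step] .
  have g_ok: "ok g"
    unfolding ok_def
  proof (intro conjI allI)
    fix i
    have "uniform_limit ?B (\<lambda>m \<zeta>. G m \<zeta> $ i) (\<lambda>\<zeta>. g \<zeta> $ i) sequentially"
      by (rule bounded_linear.uniform_limit[OF bounded_linear_vec_nth g])
    then show "holo_on UNIV ?B (\<lambda>\<zeta>. g \<zeta> $ i)"
      by (rule holo_on_uniform_limit[OF rB, rotated]) (use G_ok in \<open>auto simp: ok_def\<close>)
    show "g ` ?B \<subseteq> cball p R"
    proof clarify
      fix \<zeta> assume z: "\<zeta> \<in> ?B"
      have "(\<lambda>m. G m \<zeta>) \<longlonglongrightarrow> g \<zeta>" using tendsto_uniform_limitI[OF g z] .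
      then show "g \<zeta> \<in> cball p R"
        by (rule closed_sequentially[OF closed_cball, rotated]) (use G_ok z in \<open>unfold ok_def, blast\<close>)
    qed
  qed
  have fixpt: "T g \<zeta> = g \<zeta>" if z: "\<zeta> \<in> ?B" for \<zeta>
  proof -
    have "norm (T g \<zeta> - g \<zeta>) \<le> e" if e: "e > 0" for e
    proof -
      have "\<forall>\<^sub>F m in sequentially. \<forall>\<zeta>\<in>?B. dist (G m \<zeta>) (g \<zeta>) < e/2"
        using uniform_limitD[OF g, of "e/2"] e by simp
      then obtain m where m: "\<And>n \<zeta>. n \<ge> m \<Longrightarrow> \<zeta> \<in> ?B \<Longrightarrow> dist (G n \<zeta>) (g \<zeta>) < e/2"
        unfolding eventually_sequentially by blast
      have "norm (g \<zeta> - G m \<zeta>) \<le> e/2" if "\<zeta> \<in> ?B" for \<zeta>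
        using m[OF order_refl that] by (simp add: dist_norm norm_minus_commute)
      from T_contract[OF g_ok G_ok z this]
      have "norm (T g \<zeta> - G (Suc m) \<zeta>) \<le> e/2/2" by (simp add: G_Suc)
      moreover have "norm (G (Suc m) \<zeta> - g \<zeta>) \<le> e/2" using m[of "Suc m" \<zeta>] z by (simp add: dist_norm)
      ultimately show ?thesis
        using norm_triangle_ineq[of "T g \<zeta> - G (Suc m) \<zeta>" "G (Suc m) \<zeta> - g \<zeta>"] e by simp
    qed
    then have "norm (T g \<zeta> - g \<zeta>) \<le> 0" by (rule field_le_epsilon[where y = 0, simplified])
    then show ?thesis by simp
  qed
  have der: "\<zeta> $ k * cpartial k (\<lambda>\<zeta>. g \<zeta> $ i) \<zeta> = V (g \<zeta>) $ i" if z: "\<zeta> \<in> ?B" for \<zeta> i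
  proof -
    have h: "holo_on UNIV ?B (\<lambda>\<zeta>. p $ i + (if i = k then 0 else \<zeta> $ i))"
      by (intro holo_on_add holo_on_const rB) (cases "i = k"; simp add: holo_on_const holo_on_coord[OF rB])
    have "((\<lambda>w. p $ i + (if i = k then 0 else (\<zeta> + axis k w) $ i)) has_field_derivative 0) (at 0)"
      by (cases "i = k") (auto simp: axis_nth_eq)
    then have c: "cpartial k (\<lambda>\<zeta>. p $ i + (if i = k then 0 else \<zeta> $ i)) \<zeta> = 0"
      by (rule has_field_derivative_cpartial)
    have "cpartial k (\<lambda>\<zeta>. g \<zeta> $ i) \<zeta> =
        cpartial k (\<lambda>\<zeta>. (p $ i + (if i = k then 0 else \<zeta> $ i)) + fibre_primitive k (E g i) \<zeta>) \<zeta>"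
    proof (rule cpartial_cong[OF rB z UNIV_I])
      fix \<zeta> assume "\<zeta> \<in> ?B"
      from fixpt[OF this, symmetric] have "g \<zeta> $ i = T g \<zeta> $ i" by simp
      then show "g \<zeta> $ i = (p $ i + (if i = k then 0 else \<zeta> $ i)) + fibre_primitive k (E g i) \<zeta>"
        by (simp add: T_def axis_nth_eq)
    qed
    also have "\<dots> = 0 + E g i \<zeta>"
      unfolding cpartial_add[OF rB h holo_on_fibre_primitive[OF hE[OF g_ok]] z UNIV_I] c
        cpartial_fibre_primitive[OF hE[OF g_ok] z] ..
    finally show ?thesis using w[OF z] by (simp add: E_def)
  qed
  have init: "g \<zeta> = p + \<zeta> - axis k 1" if "\<zeta> \<in> ?B" "\<zeta> $ k = 1" for \<zeta>
  proof -
    have "(\<chi> i. fibre_primitive k (E g i) \<zeta>) = 0" using that(2) by (simp add: fibre_primitive_def vec_eq_iff)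
    then have "T g \<zeta> = p + \<zeta> - axis k 1" using that(2) by (simp add: T_def)
    with fixpt[OF that(1)] show ?thesis by simp
  qed
  show ?thesis
    by (rule that[OF r _ _ der init]) (use g_ok R(2) in \<open>auto simp: ok_def\<close>)
qed

text \<open>Puts the complex Jacobian into the form that the real inverse function theorem expects,
  a continuous map into bounded real-linear operators.\<close>

lemma cpartial_continuous_linear_blinfun:
  fixes F :: "complex ^ 'n::finite \<Rightarrow> complex ^ 'n"
  assumes B: "open B" and F: "\<And>i. holo_on UNIV B (\<lambda>z. F z $ i)"
  obtains F' :: "complex ^ 'n \<Rightarrow> ((complex ^ 'n) \<Rightarrow>\<^sub>L (complex ^ 'n))"
  where "continuous_on B F'" "\<And>z h. blinfun_apply (F' z) h = (\<chi> j. \<Sum>i\<in>UNIV. cpartial i (\<lambda>z. F z $ j) z * h $ i)"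
    "\<And>z. z \<in> B \<Longrightarrow> (F has_derivative blinfun_apply (F' z)) (at z)"
proof -
  have rB: "rel_open UNIV B" using B by simp
  define M where "M a i j = Blinfun (\<lambda>h::complex^'n. axis j (a * h $ i) :: complex^'n)" for a i j
  have bl: "bounded_linear (\<lambda>h::complex^'n. axis j (a * h $ i) :: complex^'n)" for a i j
    by (intro bounded_linear_compose[OF bounded_linear_axis] bounded_linear_const_mult bounded_linear_vec_nth)
  have M: "blinfun_apply (M a i j) h = axis j (a * h $ i)" for a i j h
    unfolding M_def bounded_linear_Blinfun_apply[OF bl] ..
  \<comment> \<open>The operators form a real vector space, so a complex entry enters through its
    real and imaginary parts, with one matrix unit for 1 and one for \<i>.\<close>
  define F' where "F' z = (\<Sum>j\<in>UNIV. \<Sum>i\<in>UNIV. Re (cpartial i (\<lambda>z. F z $ j) z) *\<^sub>R M 1 i j + Im (cpartial i (\<lambda>z. F z $ j) z) *\<^sub>R M \<i> i j)" for z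
  have ap: "blinfun_apply (F' z) h = (\<chi> j. \<Sum>i\<in>UNIV. cpartial i (\<lambda>z. F z $ j) z * h $ i)" for z h
  proof -
    have c: "Re c *\<^sub>R axis j x + Im c *\<^sub>R axis j (\<i> * x) = axis j (c * x)" for c x :: complex and j :: 'n
    proof -
      have "of_real (Re c) * x + of_real (Im c) * (\<i> * x) = c * x" by (simp add: complex_eq_iff)
      then show ?thesis by (simp only: scaleR_axis flip: axis_add)
    qed
    have "blinfun_apply (F' z) h = (\<Sum>j\<in>UNIV. \<Sum>i\<in>UNIV. axis j (cpartial i (\<lambda>z. F z $ j) z * h $ i))"
      by (simp only: F'_def blinfun.sum_left blinfun.add_left blinfun.scaleR_left M mult_1_left c)
    also have "\<dots> = (\<Sum>j\<in>UNIV. axis j (\<Sum>i\<in>UNIV. cpartial i (\<lambda>z. F z $ j) z * h $ i))"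
      by (intro sum.cong refl linear_sum[symmetric, OF bounded_linear.linear[OF bounded_linear_axis], unfolded o_def])
    also have "\<dots> = (\<chi> j. \<Sum>i\<in>UNIV. cpartial i (\<lambda>z. F z $ j) z * h $ i)"
    proof -
      have "(\<chi> j. \<Sum>i\<in>UNIV. cpartial i (\<lambda>z. F z $ j) z * h $ i) =
          (\<Sum>j\<in>UNIV. axis j ((\<chi> j. \<Sum>i\<in>UNIV. cpartial i (\<lambda>z. F z $ j) z * h $ i) $ j))"
        by (rule vec_eq_sum_axis)
      then show ?thesis by (simp only: vec_lambda_beta)
    qed
    finally show ?thesis .
  qed
  show ?thesis
  proof (rule that[of F'])
    show "continuous_on B F'"
      unfolding F'_def
      by (intro continuous_on_sum continuous_on_add continuous_on_scaleR continuous_on_const continuous_on_Re continuous_on_Im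
          holo_on_continuous[OF holo_on_cpartial[OF rB F UNIV_I]])
    show "blinfun_apply (F' z) h = (\<chi> j. \<Sum>i\<in>UNIV. cpartial i (\<lambda>z. F z $ j) z * h $ i)" for z h by (rule ap)
    show "(F has_derivative blinfun_apply (F' z)) (at z)" if "z \<in> B" for z
    proof -
      have "(F has_derivative (\<lambda>h. \<chi> j. if j \<in> UNIV then \<Sum>i\<in>UNIV. cpartial i (\<lambda>z. F z $ j) z * h $ i else 0)) (at z within B)"
        by (rule holo_map_has_derivative[OF rB F _ that]) auto
      moreover have "at z within B = at z" by (rule at_within_open[OF that B])
      moreover have "blinfun_apply (F' z) = (\<lambda>h. \<chi> j. if j \<in> UNIV then \<Sum>i\<in>UNIV. cpartial i (\<lambda>z. F z $ j) z * h $ i else 0)"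
        by (rule ext) (simp add: ap)
      ultimately show ?thesis by simp
    qed
  qed
qed

text \<open>The real inverse function theorem, upgraded: the inverse of a bijective complex-linear map
  is complex-linear.\<close>

lemma holo_inverse_function:
  fixes F :: "complex ^ 'n::finite \<Rightarrow> complex ^ 'n"
  assumes B: "open B" and F: "\<And>i. holo_on UNIV B (\<lambda>z. F z $ i)" and z0: "z0 \<in> B"
    and inv: "bounded_linear D" "\<And>h. D (\<chi> j. \<Sum>i\<in>UNIV. cpartial i (\<lambda>z. F z $ j) z0 * h $ i) = h"
  obtains U g where "open U" "U \<subseteq> B" "z0 \<in> U" "\<And>W. open W \<Longrightarrow> W \<subseteq> U \<Longrightarrow> open (F ` W)"
    "\<And>z. z \<in> U \<Longrightarrow> g (F z) = z" "\<And>i. holo_on UNIV (F ` U) (\<lambda>y. g y $ i)"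
proof -
  obtain F' :: "complex ^ 'n \<Rightarrow> ((complex ^ 'n) \<Rightarrow>\<^sub>L (complex ^ 'n))"
    where F': "continuous_on B F'" "\<And>z h. blinfun_apply (F' z) h = (\<chi> j. \<Sum>i\<in>UNIV. cpartial i (\<lambda>z. F z $ j) z * h $ i)"
      "\<And>z. z \<in> B \<Longrightarrow> (F has_derivative blinfun_apply (F' z)) (at z)"
    by (rule cpartial_continuous_linear_blinfun[OF B F]) blast
  have id: "Blinfun D o\<^sub>L F' z0 = id_blinfun"
    by (rule blinfun_eqI) (simp add: bounded_linear_Blinfun_apply[OF inv(1)] F'(2) inv(2))
  show ?thesis
  proof (rule inverse_function_theorem[OF B _ F'(1) z0 id, where f = F])
  show "(F has_derivative blinfun_apply (F' x)) (at x)" if "x \<in> B" for x using F'(3)[OF that] .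
  next
  fix U V g g' assume U: "open U" "U \<subseteq> B" "z0 \<in> U" "open V" "F z0 \<in> V" "homeomorphism U V F g"
    and g: "\<And>y. y \<in> V \<Longrightarrow> (g has_derivative (g' y)) (at y)"
      "\<And>y. y \<in> V \<Longrightarrow> g' y = Hilbert_Choice.inv (blinfun_apply (F' (g y)))"
      "\<And>y. y \<in> V \<Longrightarrow> bij (blinfun_apply (F' (g y)))"
  have FU: "F ` U = V" "\<And>z. z \<in> U \<Longrightarrow> g (F z) = z"
    using U(6) by (auto simp: homeomorphism_def)
  show ?thesis
  proof (rule that[OF U(1-3) _ FU(2)])
    fix W assume W: "open W" "W \<subseteq> U"
    have "openin (top_of_set U) W" using W U(1) by (simp add: openin_open_eq)
    from homeomorphism_imp_open_map[OF U(6) this] have "openin (top_of_set V) (F ` W)" .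
    then show "open (F ` W)" by (rule openin_open_trans[OF _ U(4)])
  next
    fix i
    show "holo_on UNIV (F ` U) (\<lambda>y. g y $ i)"
      unfolding holo_on_def FU(1)
    proof
      fix y assume y: "y \<in> V"
      let ?D = "blinfun_apply (F' (g y))"
      have scal: "?D (c *s h) = c *s ?D h" for c h
        by (simp add: F'(2) vec_eq_iff sum_distrib_left mult_ac)
      have g's: "g' y (c *s h) = c *s g' y h" for c h
      proof -
        obtain x where x: "h = ?D x" using bij_is_surj[OF g(3)[OF y]] by (elim surjE)
        show ?thesis
          unfolding g(2)[OF y] x scal[symmetric] using g(3)[OF y] by (simp add: bij_is_inj)
      qed
      have "linear (g' y)" by (rule has_derivative_linear[OF g(1)[OF y]])
      have ax: "axis j x = x *s (axis j 1 :: complex^'n)" for j x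
        by (simp add: vec_eq_iff axis_nth_eq)
      have "g' y h $ i = (\<Sum>j\<in>UNIV. g' y (axis j 1) $ i * h $ j)" for h
      proof -
        have "g' y h = g' y (\<Sum>j\<in>UNIV. axis j (h $ j))" by (simp flip: vec_eq_sum_axis)
        also have "\<dots> = (\<Sum>j\<in>UNIV. g' y (axis j (h $ j)))"
          by (rule linear_sum[OF \<open>linear (g' y)\<close>])
        also have "\<dots> $ i = (\<Sum>j\<in>UNIV. g' y (axis j 1) $ i * h $ j)"
          unfolding sum_component by (subst ax) (simp add: g's mult.commute)
        finally show ?thesis .
      qed
      then have eq: "(\<lambda>h. g' y h $ i) = (\<lambda>h. \<Sum>j\<in>UNIV. g' y (axis j 1) $ i * h $ j)" by (rule ext)
      have "((\<lambda>y. g y $ i) has_derivative (\<lambda>h. g' y h $ i)) (at y within V)"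
        by (rule has_derivative_at_withinI[OF bounded_linear.has_derivative[OF bounded_linear_vec_nth g(1)[OF y]]])
      then have "((\<lambda>y. g y $ i) has_derivative (\<lambda>h. \<Sum>j\<in>UNIV. g' y (axis j 1) $ i * h $ j)) (at y within V)"
        by (rule has_derivative_eq_rhs[OF _ eq])
      then show "\<exists>a. ((\<lambda>y. g y $ i) has_derivative (\<lambda>h. \<Sum>j\<in>UNIV. a j * h $ j)) (at y within V)"
        by (rule exI[of _ "\<lambda>j. g' y (axis j 1) $ i"])
    qed
  qed
  qed
qed

text \<open>A coordinate in which \<open>V p\<close> does not vanish makes the slice w = 1
  transversal to the field, so flowing out from this slice gives local coordinates.\<close>

theorem flow_box:
  fixes V :: "complex ^ 'n::finite \<Rightarrow> complex ^ 'n"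
  assumes S: "open S" and p: "p \<in> S" and V: "\<And>i. holo_on UNIV S (\<lambda>z. V z $ i)" and Vp: "V p \<noteq> 0"
  obtains k :: 'n and r and G g :: "complex ^ 'n \<Rightarrow> complex ^ 'n" where "0 < r" "r \<le> 1/2" "G ` polydisc k r \<subseteq> S" "G (axis k 1) = p"
    "open (G ` polydisc k r)"
    "\<And>i. holo_on UNIV (polydisc k r) (\<lambda>\<zeta>. G \<zeta> $ i)"
    "\<And>i. holo_on UNIV (G ` polydisc k r) (\<lambda>z. g z $ i)"
    "\<And>\<zeta>. \<zeta> \<in> polydisc k r \<Longrightarrow> g (G \<zeta>) = \<zeta>"
    "\<And>\<zeta> i. \<zeta> \<in> polydisc k r \<Longrightarrow> \<zeta> $ k * cpartial k (\<lambda>\<zeta>. G \<zeta> $ i) \<zeta> = V (G \<zeta>) $ i"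
proof -
  obtain k where k: "V p $ k \<noteq> 0" using Vp by (auto simp: vec_eq_iff)
  obtain r G where r: "0 < r" "r \<le> 1/2" and GS: "G ` polydisc k r \<subseteq> S"
    and G: "\<And>i. holo_on UNIV (polydisc k r) (\<lambda>\<zeta>. G \<zeta> $ i)"
    and GV: "\<And>\<zeta> i. \<zeta> \<in> polydisc k r \<Longrightarrow> \<zeta> $ k * cpartial k (\<lambda>\<zeta>. G \<zeta> $ i) \<zeta> = V (G \<zeta>) $ i"
    and G1: "\<And>\<zeta>. \<zeta> \<in> polydisc k r \<Longrightarrow> \<zeta> $ k = 1 \<Longrightarrow> G \<zeta> = p + \<zeta> - axis k 1"
    by (rule euler_flow[OF S p V, where k = k]) blast
  let ?e = "axis k 1 :: complex ^ 'n"
  have e: "?e \<in> polydisc k r" using axis_in_polydisc r(1) .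
  have Ge: "G ?e = p" using G1[OF e] by (simp add: axis_nth_eq)
  \<comment> \<open>The flow equation at w = 1 makes \<open>V p\<close> the k-th column of the
    Jacobian; on the slice the map is a translation, so the other columns are unit vectors.\<close>
  have d: "cpartial i (\<lambda>\<zeta>. G \<zeta> $ j) ?e = (if i = k then V p $ j else if i = j then 1 else 0)" for i j
  proof (cases "i = k")
    case True
    then show ?thesis using GV[OF e, of j] by (simp add: axis_nth_eq Ge)
  next
    case False
    obtain d where d: "d > 0" "\<And>w. norm w < d \<Longrightarrow> ?e + axis i w \<in> polydisc k r"
      using rel_open_axisE[OF rel_open_polydisc e UNIV_I] by blast
    have "\<forall>\<^sub>F w in nhds 0. G (?e + axis i w) $ j = p $ j - ?e $ j + (?e + axis i w) $ j"
      unfolding eventually_nhds_metric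
    proof (intro exI[of _ d] conjI allI impI d(1))
      fix w :: complex assume "dist w 0 < d"
      then have "G (?e + axis i w) = p + (?e + axis i w) - ?e"
        by (intro G1 d(2)) (use False in \<open>simp_all add: axis_nth_eq\<close>)
      then show "G (?e + axis i w) $ j = p $ j - ?e $ j + (?e + axis i w) $ j" by simp
    qed
    then have "cpartial i (\<lambda>\<zeta>. G \<zeta> $ j) ?e = deriv (\<lambda>w. p $ j - ?e $ j + (?e + axis i w) $ j) 0"
      unfolding cpartial_def by (intro deriv_cong_ev refl)
    also have "\<dots> = 0 + (if i = j then 1 else 0)"
      by (rule DERIV_imp_deriv, intro DERIV_add DERIV_const axis_derivative_coord)
    finally show ?thesis using False by simp
  qed
  \<comment> \<open>The inverse of that Jacobian: solve the row k for the unknown k, then substitute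
    into the other rows.\<close>
  define D where "D y = (\<chi> j. if j = k then y $ k / V p $ k else y $ j - V p $ j * (y $ k / V p $ k))" for y :: "complex ^ 'n"
  have bD: "bounded_linear D"
    unfolding linear_conv_bounded_linear[symmetric]
    by (rule linearI) (auto simp: D_def vec_eq_iff add_divide_distrib algebra_simps scaleR_conv_of_real[where 'a = complex])
  have row: "(\<Sum>i\<in>UNIV. cpartial i (\<lambda>\<zeta>. G \<zeta> $ j) ?e * h $ i) = (if j = k then V p $ k * h $ k else V p $ j * h $ k + h $ j)" for j h
  proof -
    have "(\<Sum>i\<in>UNIV. cpartial i (\<lambda>\<zeta>. G \<zeta> $ j) ?e * h $ i) =
        (\<Sum>i\<in>UNIV. (if i = k then V p $ j * h $ k else 0) + (if i = j then if j = k then 0 else h $ j else 0))"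
      by (rule sum.cong) (auto simp: d)
    also have "\<dots> = V p $ j * h $ k + (if j = k then 0 else h $ j)"
      by (simp add: sum.distrib)
    finally show ?thesis by simp
  qed
  have Dinv: "D (\<chi> j. \<Sum>i\<in>UNIV. cpartial i (\<lambda>\<zeta>. G \<zeta> $ j) ?e * h $ i) = h" for h
    unfolding row using k by (auto simp: D_def vec_eq_iff)
  show ?thesis
  proof (rule holo_inverse_function[OF open_polydisc G e bD Dinv])
  fix U g assume U: "open U" "U \<subseteq> polydisc k r" "?e \<in> U" "\<And>W. open W \<Longrightarrow> W \<subseteq> U \<Longrightarrow> open (G ` W)"
    "\<And>z. z \<in> U \<Longrightarrow> g (G z) = z" "\<And>i. holo_on UNIV (G ` U) (\<lambda>y. g y $ i)"
  obtain \<epsilon> where \<epsilon>: "\<epsilon> > 0" "cball ?e \<epsilon> \<subseteq> U" using U(1,3) open_contains_cball by blast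
  \<comment> \<open>The second bound places the polydisc inside the ball of radius
    \<open>\<epsilon>\<close>, on which the flow map is inverted by \<open>g\<close>.\<close>
  define \<rho> where "\<rho> = min r (\<epsilon> / real CARD('n))"
  have "\<rho> \<le> r" by (simp add: \<rho>_def)
  then have \<rho>: "\<rho> > 0" "\<rho> \<le> 1/2" using r \<epsilon>(1) by (simp add: \<rho>_def, linarith)
  have sub: "polydisc k \<rho> \<subseteq> U" "polydisc k \<rho> \<subseteq> polydisc k r"
    by (rule subset_trans[OF polydisc_mono subset_trans[OF polydisc_subset_ball[OF \<epsilon>(1)] \<epsilon>(2)]])
      (simp add: \<rho>_def, rule polydisc_mono, simp add: \<rho>_def)
  show ?thesis
  proof (rule that[where k = k and r = \<rho> and G = G and g = g, OF \<rho>])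
    show "G ` polydisc k \<rho> \<subseteq> S" "G ?e = p" using GS sub(2) Ge by auto
    show "open (G ` polydisc k \<rho>)" by (rule U(4)[OF open_polydisc sub(1)])
    show "holo_on UNIV (polydisc k \<rho>) (\<lambda>\<zeta>. G \<zeta> $ i)" for i by (rule holo_on_subset[OF G sub(2)])
    show "holo_on UNIV (G ` polydisc k \<rho>) (\<lambda>z. g z $ i)" for i
      by (rule holo_on_subset[OF U(6)]) (use sub(1) in auto)
    show "g (G \<zeta>) = \<zeta>" if "\<zeta> \<in> polydisc k \<rho>" for \<zeta> using U(5) sub(1) that by auto
    show "\<zeta> $ k * cpartial k (\<lambda>\<zeta>. G \<zeta> $ i) \<zeta> = V (G \<zeta>) $ i" if "\<zeta> \<in> polydisc k \<rho>" for \<zeta> i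
      using GV sub(2) that by auto
  qed
  qed
qed

section \<open>Homogeneous Poisson brackets in coordinates\<close>

lemma sum_contract3:
  fixes b :: "'n::finite \<Rightarrow> 'n \<Rightarrow> complex"
  shows "(\<Sum>l\<in>UNIV. (\<Sum>i\<in>UNIV. b i l * A i) * (\<Sum>j\<in>UNIV. \<Sum>m\<in>UNIV. d l j m * B j * C m)) =
    (\<Sum>i\<in>UNIV. \<Sum>j\<in>UNIV. \<Sum>m\<in>UNIV. A i * B j * C m * (\<Sum>l\<in>UNIV. b i l * d l j m))"
proof -
  have "(\<Sum>l\<in>UNIV. (\<Sum>i\<in>UNIV. b i l * A i) * (\<Sum>j\<in>UNIV. \<Sum>m\<in>UNIV. d l j m * B j * C m)) =
      (\<Sum>l\<in>UNIV. \<Sum>i\<in>UNIV. \<Sum>j\<in>UNIV. \<Sum>m\<in>UNIV. A i * B j * C m * (b i l * d l j m))"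
    by (simp only: sum_distrib_right, simp only: sum_distrib_left mult_ac)
  also have "\<dots> = (\<Sum>i\<in>UNIV. \<Sum>l\<in>UNIV. \<Sum>j\<in>UNIV. \<Sum>m\<in>UNIV. A i * B j * C m * (b i l * d l j m))"
    by (rule sum.swap)
  also have "\<dots> = (\<Sum>i\<in>UNIV. \<Sum>j\<in>UNIV. \<Sum>l\<in>UNIV. \<Sum>m\<in>UNIV. A i * B j * C m * (b i l * d l j m))"
    by (rule sum.cong[OF refl], rule sum.swap)
  also have "\<dots> = (\<Sum>i\<in>UNIV. \<Sum>j\<in>UNIV. \<Sum>m\<in>UNIV. \<Sum>l\<in>UNIV. A i * B j * C m * (b i l * d l j m))"
    by (rule sum.cong[OF refl], rule sum.cong[OF refl], rule sum.swap)
  finally show ?thesis by (simp only: sum_distrib_left)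
qed

lemma sum_rotate3:
  fixes F :: "'n::finite \<Rightarrow> 'n \<Rightarrow> 'n \<Rightarrow> complex"
  shows "(\<Sum>i\<in>UNIV. \<Sum>j\<in>UNIV. \<Sum>m\<in>UNIV. F i j m) = (\<Sum>i\<in>UNIV. \<Sum>j\<in>UNIV. \<Sum>m\<in>UNIV. F j m i)"
proof -
  have "(\<Sum>i\<in>UNIV. \<Sum>j\<in>UNIV. \<Sum>m\<in>UNIV. F j m i) = (\<Sum>j\<in>UNIV. \<Sum>i\<in>UNIV. \<Sum>m\<in>UNIV. F j m i)"
    by (rule sum.swap)
  also have "\<dots> = (\<Sum>j\<in>UNIV. \<Sum>m\<in>UNIV. \<Sum>i\<in>UNIV. F j m i)"
    by (rule sum.cong[OF refl], rule sum.swap)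
  finally show ?thesis by simp
qed

lemma sum_swap13:
  fixes F :: "'n::finite \<Rightarrow> 'n \<Rightarrow> 'n \<Rightarrow> complex"
  shows "(\<Sum>i\<in>UNIV. \<Sum>j\<in>UNIV. \<Sum>m\<in>UNIV. F i j m) = (\<Sum>i\<in>UNIV. \<Sum>j\<in>UNIV. \<Sum>m\<in>UNIV. F m j i)"
proof -
  have "(\<Sum>i\<in>UNIV. \<Sum>j\<in>UNIV. \<Sum>m\<in>UNIV. F m j i) = (\<Sum>i\<in>UNIV. \<Sum>j\<in>UNIV. \<Sum>m\<in>UNIV. F i m j)"
    by (rule sum_rotate3[of "\<lambda>i j m. F m j i"])
  also have "\<dots> = (\<Sum>i\<in>UNIV. \<Sum>j\<in>UNIV. \<Sum>m\<in>UNIV. F i j m)"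
    by (rule sum.cong[OF refl], rule sum.swap)
  finally show ?thesis by (rule sym)
qed

text \<open>The Leibniz expansion of the l-th derivative of a bracket, with \<open>d\<close> for the
  derivatives of \<open>b\<close> and \<open>HB\<close>, \<open>HC\<close> for those of
  \<open>B\<close>, \<open>C\<close>. All of these are plain arrays, so one of the directions need
  not be a partial derivative.\<close>

definition bracket_deriv ::
  "('n::finite \<Rightarrow> 'n \<Rightarrow> complex) \<Rightarrow> ('n \<Rightarrow> 'n \<Rightarrow> 'n \<Rightarrow> complex) \<Rightarrow>
   ('n \<Rightarrow> complex) \<Rightarrow> ('n \<Rightarrow> 'n \<Rightarrow> complex) \<Rightarrow> ('n \<Rightarrow> complex) \<Rightarrow> ('n \<Rightarrow> 'n \<Rightarrow> complex) \<Rightarrow> 'n \<Rightarrow> complex" where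
  "bracket_deriv b d B HB C HC l =
     (\<Sum>j\<in>UNIV. \<Sum>m\<in>UNIV. d l j m * B j * C m + b j m * HB l j * C m + b j m * B j * HC l m)"

text \<open>The second order terms of the Jacobiator cancel by the symmetry of the Hessians; what is left
  is the Schouten bracket contracted with the three differentials.\<close>

lemma jacobi_algebraic:
  fixes b :: "'n::finite \<Rightarrow> 'n \<Rightarrow> complex"
  assumes skew: "\<And>i j. b i j = - b j i"
    and schouten: "\<And>i j m. (\<Sum>l\<in>UNIV. b l i * d l j m + b l j * d l m i + b l m * d l i j) = 0"
    and sym: "\<And>i j. HA i j = HA j i" "\<And>i j. HB i j = HB j i" "\<And>i j. HC i j = HC j i"
  shows "(\<Sum>i\<in>UNIV. \<Sum>l\<in>UNIV. b i l * A i * bracket_deriv b d B HB C HC l) +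
         (\<Sum>i\<in>UNIV. \<Sum>l\<in>UNIV. b i l * B i * bracket_deriv b d C HC A HA l) +
         (\<Sum>i\<in>UNIV. \<Sum>l\<in>UNIV. b i l * C i * bracket_deriv b d A HA B HB l) = 0"
proof -
  \<comment> \<open>\<open>h A\<close> is the Hamiltonian vector of \<open>A\<close>.
    \<open>Q\<close> evaluates a Hessian on two such vectors, and \<open>D\<close> collects the
    terms with derivatives of \<open>b\<close>.\<close>
  define h where "h A l = (\<Sum>i\<in>UNIV. b i l * A i)" for A l
  define Q where "Q H x y = (\<Sum>l\<in>UNIV. \<Sum>j\<in>UNIV. x l * H l j * y j)" for H :: "'n \<Rightarrow> 'n \<Rightarrow> complex" and x y
  define D where "D A B C = (\<Sum>i\<in>UNIV. \<Sum>j\<in>UNIV. \<Sum>m\<in>UNIV. A i * B j * C m * (\<Sum>l\<in>UNIV. b i l * d l j m))"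
    for A B C :: "'n \<Rightarrow> complex"
  have Q_sym: "Q H x y = Q H y x" if "\<And>i j. H i j = H j i" for H x y
    unfolding Q_def by (subst sum.swap, intro sum.cong refl) (simp add: that[of _ _] mult_ac)
  have split: "(\<Sum>i\<in>UNIV. \<Sum>l\<in>UNIV. b i l * A i * bracket_deriv b d B HB C HC l) =
      D A B C - Q HB (h A) (h C) + Q HC (h A) (h B)" for A B C HB HC
  proof -
    have "bracket_deriv b d B HB C HC l =
        (\<Sum>j\<in>UNIV. \<Sum>m\<in>UNIV. d l j m * B j * C m) - (\<Sum>j\<in>UNIV. HB l j * h C j) + (\<Sum>m\<in>UNIV. HC l m * h B m)" for l
    proof -
      have 1: "(\<Sum>j\<in>UNIV. \<Sum>m\<in>UNIV. b j m * HB l j * C m) = - (\<Sum>j\<in>UNIV. HB l j * h C j)"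
      proof -
        have "(\<Sum>m\<in>UNIV. b j m * HB l j * C m) = - (HB l j * h C j)" for j
        proof -
          have "(\<Sum>m\<in>UNIV. b j m * HB l j * C m) = (\<Sum>m\<in>UNIV. - (HB l j * (b m j * C m)))"
            by (rule sum.cong[OF refl]) (simp add: skew[of j])
          then show ?thesis by (simp add: h_def sum_negf sum_distrib_left)
        qed
        then show ?thesis by (simp add: sum_negf)
      qed
      have 2: "(\<Sum>j\<in>UNIV. \<Sum>m\<in>UNIV. b j m * B j * HC l m) = (\<Sum>m\<in>UNIV. HC l m * h B m)"
        by (subst sum.swap) (simp add: h_def sum_distrib_left mult_ac)
      show ?thesis unfolding bracket_deriv_def sum.distrib 1 2 by simp
    qed
    note A1 = this
    have "(\<Sum>i\<in>UNIV. \<Sum>l\<in>UNIV. b i l * A i * X l) = (\<Sum>l\<in>UNIV. h A l * X l)" for X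
      by (subst sum.swap) (simp add: h_def sum_distrib_right)
    then have "(\<Sum>i\<in>UNIV. \<Sum>l\<in>UNIV. b i l * A i * bracket_deriv b d B HB C HC l) =
        (\<Sum>l\<in>UNIV. h A l * bracket_deriv b d B HB C HC l)" .
    also have "\<dots> = (\<Sum>l\<in>UNIV. h A l * (\<Sum>j\<in>UNIV. \<Sum>m\<in>UNIV. d l j m * B j * C m)
        - h A l * (\<Sum>j\<in>UNIV. HB l j * h C j) + h A l * (\<Sum>m\<in>UNIV. HC l m * h B m))"
      by (simp only: A1 distrib_left right_diff_distrib)
    also have "\<dots> = (\<Sum>l\<in>UNIV. h A l * (\<Sum>j\<in>UNIV. \<Sum>m\<in>UNIV. d l j m * B j * C m))
        - Q HB (h A) (h C) + Q HC (h A) (h B)"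
      by (simp only: sum.distrib sum_subtractf Q_def sum_distrib_left mult.assoc)
    also have "(\<Sum>l\<in>UNIV. h A l * (\<Sum>j\<in>UNIV. \<Sum>m\<in>UNIV. d l j m * B j * C m)) = D A B C"
      unfolding h_def D_def by (rule sum_contract3)
    finally show ?thesis .
  qed
  have "D B C A = (\<Sum>i\<in>UNIV. \<Sum>j\<in>UNIV. \<Sum>m\<in>UNIV. A i * B j * C m * (\<Sum>l\<in>UNIV. b j l * d l m i))"
    unfolding D_def by (subst sum_rotate3) (simp only: mult_ac)
  moreover have "D C A B = (\<Sum>i\<in>UNIV. \<Sum>j\<in>UNIV. \<Sum>m\<in>UNIV. A i * B j * C m * (\<Sum>l\<in>UNIV. b m l * d l i j))"
    unfolding D_def by (subst (1) sum_rotate3, subst (1) sum_rotate3) (simp only: mult_ac)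
  ultimately have "D A B C + D B C A + D C A B = (\<Sum>i\<in>UNIV. \<Sum>j\<in>UNIV. \<Sum>m\<in>UNIV. A i * B j * C m *
      ((\<Sum>l\<in>UNIV. b i l * d l j m) + (\<Sum>l\<in>UNIV. b j l * d l m i) + (\<Sum>l\<in>UNIV. b m l * d l i j)))"
    by (simp only: D_def sum.distrib distrib_left)
  moreover have "(\<Sum>l\<in>UNIV. b i l * d l j m) + (\<Sum>l\<in>UNIV. b j l * d l m i) + (\<Sum>l\<in>UNIV. b m l * d l i j) = 0" for i j m
  proof -
    have "(\<Sum>l\<in>UNIV. b i l * d l j m) + (\<Sum>l\<in>UNIV. b j l * d l m i) + (\<Sum>l\<in>UNIV. b m l * d l i j)
      = (\<Sum>l\<in>UNIV. - (b l i * d l j m + b l j * d l m i + b l m * d l i j))"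
      unfolding sum.distrib[symmetric] by (rule sum.cong[OF refl]) (simp add: skew[of i] skew[of j] skew[of m])
    then show ?thesis by (simp only: sum_negf schouten minus_zero)
  qed
  ultimately have "D A B C + D B C A + D C A B = 0" by simp
  \<comment> \<open>Each Hessian occurs twice in the cyclic sum, with opposite signs and exchanged
    arguments.\<close>
  then show ?thesis
    unfolding split using Q_sym[OF sym(1), where x = "h B" and y = "h C"] Q_sym[OF sym(2), where x = "h A" and y = "h C"]
      Q_sym[OF sym(3), where x = "h A" and y = "h B"]
    by (simp add: algebra_simps)
qed

text \<open>On holomorphic functions these are Wirtinger derivatives, for which the symmetry has
  been reduced to real directions.\<close>

lemma cpartial_commute:
  assumes S: "rel_open I S" and f: "holo_on I S f" and z: "z \<in> S" and i: "i \<in> I" and j: "j \<in> I"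
  shows "cpartial i (cpartial j f) z = cpartial j (cpartial i f) z"
proof -
  have *: "cpartial a (cpartial c f) z = wirtinger a (wirtinger c f) z" if "a \<in> I" "c \<in> I" for a c
  proof -
    have "cpartial a (cpartial c f) z = wirtinger a (cpartial c f) z"
      by (rule wirtinger_holo[OF S holo_on_cpartial[OF S f that(2)] z that(1), symmetric])
    also have "\<dots> = wirtinger a (wirtinger c f) z"
      by (rule wirtinger_cong[OF S z that(1)]) (simp add: wirtinger_holo[OF S f _ that(2)])
    finally show ?thesis .
  qed
  show ?thesis unfolding *[OF i j] *[OF j i] by (rule wirtinger_commute[OF S holo_on_imp_smooth_on[OF S f] z i j])
qed

text \<open>Bivector fields and vector fields on an open subset of the coordinate space.\<close>

definition bracket :: "(complex ^ 'n::finite \<Rightarrow> 'n \<Rightarrow> 'n \<Rightarrow> complex) \<Rightarrow> (complex ^ 'n \<Rightarrow> complex) \<Rightarrow> (complex ^ 'n \<Rightarrow> complex) \<Rightarrow> complex ^ 'n \<Rightarrow> complex" where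
  "bracket b f g z = (\<Sum>i\<in>UNIV. \<Sum>j\<in>UNIV. b z i j * cpartial i f z * cpartial j g z)"

context
  fixes S :: "(complex ^ 'n::finite) set" and b :: "complex ^ 'n \<Rightarrow> 'n \<Rightarrow> 'n \<Rightarrow> complex"
  assumes S: "rel_open UNIV S" and b: "\<And>i j. holo_on UNIV S (\<lambda>z. b z i j)"
    and skew: "\<And>z i j. z \<in> S \<Longrightarrow> b z i j = - b z j i"
begin

lemma holo_on_bracket:
  assumes "holo_on UNIV S f" "holo_on UNIV S g"
  shows "holo_on UNIV S (bracket b f g)"
  unfolding bracket_def
  by (intro holo_on_sum holo_on_mult S b holo_on_cpartial assms UNIV_I)

lemma bracket_skew:
  assumes z: "z \<in> S"
  shows "bracket b g f z = - bracket b f g z"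
proof -
  have "bracket b g f z = (\<Sum>i\<in>UNIV. \<Sum>j\<in>UNIV. b z j i * cpartial j g z * cpartial i f z)"
    unfolding bracket_def by (rule sum.swap)
  also have "\<dots> = (\<Sum>i\<in>UNIV. \<Sum>j\<in>UNIV. - (b z i j * cpartial i f z * cpartial j g z))"
    by (intro sum.cong refl) (subst skew[OF z], simp add: mult_ac)
  finally show ?thesis by (simp add: bracket_def sum_negf)
qed

lemma cpartial_bracket:
  assumes f: "holo_on UNIV S f" and g: "holo_on UNIV S g" and z: "z \<in> S"
  shows "cpartial l (bracket b f g) z = bracket_deriv (b z) (\<lambda>l i j. cpartial l (\<lambda>z. b z i j) z)
     (\<lambda>i. cpartial i f z) (\<lambda>l i. cpartial l (cpartial i f) z) (\<lambda>i. cpartial i g z) (\<lambda>l i. cpartial l (cpartial i g) z) l"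
proof -
  note h = b holo_on_cpartial[OF S f UNIV_I] holo_on_cpartial[OF S g UNIV_I]
  have 1: "holo_on UNIV S (\<lambda>z. b z i j * cpartial i f z)" for i j
    by (intro holo_on_mult S h)
  have 2: "holo_on UNIV S (\<lambda>z. b z i j * cpartial i f z * cpartial j g z)" for i j
    by (intro holo_on_mult S h)
  have 3: "holo_on UNIV S (\<lambda>z. \<Sum>j\<in>UNIV. b z i j * cpartial i f z * cpartial j g z)" for i
    by (intro holo_on_sum S 2)
  show ?thesis
    unfolding bracket_def bracket_deriv_def cpartial_sum[OF S 3 z UNIV_I] cpartial_sum[OF S 2 z UNIV_I]
      cpartial_mult[OF S 1 h(3) z UNIV_I] cpartial_mult[OF S h(1,2) z UNIV_I]
    by (intro sum.cong refl) (simp add: algebra_simps)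
qed

lemma bracket_jacobi:
  assumes schouten: "\<And>z i j m. z \<in> S \<Longrightarrow> (\<Sum>l\<in>UNIV. b z l i * cpartial l (\<lambda>z. b z j m) z +
      b z l j * cpartial l (\<lambda>z. b z m i) z + b z l m * cpartial l (\<lambda>z. b z i j) z) = 0"
    and f: "holo_on UNIV S f" and g: "holo_on UNIV S g" and h: "holo_on UNIV S h" and z: "z \<in> S"
  shows "bracket b f (bracket b g h) z + bracket b g (bracket b h f) z + bracket b h (bracket b f g) z = 0"
  unfolding bracket_def[of b f "bracket b g h"] bracket_def[of b g "bracket b h f"] bracket_def[of b h "bracket b f g"]
    cpartial_bracket[OF f g z] cpartial_bracket[OF g h z] cpartial_bracket[OF h f z]
  by (rule jacobi_algebraic[OF skew[OF z] schouten[OF z]])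
    (rule cpartial_commute[OF S f z UNIV_I UNIV_I] cpartial_commute[OF S g z UNIV_I UNIV_I] cpartial_commute[OF S h z UNIV_I UNIV_I])+

text \<open>The Leibniz rule for the Lie derivative of a contraction, where \<open>lie\<close> says
  in components that the Lie derivative of \<open>b\<close> is \<open>- b\<close>. The second
  derivatives of \<open>f\<close> and \<open>g\<close> occur alike on both sides; the derivatives of
  \<open>V\<close> are absorbed by \<open>lie\<close>.\<close>

lemma bracket_lie:
  fixes V :: "complex ^ 'n \<Rightarrow> complex ^ 'n"
  assumes V: "\<And>i. holo_on UNIV S (\<lambda>z. V z $ i)"
    and lie: "\<And>z i j. z \<in> S \<Longrightarrow> (\<Sum>l\<in>UNIV. V z $ l * cpartial l (\<lambda>z. b z i j) z
       - b z l j * cpartial l (\<lambda>z. V z $ i) z - b z i l * cpartial l (\<lambda>z. V z $ j) z) = - b z i j"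
    and f: "holo_on UNIV S f" and g: "holo_on UNIV S g" and z: "z \<in> S"
  defines "D \<equiv> \<lambda>f z. \<Sum>l\<in>UNIV. V z $ l * cpartial l f z"
  shows "D (bracket b f g) z = bracket b (D f) g z + bracket b f (D g) z - bracket b f g z"
proof -
  have cD: "cpartial i (D f) z = (\<Sum>l\<in>UNIV. V z $ l * cpartial i (cpartial l f) z + cpartial i (\<lambda>z. V z $ l) z * cpartial l f z)"
    if f: "holo_on UNIV S f" for i f
    unfolding D_def
    by (subst cpartial_sum[OF S _ z UNIV_I])
      (intro holo_on_mult S V holo_on_cpartial f UNIV_I,
       simp add: cpartial_mult[OF S V holo_on_cpartial[OF S f UNIV_I] z UNIV_I])
  let ?F = "\<lambda>i. cpartial i f z" and ?G = "\<lambda>i. cpartial i g z"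
  let ?b = "b z" and ?V = "\<lambda>l. V z $ l"
  let ?dV = "\<lambda>i l. cpartial i (\<lambda>z. V z $ l) z"
  let ?HF = "\<lambda>i l. cpartial i (cpartial l f) z" and ?HG = "\<lambda>i l. cpartial i (cpartial l g) z"
  have symF: "?HF i l = ?HF l i" for i l by (rule cpartial_commute[OF S f z UNIV_I UNIV_I])
  have symG: "?HG i l = ?HG l i" for i l by (rule cpartial_commute[OF S g z UNIV_I UNIV_I])
  have L1: "D (bracket b f g) z =
      (\<Sum>i\<in>UNIV. \<Sum>j\<in>UNIV. (\<Sum>l\<in>UNIV. ?V l * cpartial l (\<lambda>z. b z i j) z) * ?F i * ?G j) +
      (\<Sum>i\<in>UNIV. \<Sum>j\<in>UNIV. \<Sum>l\<in>UNIV. ?V l * ?b i j * ?HF l i * ?G j) +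
      (\<Sum>i\<in>UNIV. \<Sum>j\<in>UNIV. \<Sum>l\<in>UNIV. ?V l * ?b i j * ?F i * ?HG l j)"
  proof -
    have "D (bracket b f g) z = (\<Sum>l\<in>UNIV. \<Sum>i\<in>UNIV. \<Sum>j\<in>UNIV.
        ?V l * cpartial l (\<lambda>z. b z i j) z * ?F i * ?G j + ?V l * ?b i j * ?HF l i * ?G j + ?V l * ?b i j * ?F i * ?HG l j)"
      unfolding D_def cpartial_bracket[OF f g z] bracket_deriv_def sum_distrib_left
      by (intro sum.cong refl) (simp add: algebra_simps)
    also have "\<dots> = (\<Sum>i\<in>UNIV. \<Sum>j\<in>UNIV. \<Sum>l\<in>UNIV.
        ?V l * cpartial l (\<lambda>z. b z i j) z * ?F i * ?G j + ?V l * ?b i j * ?HF l i * ?G j + ?V l * ?b i j * ?F i * ?HG l j)"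
      by (subst sum.swap, rule sum.cong[OF refl], rule sum.swap)
    finally show ?thesis by (simp only: sum.distrib sum_distrib_right)
  qed
  have L2: "(\<Sum>i\<in>UNIV. \<Sum>j\<in>UNIV. (\<Sum>l\<in>UNIV. ?V l * cpartial l (\<lambda>z. b z i j) z) * ?F i * ?G j) =
      (\<Sum>i\<in>UNIV. \<Sum>j\<in>UNIV. \<Sum>l\<in>UNIV. ?b l j * ?dV l i * ?F i * ?G j) +
      (\<Sum>i\<in>UNIV. \<Sum>j\<in>UNIV. \<Sum>l\<in>UNIV. ?b i l * ?dV l j * ?F i * ?G j) - bracket b f g z"
  proof -
    have "(\<Sum>l\<in>UNIV. ?V l * cpartial l (\<lambda>z. b z i j) z) =
        (\<Sum>l\<in>UNIV. ?b l j * ?dV l i) + (\<Sum>l\<in>UNIV. ?b i l * ?dV l j) - ?b i j" for i j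
      using lie[OF z, of i j] by (simp add: sum_subtractf sum.distrib algebra_simps)
    then show ?thesis
      by (simp only: bracket_def sum.distrib sum_distrib_right distrib_right left_diff_distrib sum_subtractf)
  qed
  have R1: "bracket b (D f) g z = (\<Sum>i\<in>UNIV. \<Sum>j\<in>UNIV. \<Sum>l\<in>UNIV. ?V l * ?b i j * ?HF l i * ?G j) +
      (\<Sum>i\<in>UNIV. \<Sum>j\<in>UNIV. \<Sum>l\<in>UNIV. ?b l j * ?dV l i * ?F i * ?G j)"
  proof -
    have "bracket b (D f) g z = (\<Sum>i\<in>UNIV. \<Sum>j\<in>UNIV. \<Sum>l\<in>UNIV. ?V l * ?b i j * ?HF l i * ?G j + ?b i j * ?dV i l * ?F l * ?G j)"
      unfolding bracket_def cD[OF f] sum_distrib_left sum_distrib_right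
      by (intro sum.cong refl) (simp add: symF algebra_simps)
    also have "\<dots> = (\<Sum>i\<in>UNIV. \<Sum>j\<in>UNIV. \<Sum>l\<in>UNIV. ?V l * ?b i j * ?HF l i * ?G j) +
        (\<Sum>i\<in>UNIV. \<Sum>j\<in>UNIV. \<Sum>l\<in>UNIV. ?b i j * ?dV i l * ?F l * ?G j)"
      by (simp only: sum.distrib)
    also have "(\<Sum>i\<in>UNIV. \<Sum>j\<in>UNIV. \<Sum>l\<in>UNIV. ?b i j * ?dV i l * ?F l * ?G j) =
        (\<Sum>i\<in>UNIV. \<Sum>j\<in>UNIV. \<Sum>l\<in>UNIV. ?b l j * ?dV l i * ?F i * ?G j)"
      by (rule sum_swap13)
    finally show ?thesis .
  qed
  have R2: "bracket b f (D g) z = (\<Sum>i\<in>UNIV. \<Sum>j\<in>UNIV. \<Sum>l\<in>UNIV. ?V l * ?b i j * ?F i * ?HG l j) +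
      (\<Sum>i\<in>UNIV. \<Sum>j\<in>UNIV. \<Sum>l\<in>UNIV. ?b i l * ?dV l j * ?F i * ?G j)"
  proof -
    have "bracket b f (D g) z = (\<Sum>i\<in>UNIV. \<Sum>j\<in>UNIV. \<Sum>l\<in>UNIV. ?V l * ?b i j * ?F i * ?HG l j + ?b i j * ?dV j l * ?F i * ?G l)"
      unfolding bracket_def cD[OF g] sum_distrib_left sum_distrib_right
      by (intro sum.cong refl) (simp add: symG algebra_simps)
    also have "\<dots> = (\<Sum>i\<in>UNIV. \<Sum>j\<in>UNIV. \<Sum>l\<in>UNIV. ?V l * ?b i j * ?F i * ?HG l j) +
        (\<Sum>i\<in>UNIV. \<Sum>j\<in>UNIV. \<Sum>l\<in>UNIV. ?b i j * ?dV j l * ?F i * ?G l)"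
      by (simp only: sum.distrib)
    also have "(\<Sum>i\<in>UNIV. \<Sum>j\<in>UNIV. \<Sum>l\<in>UNIV. ?b i j * ?dV j l * ?F i * ?G l) =
        (\<Sum>i\<in>UNIV. \<Sum>j\<in>UNIV. \<Sum>l\<in>UNIV. ?b i l * ?dV l j * ?F i * ?G j)"
      by (rule sum.cong[OF refl], rule sum.swap)
    finally show ?thesis .
  qed
  show ?thesis unfolding L1 L2 R1 R2 by simp
qed

end

section \<open>Functions along the fibre and the slice w = 1\<close>

lemma shrink_1 [simp]: "shrink k 1 \<zeta> = \<zeta>"
  by (simp add: shrink_def)

lemma shrink_0_nth: "shrink k 0 \<zeta> $ i = (if i = k then 1 else \<zeta> $ i)"
  by (simp add: shrink_def axis_nth_eq)

lemma polydisc_nth_nonzero: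
  assumes "\<zeta> \<in> polydisc k r" "r \<le> 1"
  shows "\<zeta> $ k \<noteq> 0"
proof
  assume "\<zeta> $ k = 0"
  moreover have "norm (\<zeta> $ k - axis k 1 $ k) < r" using assms(1) unfolding polydisc_def by blast
  ultimately show False using assms(2) by simp
qed

text \<open>Only the segment from the slice w = 1 to the point has to lie in \<open>S\<close>, so
  this also applies to a box over an open part of the base.\<close>

lemma fibre_constant_within:
  assumes S: "rel_open UNIV S" and F: "holo_on UNIV S F" and d: "\<And>\<zeta>. \<zeta> \<in> S \<Longrightarrow> cpartial k F \<zeta> = 0"
    and z: "\<And>s. 0 \<le> s \<Longrightarrow> s \<le> 1 \<Longrightarrow> shrink k s \<zeta> \<in> S"
  shows "F \<zeta> = F (shrink k 0 \<zeta>)"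
proof -
  let ?I = "closed_segment 0 (\<zeta> $ k - 1)"
  have sh: "shrink k 0 \<zeta> + axis k (of_real s * (\<zeta> $ k - 1)) = shrink k s \<zeta>" for s
    by (simp add: shrink_def vec_eq_iff axis_nth_eq algebra_simps)
  have "\<exists>c. \<forall>w\<in>?I. F (shrink k 0 \<zeta> + axis k w) = c"
  proof (rule has_field_derivative_zero_constant[OF convex_closed_segment])
    fix w assume "w \<in> ?I"
    then obtain s where s: "0 \<le> s" "s \<le> 1" "w = of_real s * (\<zeta> $ k - 1)"
      by (auto simp: in_segment scaleR_conv_of_real)
    have inB: "shrink k 0 \<zeta> + axis k w \<in> S"
      unfolding s(3) sh by (rule z[OF s(1,2)])
    have "((\<lambda>w. F (shrink k 0 \<zeta> + axis k w)) has_field_derivative cpartial k F (shrink k 0 \<zeta> + axis k w)) (at w)"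
      by (rule axis_holo_line[OF _ inB UNIV_I]) (use F in \<open>simp only: holo_on_iff_axis_holo[OF S]\<close>)
    then show "((\<lambda>w. F (shrink k 0 \<zeta> + axis k w)) has_field_derivative 0) (at w within ?I)"
      unfolding d[OF inB] by (rule has_field_derivative_at_within)
  qed
  then have "F (shrink k 0 \<zeta> + axis k (\<zeta> $ k - 1)) = F (shrink k 0 \<zeta> + axis k 0)"
    by (metis ends_in_segment)
  then show ?thesis using sh[of 1] by simp
qed

lemma fibre_constant:
  assumes F: "holo_on UNIV (polydisc k r) F" and d: "\<And>\<zeta>. \<zeta> \<in> polydisc k r \<Longrightarrow> cpartial k F \<zeta> = 0"
    and z: "\<zeta> \<in> polydisc k r"
  shows "F \<zeta> = F (shrink k 0 \<zeta>)"
  by (rule fibre_constant_within[OF rel_open_polydisc F d shrink_in_polydisc[OF z]])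

lemma bracket_cong:
  assumes "rel_open UNIV T" "z \<in> T" "\<And>z. z \<in> T \<Longrightarrow> f z = f' z" "\<And>z. z \<in> T \<Longrightarrow> g z = g' z"
  shows "bracket b f g z = bracket b f' g' z"
  unfolding bracket_def
  by (simp only: cpartial_cong[OF assms(1,2) UNIV_I assms(3)] cpartial_cong[OF assms(1,2) UNIV_I assms(4)])

lemma bracket_zero: "bracket b (\<lambda>_. 0) g z = 0" "bracket b f (\<lambda>_. 0) z = 0"
  by (simp_all add: bracket_def)

definition drop_coord :: "'n::finite \<Rightarrow> complex ^ 'n \<Rightarrow> complex ^ 'n" where
  "drop_coord k \<zeta> = \<zeta> - axis k (\<zeta> $ k)"

lemma drop_coord_nth: "drop_coord k \<zeta> $ i = (if i = k then 0 else \<zeta> $ i)"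
  by (simp add: drop_coord_def axis_nth_eq)

lemma shrink_0_eq: "shrink k 0 \<zeta> = drop_coord k \<zeta> + axis k 1"
  by (simp add: vec_eq_iff shrink_0_nth drop_coord_nth axis_nth_eq)

text \<open>The slice w = 1 translated to w = 0, so that it lies in
  \<open>coord_space (UNIV - {k})\<close>, the model space for charts of the base.\<close>

definition base_polydisc :: "'n::finite \<Rightarrow> real \<Rightarrow> (complex ^ 'n) set" where
  "base_polydisc k r = {z \<in> coord_space (UNIV - {k}). z + axis k 1 \<in> polydisc k r}"

lemma rel_open_base_polydisc: "rel_open (UNIV - {k}) (base_polydisc k r)"
proof -
  have "open ((\<lambda>z. z + axis k 1) -` polydisc k r)"
    by (rule open_vimage[OF open_polydisc]) (intro continuous_intros)
  moreover have "base_polydisc k r = coord_space (UNIV - {k}) \<inter> ((\<lambda>z. z + axis k 1) -` polydisc k r)"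
    by (auto simp: base_polydisc_def)
  ultimately show ?thesis by (metis openin_open_Int)
qed

lemma drop_coord_base: "\<zeta> \<in> polydisc k r \<Longrightarrow> drop_coord k \<zeta> \<in> base_polydisc k r"
  using shrink_in_polydisc[of \<zeta> k r 0]
  by (simp add: base_polydisc_def shrink_0_eq coord_space_def drop_coord_nth)

text \<open>The homogeneity equation determines the dependence of the components on the fibre coordinate.\<close>

definition homog :: "'n::finite \<Rightarrow> (complex ^ 'n \<Rightarrow> 'n \<Rightarrow> 'n \<Rightarrow> complex) \<Rightarrow> complex ^ 'n \<Rightarrow> 'n \<Rightarrow> 'n \<Rightarrow> complex" where
  "homog k \<beta> \<zeta> i j = (if i = k \<or> j = k then 1 else 1 / \<zeta> $ k) * \<beta> (drop_coord k \<zeta>) i j"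

text \<open>The derivatives of \<open>homog k \<beta>\<close> at w = 1. In direction k they come
  from the homogeneity: -1 times the component for two base indices, 0 for one index k; with both
  indices k a skew component is zero anyway.\<close>

definition homog_deriv :: "'n::finite \<Rightarrow> (complex ^ 'n \<Rightarrow> 'n \<Rightarrow> 'n \<Rightarrow> complex) \<Rightarrow> complex ^ 'n \<Rightarrow> 'n \<Rightarrow> 'n \<Rightarrow> 'n \<Rightarrow> complex" where
  "homog_deriv k \<beta> z l i j = (if l = k then ((if i = k then 1 else 0) + (if j = k then 1 else 0) - 1) * \<beta> z i j
     else cpartial l (\<lambda>z. \<beta> z i j) z)"

section \<open>The components of the bivector in the flow box\<close>

locale flow_box_components =
  fixes S :: "(complex ^ 'n::finite) set" and k :: 'n and r and G g V :: "complex ^ 'n \<Rightarrow> complex ^ 'n"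
    and b :: "complex ^ 'n \<Rightarrow> 'n \<Rightarrow> 'n \<Rightarrow> complex"
  assumes r: "r \<le> 1"
    and GS: "G ` polydisc k r \<subseteq> S" and oG: "open (G ` polydisc k r)"
    and G: "\<And>i. holo_on UNIV (polydisc k r) (\<lambda>\<zeta>. G \<zeta> $ i)"
    and g: "\<And>i. holo_on UNIV (G ` polydisc k r) (\<lambda>z. g z $ i)"
    and gG: "\<And>\<zeta>. \<zeta> \<in> polydisc k r \<Longrightarrow> g (G \<zeta>) = \<zeta>"
    and GV: "\<And>\<zeta> i. \<zeta> \<in> polydisc k r \<Longrightarrow> \<zeta> $ k * cpartial k (\<lambda>\<zeta>. G \<zeta> $ i) \<zeta> = V (G \<zeta>) $ i"
    and V: "\<And>i. holo_on UNIV S (\<lambda>z. V z $ i)"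
    and b: "\<And>i j. holo_on UNIV S (\<lambda>z. b z i j)"
    and skew: "\<And>z i j. z \<in> S \<Longrightarrow> b z i j = - b z j i"
    and schouten: "\<And>z i j m. z \<in> S \<Longrightarrow> (\<Sum>l\<in>UNIV. b z l i * cpartial l (\<lambda>z. b z j m) z +
      b z l j * cpartial l (\<lambda>z. b z m i) z + b z l m * cpartial l (\<lambda>z. b z i j) z) = 0"
    and lie: "\<And>z i j. z \<in> S \<Longrightarrow> (\<Sum>l\<in>UNIV. V z $ l * cpartial l (\<lambda>z. b z i j) z
       - b z l j * cpartial l (\<lambda>z. V z $ i) z - b z i l * cpartial l (\<lambda>z. V z $ j) z) = - b z i j"
begin

context
begin

private abbreviation "B \<equiv> polydisc k r"
private abbreviation "T \<equiv> G ` polydisc k r"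
private abbreviation "u i \<equiv> \<lambda>z. g z $ i"

text \<open>The components in box coordinates, computed as brackets of the coordinate functions
  given by \<open>g\<close>. Working with brackets of functions replaces the transformation laws of
  the Schouten bracket and of the Lie derivative.\<close>

definition pushed :: "complex ^ 'n \<Rightarrow> 'n \<Rightarrow> 'n \<Rightarrow> complex" where
  "pushed \<zeta> i j = bracket b (u i) (u j) (G \<zeta>)"

private lemma rT: "rel_open UNIV T" using oG by simp
private lemma bT: "holo_on UNIV T (\<lambda>z. b z i j)" by (rule holo_on_subset[OF b GS])
private lemma VT: "holo_on UNIV T (\<lambda>z. V z $ i)" by (rule holo_on_subset[OF V GS])
private lemma skewT: "z \<in> T \<Longrightarrow> b z i j = - b z j i" using skew GS by blast
private lemma gT: "g ` T \<subseteq> B" "z \<in> T \<Longrightarrow> G (g z) = z" using gG by auto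

private lemma bracket_holo: "holo_on UNIV T (bracket b (u i) (u j))"
  by (rule holo_on_bracket[OF rT bT skewT g g])

lemma holo_on_pushed: "holo_on UNIV B (\<lambda>\<zeta>. pushed \<zeta> i j)"
  unfolding pushed_def
  by (rule holo_on_compose[OF rel_open_polydisc rT G subset_refl bracket_holo])

lemma pushed_skew: "\<zeta> \<in> B \<Longrightarrow> pushed \<zeta> i j = - pushed \<zeta> j i"
  unfolding pushed_def by (rule bracket_skew[OF rT bT skewT]) auto

private lemma euler_chain:
  assumes F: "holo_on UNIV T F" and z: "\<zeta> \<in> B"
  shows "\<zeta> $ k * cpartial k (\<lambda>\<zeta>. F (G \<zeta>)) \<zeta> = (\<Sum>l\<in>UNIV. V (G \<zeta>) $ l * cpartial l F (G \<zeta>))"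
  unfolding cpartial_compose[OF rel_open_polydisc rT G subset_refl F z UNIV_I] sum_distrib_left GV[OF z, symmetric]
  by (intro sum.cong refl) (simp only: mult_ac)

lemma euler_coord:
  assumes "z \<in> T"
  shows "(\<Sum>l\<in>UNIV. V z $ l * cpartial l (u i) z) = (if i = k then u k z else 0)"
proof -
  obtain \<zeta> where z: "\<zeta> \<in> B" "z = G \<zeta>" using assms by blast
  have "cpartial k (\<lambda>\<zeta>. u i (G \<zeta>)) \<zeta> = cpartial k (\<lambda>\<zeta>. \<zeta> $ i) \<zeta>"
    by (rule cpartial_cong[OF rel_open_polydisc z(1) UNIV_I]) (simp add: gG)
  then have "\<zeta> $ k * cpartial k (\<lambda>\<zeta>. u i (G \<zeta>)) \<zeta> = (if i = k then u k (G \<zeta>) else 0)"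
    by (simp add: cpartial_coord gG z(1))
  then show ?thesis unfolding euler_chain[OF g z(1)] z(2) .
qed

text \<open>Under the field, the coordinate \<open>u k\<close> has weight 1 and the others have
  weight 0; by \<open>bracket_lie\<close> a bracket has the sum of the weights minus 1.\<close>

lemma euler_pushed:
  assumes z: "\<zeta> \<in> B"
  shows "\<zeta> $ k * cpartial k (\<lambda>\<zeta>. pushed \<zeta> i j) \<zeta> =
    ((if i = k then 1 else 0) + (if j = k then 1 else 0) - 1) * pushed \<zeta> i j"
proof -
  let ?D = "\<lambda>f z. \<Sum>l\<in>UNIV. V z $ l * cpartial l f z"
  have Gz: "G \<zeta> \<in> T" using z by blast
  have "\<zeta> $ k * cpartial k (\<lambda>\<zeta>. pushed \<zeta> i j) \<zeta> = ?D (bracket b (u i) (u j)) (G \<zeta>)"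
    unfolding pushed_def by (rule euler_chain[OF bracket_holo z])
  also have "\<dots> = bracket b (?D (u i)) (u j) (G \<zeta>) + bracket b (u i) (?D (u j)) (G \<zeta>) - bracket b (u i) (u j) (G \<zeta>)"
    by (rule bracket_lie[OF rT bT skewT VT lie g g Gz]) (use GS in blast)+
  also have "bracket b (?D (u i)) (u j) (G \<zeta>) = (if i = k then bracket b (u i) (u j) (G \<zeta>) else 0)"
  proof -
    have "bracket b (?D (u i)) (u j) (G \<zeta>) = bracket b (\<lambda>z. if i = k then u k z else 0) (u j) (G \<zeta>)"
      by (rule bracket_cong[OF rT Gz euler_coord refl])
    then show ?thesis by (cases "i = k") (simp_all add: bracket_zero)
  qed
  also have "bracket b (u i) (?D (u j)) (G \<zeta>) = (if j = k then bracket b (u i) (u j) (G \<zeta>) else 0)"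
  proof -
    have "bracket b (u i) (?D (u j)) (G \<zeta>) = bracket b (u i) (\<lambda>z. if j = k then u k z else 0) (G \<zeta>)"
      by (rule bracket_cong[OF rT Gz refl euler_coord])
    then show ?thesis by (cases "j = k") (simp_all add: bracket_zero)
  qed
  finally show ?thesis by (simp add: pushed_def algebra_simps)
qed

private lemma bracket_coord_compose:
  assumes F: "holo_on UNIV B F" and z: "z \<in> T"
  shows "bracket b (u i) (\<lambda>z. F (g z)) z = (\<Sum>l\<in>UNIV. bracket b (u i) (u l) z * cpartial l F (g z))"
proof -
  have c: "cpartial m (\<lambda>z. F (g z)) z = (\<Sum>l\<in>UNIV. cpartial l F (g z) * cpartial m (u l) z)" for m
    by (rule cpartial_compose[OF rT rel_open_polydisc g gT(1) F z UNIV_I])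
  have "bracket b (u i) (\<lambda>z. F (g z)) z =
     (\<Sum>a\<in>UNIV. \<Sum>m\<in>UNIV. \<Sum>l\<in>UNIV. b z a m * cpartial a (u i) z * cpartial m (u l) z * cpartial l F (g z))"
    unfolding bracket_def c sum_distrib_left by (intro sum.cong refl) (simp only: mult_ac)
  also have "\<dots> = (\<Sum>l\<in>UNIV. \<Sum>a\<in>UNIV. \<Sum>m\<in>UNIV. b z a m * cpartial a (u i) z * cpartial m (u l) z * cpartial l F (g z))"
    by (rule sum_rotate3)
  finally show ?thesis by (simp only: bracket_def sum_distrib_right)
qed

text \<open>The Jacobi identity for three coordinate functions, with the outer bracket expanded by
  the chain rule.\<close>

lemma pushed_jacobi:
  assumes z: "\<zeta> \<in> B"
  shows "(\<Sum>l\<in>UNIV. pushed \<zeta> l i * cpartial l (\<lambda>\<zeta>. pushed \<zeta> j m) \<zeta> +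
     pushed \<zeta> l j * cpartial l (\<lambda>\<zeta>. pushed \<zeta> m i) \<zeta> + pushed \<zeta> l m * cpartial l (\<lambda>\<zeta>. pushed \<zeta> i j) \<zeta>) = 0"
proof -
  have Gz: "G \<zeta> \<in> T" using z by blast
  have *: "bracket b (u i) (bracket b (u j) (u m)) (G \<zeta>) = - (\<Sum>l\<in>UNIV. pushed \<zeta> l i * cpartial l (\<lambda>\<zeta>. pushed \<zeta> j m) \<zeta>)" for i j m
  proof -
    have "bracket b (u i) (bracket b (u j) (u m)) (G \<zeta>) = bracket b (u i) (\<lambda>z. pushed (g z) j m) (G \<zeta>)"
      by (rule bracket_cong[OF rT Gz refl]) (simp add: pushed_def gT(2))
    also have "\<dots> = (\<Sum>l\<in>UNIV. pushed \<zeta> i l * cpartial l (\<lambda>\<zeta>. pushed \<zeta> j m) \<zeta>)"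
      unfolding bracket_coord_compose[OF holo_on_pushed Gz] gG[OF z] by (simp only: pushed_def)
    also have "\<dots> = (\<Sum>l\<in>UNIV. - (pushed \<zeta> l i * cpartial l (\<lambda>\<zeta>. pushed \<zeta> j m) \<zeta>))"
      by (intro sum.cong refl) (subst pushed_skew[OF z], rule minus_mult_left[symmetric])
    finally show ?thesis by (simp only: sum_negf)
  qed
  have "bracket b (u i) (bracket b (u j) (u m)) (G \<zeta>) + bracket b (u j) (bracket b (u m) (u i)) (G \<zeta>) +
      bracket b (u m) (bracket b (u i) (u j)) (G \<zeta>) = 0"
    by (rule bracket_jacobi[OF rT bT skewT schouten g g g Gz]) (use GS in blast)+
  then show ?thesis unfolding * sum.distrib by (simp only: minus_add_distrib[symmetric] neg_equal_0_iff_equal)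
qed

definition reduced :: "complex ^ 'n \<Rightarrow> 'n \<Rightarrow> 'n \<Rightarrow> complex" where
  "reduced z i j = pushed (z + axis k 1) i j"

private lemma sum_axis: "z + axis k 1 + axis l w = z + axis l w + axis k (1 :: complex)" for z :: "complex ^ 'n" and l w
  by (simp add: add_ac)

lemma cpartial_reduced:
  assumes "l \<noteq> k"
  shows "cpartial l (\<lambda>z. reduced z i j) z = cpartial l (\<lambda>\<zeta>. pushed \<zeta> i j) (z + axis k 1)"
  by (simp add: cpartial_def reduced_def sum_axis)

lemma holo_on_reduced: "holo_on (UNIV - {k}) (base_polydisc k r) (\<lambda>z. reduced z i j)"
proof (rule holo_onI[OF rel_open_base_polydisc])
  show "continuous_on (base_polydisc k r) (\<lambda>z. reduced z i j)"
    unfolding reduced_def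
    by (rule continuous_on_compose2[OF holo_on_continuous[OF holo_on_pushed]])
      (auto simp: base_polydisc_def intro!: continuous_intros)
  fix z l assume z: "z \<in> base_polydisc k r" and l: "l \<in> UNIV - {k}"
  then have z': "z + axis k 1 \<in> B" by (simp add: base_polydisc_def)
  show "\<exists>D. ((\<lambda>w. reduced (z + axis l w) i j) has_field_derivative D) (at 0)"
    using holo_on_axis_derivative[OF holo_on_pushed rel_open_polydisc z' UNIV_I, of l i j]
    unfolding reduced_def sum_axis by (rule exI)
qed

lemma reduced_skew: "z \<in> base_polydisc k r \<Longrightarrow> reduced z i j = - reduced z j i"
  unfolding reduced_def by (rule pushed_skew) (simp add: base_polydisc_def)

text \<open>On the slice w = 1 the fibre derivative of the components is given by
  \<open>euler_pushed\<close>, and this is the value that \<open>homog_deriv\<close> assigns to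
  direction k.\<close>

lemma reduced_jacobi:
  assumes z: "z \<in> base_polydisc k r"
  shows "(\<Sum>l\<in>UNIV. reduced z l i * homog_deriv k reduced z l j m +
     reduced z l j * homog_deriv k reduced z l m i + reduced z l m * homog_deriv k reduced z l i j) = 0"
proof -
  have z': "z + axis k 1 \<in> B" and zk: "(z + axis k 1) $ k = 1"
    using z by (auto simp: base_polydisc_def coord_space_def axis_nth_eq)
  have "homog_deriv k reduced z l i j = cpartial l (\<lambda>\<zeta>. pushed \<zeta> i j) (z + axis k 1)" for l i j
    using euler_pushed[OF z', of i j] unfolding zk
    by (cases "l = k") (simp_all add: homog_deriv_def cpartial_reduced, simp add: reduced_def)
  then show ?thesis using pushed_jacobi[OF z'] by (simp add: reduced_def)
qed

text \<open>A component of weight 0 is constant along the fibre, one of weight -1 becomes constant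
  after multiplication by w. The component with both indices k would have weight 1, but it vanishes
  by skew-symmetry.\<close>

lemma pushed_eq_homog:
  assumes z: "\<zeta> \<in> B"
  shows "pushed \<zeta> i j = homog k reduced \<zeta> i j"
proof -
  note nz = polydisc_nth_nonzero[OF _ r]
  have red: "reduced (drop_coord k \<zeta>) i j = pushed (shrink k 0 \<zeta>) i j"
    by (simp add: reduced_def shrink_0_eq)
  consider "i = k" "j = k" | "(i = k) \<noteq> (j = k)" | "i \<noteq> k" "j \<noteq> k" by blast
  then show ?thesis
  proof cases
    case 1
    have "pushed \<xi> k k = 0" if "\<xi> \<in> B" for \<xi> using pushed_skew[OF that, of k k] by simp
    then show ?thesis using 1 red z shrink_in_polydisc[OF z, of 0] by (simp add: homog_def)
  next
    case 2
    have "pushed \<zeta> i j = pushed (shrink k 0 \<zeta>) i j"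
    proof (rule fibre_constant[OF holo_on_pushed _ z])
      show "cpartial k (\<lambda>\<zeta>. pushed \<zeta> i j) \<xi> = 0" if "\<xi> \<in> B" for \<xi>
        using euler_pushed[OF that, of i j] nz[OF that] 2 by auto
    qed
    then show ?thesis using 2 red by (auto simp: homog_def)
  next
    case 3
    have h: "holo_on UNIV B (\<lambda>\<zeta>. \<zeta> $ k)" by (rule holo_on_coord[OF rel_open_polydisc])
    have "\<zeta> $ k * pushed \<zeta> i j = shrink k 0 \<zeta> $ k * pushed (shrink k 0 \<zeta>) i j"
    proof (rule fibre_constant[OF _ _ z])
      show "holo_on UNIV B (\<lambda>\<zeta>. \<zeta> $ k * pushed \<zeta> i j)"
        by (intro holo_on_mult h holo_on_pushed rel_open_polydisc)
      show "cpartial k (\<lambda>\<zeta>. \<zeta> $ k * pushed \<zeta> i j) \<xi> = 0" if "\<xi> \<in> B" for \<xi>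
        using euler_pushed[OF that, of i j] 3
        by (simp add: cpartial_mult[OF rel_open_polydisc h holo_on_pushed that UNIV_I] cpartial_coord)
    qed
    then show ?thesis using 3 red nz[OF z] by (simp add: homog_def shrink_0_nth field_simps)
  qed
qed

end

end

section \<open>Jacobi brackets in a single chart\<close>

text \<open>The leaf space and the slit dual both arise with an atlas of one chart; the manifold
  notions then reduce to statements about \<open>Z\<close>.\<close>

locale single_chart =
  fixes I :: "'n::finite set" and M :: "'x set" and \<psi> :: "'x \<Rightarrow> complex ^ 'n" and Z :: "(complex ^ 'n) set"
  assumes Z: "rel_open I Z" and \<psi>: "bij_betw \<psi> M Z"
begin

lemma inj: "inj_on \<psi> M" and image: "\<psi> ` M = Z"
  using \<psi> by (auto simp: bij_betw_def)

lemma inv_chart [simp]: "p \<in> M \<Longrightarrow> inv_into M \<psi> (\<psi> p) = p"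
  by (rule inv_into_f_f[OF inj])

lemma chart_inv: "z \<in> Z \<Longrightarrow> inv_into M \<psi> z \<in> M" "z \<in> Z \<Longrightarrow> \<psi> (inv_into M \<psi> z) = z"
  using inv_into_into[of z \<psi> M] f_inv_into_f[of z \<psi> M] image by auto

lemma points_single [simp]: "points {(M, \<psi>)} = M"
  by (simp add: points_def)

lemma in_chart_single [simp]: "p \<in> M \<Longrightarrow> in_chart (M, \<psi>) f (\<psi> p) = f p"
  by (simp add: in_chart_def)

text \<open>With one chart the generating sets are already closed under finite intersections and
  arbitrary unions.\<close>

lemma openin_iff: "openin (atlas_topology {(M, \<psi>)}) W \<longleftrightarrow> (\<exists>S. open S \<and> W = {p \<in> M. \<psi> p \<in> S})"
proof -
  have gen: "generate_topology_on {{p \<in> M. \<psi> p \<in> S} |S. open S} W \<Longrightarrow> \<exists>S. open S \<and> W = {p \<in> M. \<psi> p \<in> S}"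
  proof (induction rule: generate_topology_on.induct)
    case Empty
    show ?case by (rule exI[of _ "{}"]) simp
  next
    case (Int a b)
    then obtain S T where "open S" "open T" "a = {p \<in> M. \<psi> p \<in> S}" "b = {p \<in> M. \<psi> p \<in> T}" by blast
    then show ?case by (intro exI[of _ "S \<inter> T"]) auto
  next
    case (UN \<K>)
    then have "\<forall>a\<in>\<K>. \<exists>S. open S \<and> a = {p \<in> M. \<psi> p \<in> S}" by blast
    from bchoice[OF this] obtain F where F: "\<forall>a\<in>\<K>. open (F a) \<and> a = {p \<in> M. \<psi> p \<in> F a}" by blast
    have "\<Union>\<K> = {p \<in> M. \<psi> p \<in> \<Union>(F ` \<K>)}" using F by auto
    moreover have "open (\<Union>(F ` \<K>))" using F by auto
    ultimately show ?case by blast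
  next
    case (Basis s)
    then show ?case by blast
  qed
  have eq: "{{p \<in> fst c. snd c p \<in> S} |c S. c \<in> {(M, \<psi>)} \<and> open S} = {{p \<in> M. \<psi> p \<in> S} |S. open S}"
    by auto
  show ?thesis
    unfolding atlas_topology_def openin_topology_generated_by_iff eq
    using gen by (auto intro: generate_topology_on.Basis)
qed

lemma topspace_single [simp]: "topspace (atlas_topology {(M, \<psi>)}) = M"
proof
  show "topspace (atlas_topology {(M, \<psi>)}) \<subseteq> M" unfolding topspace_def openin_iff by auto
  have "openin (atlas_topology {(M, \<psi>)}) M" unfolding openin_iff by (rule exI[of _ UNIV]) auto
  then show "M \<subseteq> topspace (atlas_topology {(M, \<psi>)})" by (rule openin_subset)
qed

lemma openin_image:
  assumes "openin (atlas_topology {(M, \<psi>)}) W"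
  shows "W \<subseteq> M" "rel_open I (\<psi> ` W)" "\<psi> ` W \<subseteq> Z"
proof -
  obtain S where S: "open S" "W = {p \<in> M. \<psi> p \<in> S}" using assms openin_iff by blast
  then have "\<psi> ` W = Z \<inter> S" using image by auto
  then show "rel_open I (\<psi> ` W)" using openin_Int_open[OF Z S(1)] by simp
  show "W \<subseteq> M" "\<psi> ` W \<subseteq> Z" using S(2) image by auto
qed

lemma openin_of_image:
  assumes "W \<subseteq> M" "rel_open I (\<psi> ` W)"
  shows "openin (atlas_topology {(M, \<psi>)}) W"
proof -
  obtain S where S: "open S" "\<psi> ` W = coord_space I \<inter> S"
    using assms(2) unfolding openin_open by blast
  have "Z \<subseteq> coord_space I" by (rule rel_open_subset[OF Z])
  then have "\<psi> p \<in> \<psi> ` W \<longleftrightarrow> \<psi> p \<in> S" if "p \<in> M" for p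
    unfolding S(2) using image that by blast
  then have "W = {p \<in> M. \<psi> p \<in> S}"
    using inj_on_image_mem_iff[OF inj _ assms(1)] assms(1) by blast
  then show ?thesis unfolding openin_iff using S(1) by blast
qed

lemma manifold: "complex_manifold I {(M, \<psi>)}"
proof -
  have "Hausdorff_space (atlas_topology {(M, \<psi>)})"
    unfolding Hausdorff_space_def topspace_single
  proof (intro allI impI)
    fix x y assume "x \<in> M \<and> y \<in> M \<and> x \<noteq> y"
    then have xy: "x \<in> M" "y \<in> M" "\<psi> x \<noteq> \<psi> y" using inj by (auto simp: inj_on_def)
    obtain S T where ST: "open S" "open T" "\<psi> x \<in> S" "\<psi> y \<in> T" "S \<inter> T = {}"
      using hausdorff[OF xy(3)] by blast
    show "\<exists>U V. openin (atlas_topology {(M, \<psi>)}) U \<and> openin (atlas_topology {(M, \<psi>)}) V \<and> x \<in> U \<and> y \<in> V \<and> disjnt U V"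
      unfolding openin_iff
      by (rule exI[of _ "{p \<in> M. \<psi> p \<in> S}"], rule exI[of _ "{p \<in> M. \<psi> p \<in> T}"])
        (use ST xy in \<open>auto simp: disjnt_def\<close>)
  qed
  moreover have "second_countable (atlas_topology {(M, \<psi>)})"
  proof -
    obtain \<B> :: "(complex ^ 'n) set set" where \<B>: "countable \<B>" "topological_basis \<B>"
      using ex_countable_basis by blast
    show ?thesis
      unfolding second_countable_def
    proof (intro exI conjI)
      show "countable ((\<lambda>S. {p \<in> M. \<psi> p \<in> S}) ` \<B>)" using \<B>(1) by simp
      show "\<forall>V\<in>(\<lambda>S. {p \<in> M. \<psi> p \<in> S}) ` \<B>. openin (atlas_topology {(M, \<psi>)}) V"
      proof
        fix V assume "V \<in> (\<lambda>S. {p \<in> M. \<psi> p \<in> S}) ` \<B>"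
        then obtain S where "S \<in> \<B>" "V = {p \<in> M. \<psi> p \<in> S}" by (rule imageE)
        then show "openin (atlas_topology {(M, \<psi>)}) V"
          unfolding openin_iff using topological_basis_open[OF \<B>(2)] by (intro exI[of _ S]) simp
      qed
      show "\<forall>U x. openin (atlas_topology {(M, \<psi>)}) U \<and> x \<in> U \<longrightarrow>
          (\<exists>V\<in>(\<lambda>S. {p \<in> M. \<psi> p \<in> S}) ` \<B>. x \<in> V \<and> V \<subseteq> U)"
      proof (intro allI impI)
        fix U x assume U: "openin (atlas_topology {(M, \<psi>)}) U \<and> x \<in> U"
        then obtain S where S: "open S" "U = {p \<in> M. \<psi> p \<in> S}" unfolding openin_iff by blast
        then have x: "x \<in> M" "\<psi> x \<in> S" using U by auto
        obtain B where B: "B \<in> \<B>" "\<psi> x \<in> B" "B \<subseteq> S"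
          by (rule topological_basisE[OF \<B>(2) S(1) x(2)])
        show "\<exists>V\<in>(\<lambda>S. {p \<in> M. \<psi> p \<in> S}) ` \<B>. x \<in> V \<and> V \<subseteq> U"
          by (rule bexI[OF _ imageI[OF B(1)]]) (use B x(1) S(2) in auto)
      qed
    qed
  qed
  moreover have "holo_on I Z (in_chart (M, \<psi>) (\<lambda>p. \<psi> p $ i))" for i
    using holo_on_coord[OF Z, of i] holo_on_cong[of Z "in_chart (M, \<psi>) (\<lambda>p. \<psi> p $ i)" "\<lambda>z. z $ i" I]
    by (simp add: in_chart_def chart_inv)
  ultimately show ?thesis
    unfolding complex_manifold_def using Z by (simp add: inj image)
qed

lemma continuous_map_single:
  assumes "\<And>x. x \<in> topspace T \<Longrightarrow> f x \<in> M" "continuous_map T euclidean (\<lambda>x. \<psi> (f x))"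
  shows "continuous_map T (atlas_topology {(M, \<psi>)}) f"
  unfolding continuous_map topspace_single
proof (intro conjI allI impI)
  show "f ` topspace T \<subseteq> M" using assms(1) by auto
  fix U assume "openin (atlas_topology {(M, \<psi>)}) U"
  then obtain S where S: "open S" "U = {p \<in> M. \<psi> p \<in> S}" unfolding openin_iff by blast
  have "openin T {x \<in> topspace T. \<psi> (f x) \<in> S}"
    by (rule openin_continuous_map_preimage[OF assms(2)]) (use S(1) in simp)
  moreover have "{x \<in> topspace T. f x \<in> U} = {x \<in> topspace T. \<psi> (f x) \<in> S}"
    using assms(1) S(2) by auto
  ultimately show "openin T {x \<in> topspace T. f x \<in> U}" by simp
qed

lemma jac_id:
  assumes "p \<in> M" "j \<in> I"
  shows "jac (\<lambda>q. q) (M, \<psi>) (M, \<psi>) p i j = (if j = i then 1 else 0)"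
proof -
  have "\<psi> p \<in> Z" using assms(1) image by auto
  then have "cpartial j (in_chart (M, \<psi>) (\<lambda>q. \<psi> q $ i)) (\<psi> p) = cpartial j (\<lambda>z. z $ i) (\<psi> p)"
    by (rule cpartial_cong[OF Z _ assms(2)]) (simp add: in_chart_def chart_inv)
  then show ?thesis by (simp add: jac_def cpartial_coord)
qed

lemma push_vec_id:
  assumes "p \<in> M" "v \<in> coord_space I"
  shows "push_vec I (\<lambda>q. q) (M, \<psi>) (M, \<psi>) p v = v"
proof -
  have "(\<Sum>j\<in>I. jac (\<lambda>q. q) (M, \<psi>) (M, \<psi>) p i j * v $ j) = v $ i" for i
  proof -
    have "(\<Sum>j\<in>I. jac (\<lambda>q. q) (M, \<psi>) (M, \<psi>) p i j * v $ j) = (\<Sum>j\<in>I. if j = i then v $ i else 0)"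
      by (rule sum.cong[OF refl]) (simp add: jac_id[OF assms(1)])
    then show ?thesis using assms(2) by (simp add: coord_space_def)
  qed
  then show ?thesis by (simp add: push_vec_def vec_eq_iff)
qed

lemma push_biv_id:
  assumes "p \<in> M" "\<And>i j. i \<notin> I \<or> j \<notin> I \<Longrightarrow> b $ i $ j = 0"
  shows "push_biv I (\<lambda>q. q) (M, \<psi>) (M, \<psi>) p b = b"
proof -
  have "(\<Sum>k\<in>I. \<Sum>l\<in>I. jac (\<lambda>q. q) (M, \<psi>) (M, \<psi>) p i k * jac (\<lambda>q. q) (M, \<psi>) (M, \<psi>) p j l * b $ k $ l) = b $ i $ j" for i j
  proof -
    have "(\<Sum>k\<in>I. \<Sum>l\<in>I. jac (\<lambda>q. q) (M, \<psi>) (M, \<psi>) p i k * jac (\<lambda>q. q) (M, \<psi>) (M, \<psi>) p j l * b $ k $ l) =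
        (\<Sum>k\<in>I. \<Sum>l\<in>I. if l = j then if k = i then b $ i $ j else 0 else 0)"
      by (intro sum.cong refl) (auto simp: jac_id[OF assms(1)])
    also have "\<dots> = (\<Sum>k\<in>I. if j \<in> I then if k = i then b $ i $ j else 0 else 0)" by simp
    also have "\<dots> = b $ i $ j" using assms(2)[of i j] by (cases "j \<in> I"; cases "i \<in> I") auto
    finally show ?thesis .
  qed
  then show ?thesis by (simp add: push_biv_def vec_eq_iff)
qed

end

text \<open>The derivatives of w f(z) at w = 1, so that direction k returns f itself. The Wirtinger
  derivative makes sense for smooth f and agrees with \<open>cpartial\<close> for holomorphic
  f.\<close>

definition ext_deriv :: "'n::finite \<Rightarrow> (complex ^ 'n \<Rightarrow> complex) \<Rightarrow> 'n \<Rightarrow> complex ^ 'n \<Rightarrow> complex" where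
  "ext_deriv k f i z = (if i = k then f z else wirtinger i f z)"

text \<open>For skew \<open>\<beta>\<close> this is the usual bivector and vector field of a Jacobi
  bracket in one matrix: the entries without index k form the bivector, the row k forms the vector
  field, which multiplies the other argument undifferentiated.\<close>

definition jacobi_bracket ::
  "'n::finite \<Rightarrow> (complex ^ 'n \<Rightarrow> 'n \<Rightarrow> 'n \<Rightarrow> complex) \<Rightarrow> (complex ^ 'n \<Rightarrow> complex) \<Rightarrow> (complex ^ 'n \<Rightarrow> complex) \<Rightarrow> complex ^ 'n \<Rightarrow> complex" where
  "jacobi_bracket k \<beta> f g z = (\<Sum>i\<in>UNIV. \<Sum>j\<in>UNIV. \<beta> z i j * ext_deriv k f i z * ext_deriv k g j z)"

context
  fixes k :: "'n::finite" and S :: "(complex ^ 'n) set" and \<beta> :: "complex ^ 'n \<Rightarrow> 'n \<Rightarrow> 'n \<Rightarrow> complex"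
  assumes S: "rel_open (UNIV - {k}) S"
    and \<beta>: "\<And>i j. holo_on (UNIV - {k}) S (\<lambda>z. \<beta> z i j)"
    and skew: "\<And>z i j. z \<in> S \<Longrightarrow> \<beta> z i j = - \<beta> z j i"
begin

private abbreviation "K \<equiv> UNIV - {k}"

lemma ext_deriv_cong:
  assumes "z \<in> S" "\<And>z. z \<in> S \<Longrightarrow> f z = g z"
  shows "ext_deriv k f i z = ext_deriv k g i z"
proof (cases "i = k")
  case True
  then show ?thesis using assms by (simp add: ext_deriv_def)
next
  case False
  then have "wirtinger i f z = wirtinger i g z" by (intro wirtinger_cong[OF S assms(1) _ assms(2)]) simp_all
  with False show ?thesis by (simp add: ext_deriv_def)
qed

lemma smooth_on_ext_deriv: "smooth_on K S f \<Longrightarrow> smooth_on K S (ext_deriv k f i)"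
  unfolding ext_deriv_def by (cases "i = k") (simp_all add: smooth_on_wirtinger[OF S])

lemma holo_on_ext_deriv:
  assumes "holo_on K S f"
  shows "holo_on K S (ext_deriv k f i)"
proof (cases "i = k")
  case True
  have "ext_deriv k f k = f" by (simp add: ext_deriv_def fun_eq_iff)
  with True show ?thesis using assms by simp
next
  case False
  then have "holo_on K S (ext_deriv k f i) \<longleftrightarrow> holo_on K S (cpartial i f)"
    by (intro holo_on_cong) (simp add: ext_deriv_def wirtinger_holo[OF S assms])
  then show ?thesis using holo_on_cpartial[OF S assms] False by simp
qed

lemma ext_deriv_add:
  "smooth_on K S f \<Longrightarrow> smooth_on K S g \<Longrightarrow> z \<in> S \<Longrightarrow>
   ext_deriv k (\<lambda>z. f z + g z) i z = ext_deriv k f i z + ext_deriv k g i z"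
  unfolding ext_deriv_def by (cases "i = k") (simp_all add: wirtinger_add[OF S])

lemma ext_deriv_mult:
  "smooth_on K S f \<Longrightarrow> smooth_on K S g \<Longrightarrow> z \<in> S \<Longrightarrow>
   ext_deriv k (\<lambda>z. f z * g z) i z = f z * ext_deriv k g i z + (if i = k then 0 else wirtinger i f z * g z)"
  unfolding ext_deriv_def by (cases "i = k") (simp_all add: wirtinger_mult[OF S])

lemma smooth_on_jacobi_bracket:
  "smooth_on K S f \<Longrightarrow> smooth_on K S g \<Longrightarrow> smooth_on K S (jacobi_bracket k \<beta> f g)"
  unfolding jacobi_bracket_def
  by (intro smooth_on_sum smooth_on_mult S holo_on_imp_smooth_on[OF S \<beta>] smooth_on_ext_deriv)

lemma holo_on_jacobi_bracket:
  "holo_on K S f \<Longrightarrow> holo_on K S g \<Longrightarrow> holo_on K S (jacobi_bracket k \<beta> f g)"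
  unfolding jacobi_bracket_def
  by (intro holo_on_sum holo_on_mult S \<beta> holo_on_ext_deriv)

lemma jacobi_bracket_cong:
  assumes "z \<in> S" "\<And>z. z \<in> S \<Longrightarrow> f z = f' z" "\<And>z. z \<in> S \<Longrightarrow> g z = g' z"
  shows "jacobi_bracket k \<beta> f g z = jacobi_bracket k \<beta> f' g' z"
  unfolding jacobi_bracket_def
  by (simp only: ext_deriv_cong[OF assms(1,2)] ext_deriv_cong[OF assms(1,3)])

lemma jacobi_bracket_skew:
  assumes z: "z \<in> S"
  shows "jacobi_bracket k \<beta> g f z = - jacobi_bracket k \<beta> f g z"
proof -
  have "jacobi_bracket k \<beta> g f z = (\<Sum>i\<in>UNIV. \<Sum>j\<in>UNIV. \<beta> z j i * ext_deriv k g j z * ext_deriv k f i z)"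
    unfolding jacobi_bracket_def by (rule sum.swap)
  also have "\<dots> = (\<Sum>i\<in>UNIV. \<Sum>j\<in>UNIV. - (\<beta> z i j * ext_deriv k f i z * ext_deriv k g j z))"
    by (intro sum.cong refl) (subst skew[OF z], simp add: mult_ac)
  finally show ?thesis by (simp add: jacobi_bracket_def sum_negf)
qed

lemma jacobi_bracket_add:
  assumes "smooth_on K S f" "smooth_on K S g" "z \<in> S"
  shows "jacobi_bracket k \<beta> (\<lambda>z. f z + g z) h z = jacobi_bracket k \<beta> f h z + jacobi_bracket k \<beta> g h z"
    "jacobi_bracket k \<beta> h (\<lambda>z. f z + g z) z = jacobi_bracket k \<beta> h f z + jacobi_bracket k \<beta> h g z"
  unfolding jacobi_bracket_def ext_deriv_add[OF assms]
  by (simp_all only: distrib_left distrib_right sum.distrib)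

text \<open>The entry k is multiplicative in its argument, so the factor \<open>f\<close> is
  differentiated in base directions only; these terms form the symbol.\<close>

lemma jacobi_bracket_mult:
  assumes "smooth_on K S f" "smooth_on K S g" "z \<in> S"
  shows "jacobi_bracket k \<beta> h (\<lambda>z. f z * g z) z = f z * jacobi_bracket k \<beta> h g z +
     (\<Sum>j\<in>K. (\<Sum>i\<in>UNIV. \<beta> z i j * ext_deriv k h i z) * wirtinger j f z) * g z"
proof -
  have "jacobi_bracket k \<beta> h (\<lambda>z. f z * g z) z = (\<Sum>i\<in>UNIV. \<Sum>j\<in>UNIV. f z * (\<beta> z i j * ext_deriv k h i z * ext_deriv k g j z) +
      (if j = k then 0 else \<beta> z i j * ext_deriv k h i z * wirtinger j f z * g z))"
    unfolding jacobi_bracket_def ext_deriv_mult[OF assms] by (intro sum.cong refl) (simp add: algebra_simps)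
  also have "\<dots> = f z * jacobi_bracket k \<beta> h g z + (\<Sum>i\<in>UNIV. \<Sum>j\<in>UNIV. if j = k then 0 else \<beta> z i j * ext_deriv k h i z * wirtinger j f z * g z)"
    by (simp only: sum.distrib jacobi_bracket_def sum_distrib_left)
  also have "(\<Sum>i\<in>UNIV. \<Sum>j\<in>UNIV. if j = k then 0 else \<beta> z i j * ext_deriv k h i z * wirtinger j f z * g z) =
      (\<Sum>i\<in>UNIV. \<Sum>j\<in>K. \<beta> z i j * ext_deriv k h i z * wirtinger j f z * g z)"
    by (rule sum.cong[OF refl], rule sum.mono_neutral_cong_right) auto
  also have "\<dots> = (\<Sum>j\<in>K. (\<Sum>i\<in>UNIV. \<beta> z i j * ext_deriv k h i z) * wirtinger j f z) * g z"
    by (subst sum.swap) (simp only: sum_distrib_right)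
  finally show ?thesis .
qed

text \<open>Second derivatives of w f(z) at w = 1: linearity in w makes the entry with both indices
  k zero, and turns a mixed entry into a first derivative.\<close>

private definition hess :: "(complex ^ 'n \<Rightarrow> complex) \<Rightarrow> complex ^ 'n \<Rightarrow> 'n \<Rightarrow> 'n \<Rightarrow> complex" where
  "hess f z l i = (if l = k then if i = k then 0 else ext_deriv k f i z else wirtinger l (ext_deriv k f i) z)"

private lemma hess_sym:
  assumes f: "smooth_on K S f" and z: "z \<in> S"
  shows "hess f z l i = hess f z i l"
proof -
  have [simp]: "ext_deriv k f k = f" "\<And>i. i \<noteq> k \<Longrightarrow> ext_deriv k f i = wirtinger i f"
    by (auto simp: ext_deriv_def)
  show ?thesis
    using wirtinger_commute[OF S f z, of l i] by (cases "l = k"; cases "i = k") (simp_all add: hess_def)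
qed

text \<open>The delicate direction is k, where the left side is the bracket itself. An index
  different from k contributes 1 through its Hessian, an index k contributes 1 through
  \<open>homog_deriv\<close>, and the -1 of \<open>homog_deriv\<close> leaves every term with total
  factor 1.\<close>

private lemma ext_deriv_jacobi_bracket:
  assumes f: "smooth_on K S f" and g: "smooth_on K S g" and z: "z \<in> S"
  shows "ext_deriv k (jacobi_bracket k \<beta> f g) l z =
    bracket_deriv (\<beta> z) (homog_deriv k \<beta> z) (\<lambda>i. ext_deriv k f i z) (hess f z) (\<lambda>i. ext_deriv k g i z) (hess g z) l"
proof (cases "l = k")
  case True
  have e: "ext_deriv k (jacobi_bracket k \<beta> f g) k z = jacobi_bracket k \<beta> f g z" by (simp add: ext_deriv_def)
  show ?thesis
    unfolding True bracket_deriv_def e unfolding jacobi_bracket_def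
  proof (intro sum.cong refl)
    fix i j
    show "\<beta> z i j * ext_deriv k f i z * ext_deriv k g j z =
       homog_deriv k \<beta> z k i j * ext_deriv k f i z * ext_deriv k g j z +
       \<beta> z i j * hess f z k i * ext_deriv k g j z + \<beta> z i j * ext_deriv k f i z * hess g z k j"
      by (cases "i = k"; cases "j = k") (simp_all add: hess_def homog_deriv_def)
  qed
next
  case False
  then have l: "l \<in> K" by simp
  note s = holo_on_imp_smooth_on[OF S \<beta>] smooth_on_ext_deriv[OF f] smooth_on_ext_deriv[OF g]
  have 1: "smooth_on K S (\<lambda>z. \<beta> z i j * ext_deriv k f i z)" for i j by (intro smooth_on_mult S s)
  have 2: "smooth_on K S (\<lambda>z. \<beta> z i j * ext_deriv k f i z * ext_deriv k g j z)" for i j by (intro smooth_on_mult S s)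
  have 3: "smooth_on K S (\<lambda>z. \<Sum>j\<in>UNIV. \<beta> z i j * ext_deriv k f i z * ext_deriv k g j z)" for i by (intro smooth_on_sum S 2)
  have "ext_deriv k (jacobi_bracket k \<beta> f g) l z = wirtinger l (jacobi_bracket k \<beta> f g) z"
    using False by (simp add: ext_deriv_def)
  also have "\<dots> = (\<Sum>i\<in>UNIV. \<Sum>j\<in>UNIV. \<beta> z i j * ext_deriv k f i z * wirtinger l (ext_deriv k g j) z +
      (\<beta> z i j * wirtinger l (ext_deriv k f i) z + wirtinger l (\<lambda>z. \<beta> z i j) z * ext_deriv k f i z) * ext_deriv k g j z)"
    unfolding jacobi_bracket_def wirtinger_sum[OF S 3 z l] wirtinger_sum[OF S 2 z l]
      wirtinger_mult[OF S 1 s(3) z l] wirtinger_mult[OF S s(1,2) z l] ..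
  also have "\<dots> = bracket_deriv (\<beta> z) (homog_deriv k \<beta> z) (\<lambda>i. ext_deriv k f i z) (hess f z) (\<lambda>i. ext_deriv k g i z) (hess g z) l"
    unfolding bracket_deriv_def using False
    by (intro sum.cong refl) (simp add: hess_def homog_deriv_def wirtinger_holo[OF S \<beta> z l] algebra_simps)
  finally show ?thesis .
qed

lemma jacobi_bracket_jacobi:
  assumes jac: "\<And>z i j m. z \<in> S \<Longrightarrow> (\<Sum>l\<in>UNIV. \<beta> z l i * homog_deriv k \<beta> z l j m +
     \<beta> z l j * homog_deriv k \<beta> z l m i + \<beta> z l m * homog_deriv k \<beta> z l i j) = 0"
    and f: "smooth_on K S f" and g: "smooth_on K S g" and h: "smooth_on K S h" and z: "z \<in> S"
  shows "jacobi_bracket k \<beta> f (jacobi_bracket k \<beta> g h) z + jacobi_bracket k \<beta> g (jacobi_bracket k \<beta> h f) z +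
    jacobi_bracket k \<beta> h (jacobi_bracket k \<beta> f g) z = 0"
  unfolding jacobi_bracket_def[of k \<beta> f "jacobi_bracket k \<beta> g h"] jacobi_bracket_def[of k \<beta> g "jacobi_bracket k \<beta> h f"]
    jacobi_bracket_def[of k \<beta> h "jacobi_bracket k \<beta> f g"]
    ext_deriv_jacobi_bracket[OF f g z] ext_deriv_jacobi_bracket[OF g h z] ext_deriv_jacobi_bracket[OF h f z]
  by (rule jacobi_algebraic[OF skew[OF z] jac[OF z]])
    (rule hess_sym[OF f z] hess_sym[OF g z] hess_sym[OF h z])+

end

text \<open>The fibrewise linear function of the section with coefficient f. For holomorphic f it
  has weight 1 under the Euler field.\<close>

definition lift_fun :: "'n::finite \<Rightarrow> (complex ^ 'n \<Rightarrow> complex) \<Rightarrow> complex ^ 'n \<Rightarrow> complex" where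
  "lift_fun k f \<zeta> = \<zeta> $ k * f (drop_coord k \<zeta>)"

text \<open>The coordinate image of the part of the slit dual that lies over
  \<open>S\<close>.\<close>

definition cylinder :: "'n::finite \<Rightarrow> (complex ^ 'n) set \<Rightarrow> (complex ^ 'n) set" where
  "cylinder k S = {\<zeta>. \<zeta> $ k \<noteq> 0 \<and> drop_coord k \<zeta> \<in> S}"

lemma drop_coord_axis: "drop_coord k (\<zeta> + axis i w) = (if i = k then drop_coord k \<zeta> else drop_coord k \<zeta> + axis i w)"
  by (auto simp: vec_eq_iff drop_coord_nth axis_nth_eq)

lemma drop_coord_in_coord_space: "drop_coord k \<zeta> \<in> coord_space (UNIV - {k})"
  by (simp add: coord_space_def drop_coord_nth)

lemma continuous_on_drop_coord: "continuous_on A (drop_coord k)"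
  unfolding drop_coord_def by (intro continuous_intros)

lemma open_drop_coord_vimage:
  assumes "rel_open (UNIV - {k}) S"
  shows "open (drop_coord k -` S)"
proof -
  obtain T where T: "open T" "S = coord_space (UNIV - {k}) \<inter> T" using assms unfolding openin_open by blast
  have "drop_coord k -` S = drop_coord k -` T"
    unfolding T(2) using drop_coord_in_coord_space by blast
  then show ?thesis using open_vimage[OF T(1) continuous_on_drop_coord] by simp
qed

lemma rel_open_cylinder:
  assumes "rel_open (UNIV - {k}) S"
  shows "rel_open UNIV (cylinder k S)"
proof -
  have "open {\<zeta> :: complex ^ 'a. \<zeta> $ k \<noteq> 0}"
    by (intro open_Collect_neq continuous_intros)
  moreover have "cylinder k S = {\<zeta>. \<zeta> $ k \<noteq> 0} \<inter> (drop_coord k -` S)"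
    by (auto simp: cylinder_def)
  ultimately show ?thesis using open_drop_coord_vimage[OF assms] by (simp add: open_Int)
qed

lemma holo_on_drop_coord:
  assumes "rel_open UNIV T" "rel_open (UNIV - {k}) S" "drop_coord k ` T \<subseteq> S" "holo_on (UNIV - {k}) S f"
  shows "holo_on UNIV T (\<lambda>\<zeta>. f (drop_coord k \<zeta>))"
proof (rule holo_on_compose[OF assms(1,2) _ assms(3,4)])
  fix j show "holo_on UNIV T (\<lambda>\<zeta>. drop_coord k \<zeta> $ j)"
    unfolding drop_coord_nth by (cases "j = k") (simp_all add: holo_on_const holo_on_coord[OF assms(1)])
qed

lemma holo_on_lift_fun:
  assumes "rel_open UNIV T" "rel_open (UNIV - {k}) S" "drop_coord k ` T \<subseteq> S" "holo_on (UNIV - {k}) S f"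
  shows "holo_on UNIV T (lift_fun k f)"
  unfolding lift_fun_def
  by (intro holo_on_mult holo_on_coord holo_on_drop_coord[OF assms] assms(1))

lemma cpartial_lift_fun:
  assumes S: "rel_open (UNIV - {k}) S" and f: "holo_on (UNIV - {k}) S f" and z: "drop_coord k \<zeta> \<in> S"
  shows "cpartial i (lift_fun k f) \<zeta> = (if i = k then 1 else \<zeta> $ k) * ext_deriv k f i (drop_coord k \<zeta>)"
proof (cases "i = k")
  case True
  have "((\<lambda>w. (\<zeta> + axis k w) $ k * f (drop_coord k \<zeta>)) has_field_derivative 1 * f (drop_coord k \<zeta>)) (at 0)"
    using DERIV_cmult_right[OF axis_derivative_coord[of \<zeta> k k 0]] by simp
  then have "((\<lambda>w. lift_fun k f (\<zeta> + axis k w)) has_field_derivative f (drop_coord k \<zeta>)) (at 0)"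
    by (simp add: lift_fun_def drop_coord_axis)
  then show ?thesis using True by (simp add: has_field_derivative_cpartial ext_deriv_def)
next
  case False
  have "((\<lambda>w. f (drop_coord k \<zeta> + axis i w)) has_field_derivative cpartial i f (drop_coord k \<zeta>)) (at 0)"
    by (rule holo_on_axis_derivative[OF f S z]) (use False in simp)
  from DERIV_cmult[OF this, of "\<zeta> $ k"]
  have "((\<lambda>w. lift_fun k f (\<zeta> + axis i w)) has_field_derivative \<zeta> $ k * cpartial i f (drop_coord k \<zeta>)) (at 0)"
    using False by (simp add: lift_fun_def drop_coord_axis axis_nth_eq)
  then show ?thesis using False
    by (simp add: has_field_derivative_cpartial ext_deriv_def wirtinger_holo[OF S f z])
qed

text \<open>Counting powers of w: each index different from k brings a factor w from the derivative,
  and \<open>homog\<close> removes one factor if both are different from k, which leaves a single w.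
  For both indices k the entry is zero.\<close>

lemma bracket_lift_fun:
  assumes S: "rel_open (UNIV - {k}) S" and f: "holo_on (UNIV - {k}) S f" and g: "holo_on (UNIV - {k}) S g"
    and z: "drop_coord k \<zeta> \<in> S" "\<zeta> $ k \<noteq> 0" and skew: "\<And>i j. \<beta> (drop_coord k \<zeta>) i j = - \<beta> (drop_coord k \<zeta>) j i"
  shows "bracket (homog k \<beta>) (lift_fun k f) (lift_fun k g) \<zeta> = lift_fun k (jacobi_bracket k \<beta> f g) \<zeta>"
proof -
  have kk: "\<beta> (drop_coord k \<zeta>) k k = 0" using skew[of k k] by simp
  show ?thesis
    unfolding bracket_def lift_fun_def[of k "jacobi_bracket k \<beta> f g"] jacobi_bracket_def sum_distrib_left
      cpartial_lift_fun[OF S f z(1)] cpartial_lift_fun[OF S g z(1)]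
  proof (intro sum.cong refl)
    fix i j
    show "homog k \<beta> \<zeta> i j * ((if i = k then 1 else \<zeta> $ k) * ext_deriv k f i (drop_coord k \<zeta>)) *
        ((if j = k then 1 else \<zeta> $ k) * ext_deriv k g j (drop_coord k \<zeta>)) =
      \<zeta> $ k * (\<beta> (drop_coord k \<zeta>) i j * ext_deriv k f i (drop_coord k \<zeta>) * ext_deriv k g j (drop_coord k \<zeta>))"
      using z(2) kk by (cases "i = k"; cases "j = k") (simp_all add: homog_def)
  qed
qed

section \<open>The Jacobi manifold on a trivial line bundle\<close>

locale jacobi_model = single_chart "UNIV - {k}" M \<psi> Z
  for k :: "'n::finite" and M :: "'x set" and \<psi> and Z +
  fixes \<beta> :: "complex ^ 'n \<Rightarrow> 'n \<Rightarrow> 'n \<Rightarrow> complex"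
  assumes \<beta>: "\<And>i j. holo_on (UNIV - {k}) Z (\<lambda>z. \<beta> z i j)"
    and skew: "\<And>z i j. z \<in> Z \<Longrightarrow> \<beta> z i j = - \<beta> z j i"
    and jac: "\<And>z i j m. z \<in> Z \<Longrightarrow> (\<Sum>l\<in>UNIV. \<beta> z l i * homog_deriv k \<beta> z l j m +
     \<beta> z l j * homog_deriv k \<beta> z l m i + \<beta> z l m * homog_deriv k \<beta> z l i j) = 0"
begin

abbreviation "K \<equiv> UNIV - {k}"
abbreviation "X \<equiv> {(M, \<psi>)}"

definition L :: "('x, 'x \<times> complex) line_bundle" where
  "L = \<lparr>total = M \<times> UNIV, proj = fst, fadd = (\<lambda>u v. (fst u, snd u + snd v)),
        fscale = (\<lambda>a u. (fst u, a * snd u)), triv = {(M, snd)}\<rparr>"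

lemma L_simps [simp]: "total L = M \<times> UNIV" "proj L = fst" "fadd L u v = (fst u, snd u + snd v)"
  "fscale L a u = (fst u, a * snd u)" "triv L = {(M, snd)}"
  by (simp_all add: L_def)

lemma fibre_L: "x \<in> M \<Longrightarrow> fibre L x = {x} \<times> UNIV"
  by (auto simp: fibre_def)

lemma frame_L:
  assumes "x \<in> M"
  shows "frame L snd x = (x, 1)"
proof -
  have "inj_on snd (fibre L x)" by (auto simp: fibre_L[OF assms] inj_on_def)
  moreover have "(x, 1) \<in> fibre L x" by (simp add: fibre_L[OF assms])
  ultimately show ?thesis unfolding frame_def using inv_into_f_f[of snd "fibre L x" "(x, 1)"] by simp
qed

lemma line_bundle: "holo_line_bundle K X L"
proof -
  have "bij_betw snd (fibre L x) UNIV" if "x \<in> M" for x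
    unfolding fibre_L[OF that] by (auto simp: bij_betw_def inj_on_def image_iff)
  moreover have "fibre_linear L x snd" for x by (simp add: fibre_linear_def)
  moreover have "holo_fun K X M (\<lambda>x. snd (frame L snd x))"
  proof -
    have "holo_on K Z (in_chart (M, \<psi>) (\<lambda>x. snd (frame L snd x))) \<longleftrightarrow> holo_on K Z (\<lambda>z. 1)"
      by (rule holo_on_cong) (simp add: in_chart_def chart_inv frame_L)
    then show ?thesis by (simp add: holo_fun_def image holo_on_const)
  qed
  moreover have "openin (atlas_topology X) M" using openin_topspace[of "atlas_topology X"] by simp
  ultimately show ?thesis
    by (auto simp: holo_line_bundle_def fibre_L image_iff)
qed

definition loc :: "('x \<Rightarrow> 'x \<times> complex) \<Rightarrow> complex ^ 'n \<Rightarrow> complex" where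
  "loc s = in_chart (M, \<psi>) (\<lambda>x. snd (s x))"

lemma loc_chart [simp]: "x \<in> M \<Longrightarrow> loc s (\<psi> x) = snd (s x)"
  by (simp add: loc_def)

lemma smooth_sections_iff:
  assumes "W \<subseteq> M"
  shows "s \<in> smooth_sections K X L W \<longleftrightarrow>
    s \<in> extensional W \<and> (\<forall>x\<in>W. fst (s x) = x) \<and> smooth_on K (\<psi> ` W) (loc s)"
proof -
  have "M \<inter> W = W" using assms by blast
  then show ?thesis
    using assms by (auto simp: smooth_sections_def smooth_fun_def loc_def PiE_def Pi_iff fibre_L subset_iff mem_Times_iff)
qed

lemma holo_sections_iff:
  assumes "W \<subseteq> M"
  shows "s \<in> holo_sections K X L W \<longleftrightarrow>
    s \<in> extensional W \<and> (\<forall>x\<in>W. fst (s x) = x) \<and> holo_on K (\<psi> ` W) (loc s)"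
proof -
  have "M \<inter> W = W" using assms by blast
  then show ?thesis
    using assms by (auto simp: holo_sections_def holo_fun_def loc_def PiE_def Pi_iff fibre_L subset_iff mem_Times_iff)
qed

lemma section_eqI:
  assumes "s \<in> extensional W" "t \<in> extensional W" "\<And>x. x \<in> W \<Longrightarrow> fst (s x) = fst (t x)" "\<And>x. x \<in> W \<Longrightarrow> snd (s x) = snd (t x)"
  shows "s = t"
  by (rule extensionalityI[OF assms(1,2)]) (rule prod_eqI[OF assms(3,4)])

definition J :: "('x, 'x \<times> complex) bracket" where
  "J W s t = (\<lambda>x\<in>W. (x, jacobi_bracket k \<beta> (loc s) (loc t) (\<psi> x)))"

context
  fixes W assumes W: "openin (atlas_topology X) W"
begin

private lemma WM: "W \<subseteq> M" and rW: "rel_open K (\<psi> ` W)" and WZ: "\<psi> ` W \<subseteq> Z"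
  using openin_image[OF W] by auto

private lemma \<beta>W: "holo_on K (\<psi> ` W) (\<lambda>z. \<beta> z i j)" by (rule holo_on_subset[OF \<beta> WZ])
private lemma skewW: "z \<in> \<psi> ` W \<Longrightarrow> \<beta> z i j = - \<beta> z j i" using skew WZ by blast
private lemma WinM: "x \<in> W \<Longrightarrow> x \<in> M" using WM by blast

private abbreviation "jb \<equiv> jacobi_bracket k \<beta>"
private abbreviation "\<Gamma> \<equiv> smooth_sections K X L W"
private abbreviation "\<O> \<equiv> holo_sections K X L W"

lemma loc_J: "z \<in> \<psi> ` W \<Longrightarrow> loc (J W s t) z = jb (loc s) (loc t) z"
  by (auto simp: J_def WinM)

lemma loc_add: "z \<in> \<psi> ` W \<Longrightarrow> loc (sec_add L W s t) z = loc s z + loc t z"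
  by (auto simp: sec_add_def WinM)

lemma loc_scale: "z \<in> \<psi> ` W \<Longrightarrow> loc (sec_scale L W f s) z = in_chart (M, \<psi>) f z * loc s z"
  by (auto simp: sec_scale_def WinM)

private lemma sm: "s \<in> \<Gamma> \<Longrightarrow> smooth_on K (\<psi> ` W) (loc s)"
  "s \<in> \<Gamma> \<Longrightarrow> x \<in> W \<Longrightarrow> fst (s x) = x" "s \<in> \<Gamma> \<Longrightarrow> s \<in> extensional W"
  using smooth_sections_iff[OF WM] by auto

lemma J_smooth:
  assumes "s \<in> \<Gamma>" "t \<in> \<Gamma>"
  shows "J W s t \<in> \<Gamma>"
proof -
  have "smooth_on K (\<psi> ` W) (loc (J W s t)) \<longleftrightarrow> smooth_on K (\<psi> ` W) (jb (loc s) (loc t))"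
    by (rule smooth_on_cong[OF rW loc_J])
  then have "smooth_on K (\<psi> ` W) (loc (J W s t))"
    using smooth_on_jacobi_bracket[where S = "\<psi> ` W" and k = k and \<beta> = \<beta>, OF rW \<beta>W skewW sm(1)[OF assms(1)] sm(1)[OF assms(2)]] by simp
  then show ?thesis by (simp add: smooth_sections_iff[OF WM] J_def)
qed

lemma J_holo:
  assumes "s \<in> \<O>" "t \<in> \<O>"
  shows "J W s t \<in> \<O>"
proof -
  have "holo_on K (\<psi> ` W) (loc (J W s t)) \<longleftrightarrow> holo_on K (\<psi> ` W) (jb (loc s) (loc t))"
    by (rule holo_on_cong[OF loc_J])
  moreover have "holo_on K (\<psi> ` W) (jb (loc s) (loc t))"
    by (rule holo_on_jacobi_bracket[where S = "\<psi> ` W" and k = k and \<beta> = \<beta>, OF rW \<beta>W skewW]) (use assms in \<open>simp_all add: holo_sections_iff[OF WM]\<close>)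
  ultimately show ?thesis by (simp add: holo_sections_iff[OF WM] J_def)
qed

lemma J_restrict:
  assumes W': "openin (atlas_topology X) W'" "W' \<subseteq> W"
  shows "J W' (restrict s W') (restrict t W') = restrict (J W s t) W'"
proof (rule section_eqI)
  have r': "rel_open K (\<psi> ` W')" by (rule openin_image[OF W'(1)])
  fix x assume x: "x \<in> W'"
  \<comment> \<open>Restriction alters \<open>loc\<close> only outside the image of
    \<open>W'\<close>, which is relatively open, so the bracket inside does not notice it.\<close>
  have l: "loc (restrict s W') z = loc s z" if "z \<in> \<psi> ` W'" for s z
    using that W'(2) WinM by auto
  have "jb (loc (restrict s W')) (loc (restrict t W')) (\<psi> x) = jb (loc s) (loc t) (\<psi> x)"
    by (rule jacobi_bracket_cong[OF r' _ _ _ l l])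
      (use W'(2) x in \<open>auto intro: skewW holo_on_subset[OF \<beta>W]\<close>)
  then show "snd (J W' (restrict s W') (restrict t W') x) = snd (restrict (J W s t) W' x)"
    using x W'(2) by (auto simp: J_def)
  show "fst (J W' (restrict s W') (restrict t W') x) = fst (restrict (J W s t) W' x)"
    using x W'(2) by (auto simp: J_def)
qed (auto simp: J_def extensional_def)

lemma J_skew: "J W s t = sec_scale L W (\<lambda>_. - 1) (J W t s)"
  by (rule section_eqI)
    (auto simp: J_def sec_scale_def intro!: jacobi_bracket_skew[where S = "\<psi> ` W" and k = k and \<beta> = \<beta>, OF rW \<beta>W skewW])

lemma J_add:
  assumes "s \<in> \<Gamma>" "t \<in> \<Gamma>"
  shows "J W (sec_add L W s t) u = sec_add L W (J W s u) (J W t u)"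
    "J W u (sec_add L W s t) = sec_add L W (J W u s) (J W u t)"
proof -
  have a: "jb (\<lambda>z. loc s z + loc t z) h z = jb (loc s) h z + jb (loc t) h z"
    "jb h (\<lambda>z. loc s z + loc t z) z = jb h (loc s) z + jb h (loc t) z" if "z \<in> \<psi> ` W" for z h
    by (rule jacobi_bracket_add[OF rW \<beta>W skewW sm(1)[OF assms(1)] sm(1)[OF assms(2)] that]; assumption)+
  have c: "jb f g z = jb f' g' z" if "z \<in> \<psi> ` W" "\<And>z. z \<in> \<psi> ` W \<Longrightarrow> f z = f' z" "\<And>z. z \<in> \<psi> ` W \<Longrightarrow> g z = g' z" for f g f' g' z
    by (rule jacobi_bracket_cong[OF rW \<beta>W skewW that])
  show "J W (sec_add L W s t) u = sec_add L W (J W s u) (J W t u)"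
  proof (rule section_eqI)
    fix x assume x: "x \<in> W"
    then have z: "\<psi> x \<in> \<psi> ` W" by blast
    have "jb (loc (sec_add L W s t)) (loc u) (\<psi> x) = jb (\<lambda>z. loc s z + loc t z) (loc u) (\<psi> x)"
      by (rule c[OF z loc_add refl])
    with x show "snd (J W (sec_add L W s t) u x) = snd (sec_add L W (J W s u) (J W t u) x)"
      unfolding a(1)[OF z] by (simp add: J_def sec_add_def[of L W "restrict _ _"])
  qed (simp_all add: J_def sec_add_def)
  show "J W u (sec_add L W s t) = sec_add L W (J W u s) (J W u t)"
  proof (rule section_eqI)
    fix x assume x: "x \<in> W"
    then have z: "\<psi> x \<in> \<psi> ` W" by blast
    have "jb (loc u) (loc (sec_add L W s t)) (\<psi> x) = jb (loc u) (\<lambda>z. loc s z + loc t z) (\<psi> x)"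
      by (rule c[OF z refl loc_add])
    with x show "snd (J W u (sec_add L W s t) x) = snd (sec_add L W (J W u s) (J W u t) x)"
      unfolding a(2)[OF z] by (simp add: J_def sec_add_def[of L W "restrict _ _"])
  qed (simp_all add: J_def sec_add_def)
qed

text \<open>The symbol of \<open>J W s\<close>. The component k is cut off, since that entry of the
  bracket multiplies and does not differentiate.\<close>

definition ham :: "('x \<Rightarrow> 'x \<times> complex) \<Rightarrow> ('x, 'n) vfield" where
  "ham s c x = (\<chi> j. if j = k then 0 else \<Sum>i\<in>UNIV. \<beta> (\<psi> x) i j * ext_deriv k (loc s) i (\<psi> x))"

lemma J_mult:
  assumes "t \<in> \<Gamma>" "smooth_fun K X W f" "x \<in> W"
  shows "J W s (sec_scale L W f t) x =
     fadd L (fscale L (vf_smooth K (ham s) (M, \<psi>) f x) (t x)) (fscale L (f x) (J W s t x))"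
proof -
  have f: "smooth_on K (\<psi> ` W) (in_chart (M, \<psi>) f)"
    using assms(2) WM by (simp add: smooth_fun_def Int_absorb1)
  have x: "\<psi> x \<in> \<psi> ` W" using assms(3) by blast
  have "jb (loc s) (loc (sec_scale L W f t)) (\<psi> x) = jb (loc s) (\<lambda>z. in_chart (M, \<psi>) f z * loc t z) (\<psi> x)"
    by (rule jacobi_bracket_cong[where S = "\<psi> ` W" and k = k and \<beta> = \<beta>, OF rW \<beta>W skewW x refl loc_scale])
  also have "\<dots> = in_chart (M, \<psi>) f (\<psi> x) * jb (loc s) (loc t) (\<psi> x) +
     (\<Sum>j\<in>K. (\<Sum>i\<in>UNIV. \<beta> (\<psi> x) i j * ext_deriv k (loc s) i (\<psi> x)) * wirtinger j (in_chart (M, \<psi>) f) (\<psi> x)) * loc t (\<psi> x)"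
    by (rule jacobi_bracket_mult[where S = "\<psi> ` W" and k = k and \<beta> = \<beta>, OF rW \<beta>W skewW f sm(1)[OF assms(1)] x])
  also have "(\<Sum>j\<in>K. (\<Sum>i\<in>UNIV. \<beta> (\<psi> x) i j * ext_deriv k (loc s) i (\<psi> x)) * wirtinger j (in_chart (M, \<psi>) f) (\<psi> x))
     = vf_smooth K (ham s) (M, \<psi>) f x"
    unfolding vf_smooth_def ham_def by (intro sum.cong refl) simp
  finally show ?thesis
    using assms(3) sm(2)[OF assms(1,3)] by (simp add: J_def WinM)
qed

lemma J_cmult:
  assumes "t \<in> \<Gamma>"
  shows "J W s (sec_scale L W (\<lambda>_. a) t) = sec_scale L W (\<lambda>_. a) (J W s t)"
proof (rule section_eqI)
  fix x assume x: "x \<in> W"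
  have const: "in_chart (M, \<psi>) (\<lambda>_. a) = (\<lambda>_. a)" by (simp add: in_chart_def fun_eq_iff)
  then have "smooth_fun K X W (\<lambda>_. a)" using WM by (simp add: smooth_fun_def Int_absorb1 smooth_on_const[OF rW])
  moreover have "vf_smooth K (ham s) (M, \<psi>) (\<lambda>_. a) x = 0"
    by (simp add: vf_smooth_def const wirtinger_const[OF rW])
  ultimately show "snd (J W s (sec_scale L W (\<lambda>_. a) t) x) = snd (sec_scale L W (\<lambda>_. a) (J W s t) x)"
    using J_mult[OF assms _ x] x by (simp add: sec_scale_def[of L W _ "J W s t"])
qed (auto simp: J_def sec_scale_def)

lemma ham_smooth:
  assumes s: "s \<in> \<Gamma>"
  shows "smooth_vector_field K X W (ham s)"
proof -
  have c: "ham s c p \<in> coord_space K" for c p by (simp add: ham_def coord_space_def)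
  have "smooth_on K (\<psi> ` W) (in_chart (M, \<psi>) (\<lambda>p. ham s (M, \<psi>) p $ j))" if "j \<in> K" for j
  proof -
    have "smooth_on K (\<psi> ` W) (in_chart (M, \<psi>) (\<lambda>p. ham s (M, \<psi>) p $ j)) \<longleftrightarrow>
        smooth_on K (\<psi> ` W) (\<lambda>z. \<Sum>i\<in>UNIV. \<beta> z i j * ext_deriv k (loc s) i z)"
      by (rule smooth_on_cong[OF rW]) (use that in \<open>auto simp: ham_def WinM\<close>)
    moreover have "smooth_on K (\<psi> ` W) (\<lambda>z. \<Sum>i\<in>UNIV. \<beta> z i j * ext_deriv k (loc s) i z)"
      by (intro smooth_on_sum smooth_on_mult rW holo_on_imp_smooth_on[OF rW \<beta>W] smooth_on_ext_deriv[where S = "\<psi> ` W" and k = k and \<beta> = \<beta>, OF rW \<beta>W skewW sm(1)[OF s]])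
    ultimately show ?thesis by simp
  qed
  moreover have "ham s d p = push_vec K (\<lambda>p. p) (M, \<psi>) (M, \<psi>) p (ham s c p)" if "p \<in> M" for c d p
    unfolding push_vec_id[OF that c] by (simp add: ham_def)
  ultimately show ?thesis
    using WM by (auto simp: smooth_vector_field_def vector_field_def vf_related_def c Int_absorb1)
qed

lemma J_jacobi:
  assumes "s \<in> \<Gamma>" "t \<in> \<Gamma>" "u \<in> \<Gamma>"
  shows "sec_add L W (sec_add L W (J W s (J W t u)) (J W t (J W u s))) (J W u (J W s t)) = sec_scale L W (\<lambda>_. 0) s"
proof (rule section_eqI)
  fix x assume x: "x \<in> W"
  then have z: "\<psi> x \<in> \<psi> ` W" by blast
  have "snd (J W s (J W t u) x) = jb (loc s) (jb (loc t) (loc u)) (\<psi> x)" for s t u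
  proof -
    have "jb (loc s) (loc (J W t u)) (\<psi> x) = jb (loc s) (jb (loc t) (loc u)) (\<psi> x)"
      by (rule jacobi_bracket_cong[where S = "\<psi> ` W" and k = k and \<beta> = \<beta>, OF rW \<beta>W skewW z refl loc_J])
    then show ?thesis using x by (simp add: J_def[of W s])
  qed
  then have "snd (J W s (J W t u) x) + snd (J W t (J W u s) x) + snd (J W u (J W s t) x) = 0"
    using jacobi_bracket_jacobi[where S = "\<psi> ` W" and k = k and \<beta> = \<beta>, OF rW \<beta>W skewW jac[OF subsetD[OF WZ]]
        sm(1)[OF assms(1)] sm(1)[OF assms(2)] sm(1)[OF assms(3)] z]
    by simp
  then show "snd (sec_add L W (sec_add L W (J W s (J W t u)) (J W t (J W u s))) (J W u (J W s t)) x) = snd (sec_scale L W (\<lambda>_. 0) s x)"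
    using x by (simp add: sec_add_def sec_scale_def)
  show "fst (sec_add L W (sec_add L W (J W s (J W t u)) (J W t (J W u s))) (J W u (J W s t)) x) = fst (sec_scale L W (\<lambda>_. 0) s x)"
    using x sm(2)[OF assms(1) x] by (simp add: sec_add_def sec_scale_def J_def)
qed (simp_all add: sec_add_def sec_scale_def)

end

lemma biderivation: "holo_jacobi_biderivation K X L J"
  unfolding holo_jacobi_biderivation_def Let_def
proof (intro allI impI conjI ballI)
  fix W assume W: "openin (atlas_topology X) W"
  fix s assume s: "s \<in> smooth_sections K X L W"
  show "\<exists>v. smooth_vector_field K X W v \<and> has_symbol K X L W (J W s) v"
    using ham_smooth[OF W s] J_mult[OF W] by (intro exI[of _ "ham s"]) (simp add: has_symbol_def)
  fix t assume t: "t \<in> smooth_sections K X L W"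
  show "J W s t \<in> smooth_sections K X L W" by (rule J_smooth[OF W s t])
  show "J W s t = sec_scale L W (\<lambda>_. - 1) (J W t s)" by (rule J_skew[OF W])
  show cm: "J W s (sec_scale L W (\<lambda>_. a) t) = sec_scale L W (\<lambda>_. a) (J W s t)" for a
    by (rule J_cmult[OF W t])
  show "J W (sec_scale L W (\<lambda>_. a) s) t = sec_scale L W (\<lambda>_. a) (J W s t)" for a
  proof -
    have "J W (sec_scale L W (\<lambda>_. a) s) t = sec_scale L W (\<lambda>_. - 1) (J W t (sec_scale L W (\<lambda>_. a) s))"
      by (rule J_skew[OF W])
    also have "\<dots> = sec_scale L W (\<lambda>_. - 1) (sec_scale L W (\<lambda>_. a) (J W t s))"
      by (simp only: J_cmult[OF W s])
    also have "\<dots> = sec_scale L W (\<lambda>_. a) (sec_scale L W (\<lambda>_. - 1) (J W t s))"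
      by (auto simp: sec_scale_def)
    finally show ?thesis by (simp only: J_skew[OF W, of s t])
  qed
  fix u assume u: "u \<in> smooth_sections K X L W"
  show "J W (sec_add L W s t) u = sec_add L W (J W s u) (J W t u)"
    "J W u (sec_add L W s t) = sec_add L W (J W u s) (J W u t)"
    by (rule J_add[OF W s t])+
  show "sec_add L W (sec_add L W (J W s (J W t u)) (J W t (J W u s))) (J W u (J W s t)) = sec_scale L W (\<lambda>_. 0) s"
    by (rule J_jacobi[OF W s t u])
next
  fix W W' s t assume W: "openin (atlas_topology X) W" and "openin (atlas_topology X) W' \<and> W' \<subseteq> W"
  then show "J W' (restrict s W') (restrict t W') = restrict (J W s t) W'"
    by (intro J_restrict[OF W]) auto
next
  fix W s t assume "openin (atlas_topology X) W" "s \<in> holo_sections K X L W" "t \<in> holo_sections K X L W"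
  then show "J W s t \<in> holo_sections K X L W" by (rule J_holo)
qed

lemma jacobi_manifold: "holo_jacobi_manifold K X L J"
  by (simp add: holo_jacobi_manifold_def manifold line_bundle biderivation)

end

section \<open>The slit dual and its Poisson structure\<close>

context jacobi_model
begin

abbreviation "D \<equiv> slit_dual X L"

definition dual_chart :: "'x \<times> ('x \<times> complex \<Rightarrow> complex) \<Rightarrow> complex ^ 'n" where
  "dual_chart = snd (slit_dual_chart k X L (M, \<psi>) (M, snd))"

definition dual_point :: "'x \<Rightarrow> complex \<Rightarrow> 'x \<times> ('x \<times> complex \<Rightarrow> complex)" where
  "dual_point x w = (x, \<lambda>v\<in>{x} \<times> UNIV. snd v * w)"

lemma slit_dual_iff:
  "(x, \<xi>) \<in> D \<longleftrightarrow> x \<in> M \<and> \<xi> \<in> extensional ({x} \<times> UNIV) \<and> (\<forall>a. \<xi> (x, a) = a * \<xi> (x, 1)) \<and> \<xi> (x, 1) \<noteq> 0"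
proof (cases "x \<in> M")
  case True
  have 1: "fibre_linear L x \<xi> \<longleftrightarrow> (\<forall>a. \<xi> (x, a) = a * \<xi> (x, 1))"
  proof
    assume "fibre_linear L x \<xi>"
    then have *: "\<xi> (x, a * b) = a * \<xi> (x, b)" for a b
      by (simp add: fibre_linear_def fibre_L[OF True])
    show "\<forall>a. \<xi> (x, a) = a * \<xi> (x, 1)"
    proof
      fix a show "\<xi> (x, a) = a * \<xi> (x, 1)" using *[of a 1] by simp
    qed
  next
    assume *: "\<forall>a. \<xi> (x, a) = a * \<xi> (x, 1)"
    have "\<xi> (x, a + b) = \<xi> (x, a) + \<xi> (x, b)" "\<xi> (x, a * b) = a * \<xi> (x, b)" for a b
      using *[rule_format, of "a + b"] *[rule_format, of "a * b"] *[rule_format, of a] *[rule_format, of b]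
      by (simp_all add: distrib_right)
    then show "fibre_linear L x \<xi>" by (auto simp: fibre_linear_def fibre_L[OF True])
  qed
  have 2: "(\<exists>v\<in>{x} \<times> UNIV. \<xi> v \<noteq> 0) \<longleftrightarrow> \<xi> (x, 1) \<noteq> 0" if "\<forall>a. \<xi> (x, a) = a * \<xi> (x, 1)"
  proof
    assume "\<exists>v\<in>{x} \<times> UNIV. \<xi> v \<noteq> 0"
    then obtain a where "\<xi> (x, a) \<noteq> 0" by auto
    then show "\<xi> (x, 1) \<noteq> 0" using that[rule_format, of a] by auto
  next
    assume "\<xi> (x, 1) \<noteq> 0"
    then show "\<exists>v\<in>{x} \<times> UNIV. \<xi> v \<noteq> 0" by (intro bexI[of _ "(x, 1)"]) auto
  qed
  have "(x, \<xi>) \<in> D \<longleftrightarrow> \<xi> \<in> extensional (fibre L x) \<and> fibre_linear L x \<xi> \<and> (\<exists>v\<in>fibre L x. \<xi> v \<noteq> 0)"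
    using True by (simp add: slit_dual_def)
  then show ?thesis unfolding fibre_L[OF True] 1 using True 2 by blast
qed (simp add: slit_dual_def)

lemma slit_dualD:
  assumes "(x, \<xi>) \<in> D"
  shows "x \<in> M" "\<xi> \<in> extensional ({x} \<times> UNIV)" "\<xi> (x, 1) \<noteq> 0"
  using assms unfolding slit_dual_iff by blast+

lemma dual_atlas: "slit_dual_atlas k X L = {(D, dual_chart)}"
proof -
  have "{P \<in> D. fst P \<in> M} = D" by (auto simp: slit_dual_def)
  then show ?thesis by (simp add: slit_dual_atlas_def slit_dual_chart_def dual_chart_def)
qed

lemma chart_k: "x \<in> M \<Longrightarrow> \<psi> x $ k = 0"
  using rel_open_subset[OF Z] image by (auto simp: coord_space_def)

lemma dual_chart_eq: "x \<in> M \<Longrightarrow> dual_chart (x, \<xi>) = \<psi> x + axis k (\<xi> (x, 1))"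
  by (auto simp: dual_chart_def slit_dual_chart_def frame_L vec_eq_iff axis_nth_eq chart_k)

lemma drop_dual_chart:
  assumes "Q \<in> D"
  shows "drop_coord k (dual_chart Q) = \<psi> (fst Q)"
proof -
  obtain x \<xi> where Q: "Q = (x, \<xi>)" by (cases Q)
  have x: "x \<in> M" using assms Q slit_dualD by simp
  show ?thesis unfolding Q dual_chart_eq[OF x]
    using chart_k[OF x] by (simp add: vec_eq_iff drop_coord_nth axis_nth_eq)
qed

lemma dual_chart_k:
  assumes "Q \<in> D"
  shows "dual_chart Q $ k = snd Q (fst Q, 1)"
proof -
  obtain x \<xi> where Q: "Q = (x, \<xi>)" by (cases Q)
  have x: "x \<in> M" using assms Q slit_dualD by simp
  show ?thesis unfolding Q dual_chart_eq[OF x] using chart_k[OF x] by (simp add: axis_nth_eq)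
qed

lemma dual_point_in: "x \<in> M \<Longrightarrow> w \<noteq> 0 \<Longrightarrow> dual_point x w \<in> D"
  by (simp add: dual_point_def slit_dual_iff)

lemma dual_chart_point: "x \<in> M \<Longrightarrow> dual_chart (dual_point x w) = \<psi> x + axis k w"
  by (simp add: dual_point_def dual_chart_eq)

text \<open>A functional on a fibre is determined by its value on the frame, which becomes the fibre
  coordinate; the slit condition is that this value is nonzero.\<close>

lemma bij_dual_chart: "bij_betw dual_chart D (cylinder k Z)"
proof (rule bij_betw_imageI)
  show "inj_on dual_chart D"
  proof (rule inj_onI)
    fix P Q assume P: "P \<in> D" and Q: "Q \<in> D" and e: "dual_chart P = dual_chart Q"
    obtain x \<xi> y \<eta> where PQ: "P = (x, \<xi>)" "Q = (y, \<eta>)" by (cases P, cases Q)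
    have xy: "x \<in> M" "y \<in> M" using P Q PQ slit_dualD(1) by auto
    have "\<psi> x = \<psi> y" using drop_dual_chart[OF P] drop_dual_chart[OF Q] e PQ by simp
    then have x: "x = y" using inj xy by (auto dest: inj_onD)
    have 1: "\<xi> (x, 1) = \<eta> (x, 1)" using dual_chart_k[OF P] dual_chart_k[OF Q] e PQ x by simp
    have 2: "\<forall>a. \<xi> (x, a) = a * \<xi> (x, 1)" "\<forall>a. \<eta> (x, a) = a * \<eta> (x, 1)"
      using P Q unfolding PQ x slit_dual_iff by blast+
    have "\<xi> (x, a) = \<eta> (x, a)" for a using 2[THEN spec, of a] 1 by simp
    then have "\<xi> = \<eta>"
      using slit_dualD(2)[of x \<xi>] slit_dualD(2)[of x \<eta>] P Q PQ x by (intro extensionalityI[of \<xi> "{x} \<times> UNIV" \<eta>]) auto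
    then show "P = Q" using PQ x by simp
  qed
  show "dual_chart ` D = cylinder k Z"
  proof
    show "dual_chart ` D \<subseteq> cylinder k Z"
    proof clarify
      fix x \<xi> assume P: "(x, \<xi>) \<in> D"
      then have "x \<in> M" "\<xi> (x, 1) \<noteq> 0" by (rule slit_dualD)+
      then show "dual_chart (x, \<xi>) \<in> cylinder k Z"
        using drop_dual_chart[OF P] dual_chart_k[OF P] image by (auto simp: cylinder_def)
    qed
    show "cylinder k Z \<subseteq> dual_chart ` D"
    proof
      fix \<zeta> assume "\<zeta> \<in> cylinder k Z"
      then have z: "\<zeta> $ k \<noteq> 0" "drop_coord k \<zeta> \<in> Z" by (auto simp: cylinder_def)
      have "dual_chart (dual_point (inv_into M \<psi> (drop_coord k \<zeta>)) (\<zeta> $ k)) = \<zeta>"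
        unfolding dual_chart_point[OF chart_inv(1)[OF z(2)]] chart_inv(2)[OF z(2)] by (simp add: drop_coord_def)
      from this[symmetric] show "\<zeta> \<in> dual_chart ` D"
        by (rule image_eqI) (rule dual_point_in[OF chart_inv(1)[OF z(2)] z(1)])
    qed
  qed
qed

sublocale dual: single_chart UNIV D dual_chart "cylinder k Z"
  using rel_open_cylinder[OF Z] bij_dual_chart by unfold_locales

lemma lin_fun_eq:
  assumes "Q \<in> D" "fst (s (fst Q)) = fst Q"
  shows "lin_fun s Q = lift_fun k (loc s) (dual_chart Q)"
proof -
  obtain x \<xi> where Q: "Q = (x, \<xi>)" by (cases Q)
  have x: "x \<in> M" "\<xi> (x, a) = a * \<xi> (x, 1)" for a using assms(1) unfolding Q slit_dual_iff by blast+
  have e: "s x = (x, snd (s x))" using assms(2) by (simp add: prod_eq_iff Q)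
  have "lin_fun s Q = \<xi> (s x)" by (simp add: lin_fun_def Q)
  also have "\<dots> = \<xi> (x, snd (s x))" by (subst e) (rule refl)
  also have "\<dots> = snd (s x) * \<xi> (x, 1)" by (rule x(2))
  finally have "lin_fun s Q = snd (s x) * \<xi> (x, 1)" .
  then show ?thesis
    using dual_chart_k[OF assms(1)] drop_dual_chart[OF assms(1)] x(1) Q by (simp add: lift_fun_def)
qed

text \<open>The same formula as for the components in the flow box, so comparing the two bivectors
  becomes comparing coordinates. The chart argument is ignored because the atlas has only one
  chart.\<close>

definition dual_bivector :: "('x \<times> ('x \<times> complex \<Rightarrow> complex), 'n) bfield" where
  "dual_bivector c Q = (\<chi> i j. homog k \<beta> (dual_chart Q) i j)"

lemma bf_pair_bracket:
  "bf_pair UNIV b c f g p = bracket (\<lambda>_ i j. b c p $ i $ j) (in_chart c f) (in_chart c g) (snd c p)"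
  by (simp add: bf_pair_def bracket_def)

lemma homog_skew: "\<zeta> \<in> cylinder k Z \<Longrightarrow> homog k \<beta> \<zeta> i j = - homog k \<beta> \<zeta> j i"
  using skew[of "drop_coord k \<zeta>" i j] by (auto simp: homog_def cylinder_def)

lemma holo_on_homog: "holo_on UNIV (cylinder k Z) (\<lambda>\<zeta>. homog k \<beta> \<zeta> i j)"
proof -
  have h: "holo_on UNIV (cylinder k Z) (\<lambda>\<zeta>. \<beta> (drop_coord k \<zeta>) i j)"
    by (rule holo_on_drop_coord[OF dual.Z Z _ \<beta>]) (auto simp: cylinder_def)
  have "holo_on UNIV (cylinder k Z) (\<lambda>\<zeta>. 1 / \<zeta> $ k)"
    by (rule holo_on_divide[OF dual.Z holo_on_const holo_on_coord[OF dual.Z]]) (simp add: cylinder_def)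
  then have "holo_on UNIV (cylinder k Z) (\<lambda>\<zeta>. if i = k \<or> j = k then 1 else 1 / \<zeta> $ k)"
    by (cases "i = k \<or> j = k") (simp_all add: holo_on_const)
  then show ?thesis unfolding homog_def by (rule holo_on_mult[OF dual.Z _ h])
qed

lemma poissonization: "is_poissonization K k X L J dual_bivector (euler_field k)"
  unfolding is_poissonization_def
proof (intro conjI allI impI ballI refl)
  have ins: "insert k K = UNIV" by blast
  show "holo_bivector_field (insert k K) (slit_dual_atlas k X L) D dual_bivector"
    unfolding ins dual_atlas holo_bivector_field_def
  proof (intro conjI ballI allI impI)
    fix c p i j assume "c \<in> {(D, dual_chart)}" "p \<in> fst c \<inter> D"
    then have "dual_chart p \<in> cylinder k Z" using dual.image by auto
    then show "dual_bivector c p $ i $ j = - dual_bivector c p $ j $ i"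
      unfolding dual_bivector_def vec_lambda_beta by (rule homog_skew)
  next
    show "bf_related UNIV {(D, dual_chart)} D {(D, dual_chart)} (\<lambda>p. p) dual_bivector dual_bivector"
      using dual.push_biv_id by (simp add: bf_related_def)
  next
    fix c i j assume c: "c \<in> {(D, dual_chart)}"
    have "holo_on UNIV (cylinder k Z) (in_chart (D, dual_chart) (\<lambda>p. dual_bivector c p $ i $ j)) \<longleftrightarrow>
        holo_on UNIV (cylinder k Z) (\<lambda>\<zeta>. homog k \<beta> \<zeta> i j)"
      by (rule holo_on_cong) (simp add: in_chart_def dual_bivector_def dual.chart_inv)
    then show "holo_on UNIV (snd c ` (fst c \<inter> D)) (in_chart c (\<lambda>p. dual_bivector c p $ i $ j))"
      using c holo_on_homog by (simp add: dual.image)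
  qed simp
next
  fix W s t c Q
  assume W: "openin (atlas_topology X) W" and s: "s \<in> holo_sections K X L W" and t: "t \<in> holo_sections K X L W"
    and c: "c \<in> slit_dual_atlas k X L" and Q: "Q \<in> fst c" "fst Q \<in> W"
  have ins: "insert k K = UNIV" by blast
  have c': "c = (D, dual_chart)" using c by (simp add: dual_atlas)
  have QD: "Q \<in> D" using Q c' by simp
  note W' = openin_image[OF W]
  note T = rel_open_cylinder[OF W'(2)]
  have in_T: "dual_chart Q \<in> cylinder k (\<psi> ` W) \<longleftrightarrow> fst Q \<in> W" if "Q \<in> D" for Q
  proof -
    have M: "fst Q \<in> M" and nz: "snd Q (fst Q, 1) \<noteq> 0" using that slit_dualD[of "fst Q" "snd Q"] by auto
    have "\<psi> (fst Q) \<in> \<psi> ` W \<longleftrightarrow> fst Q \<in> W" by (rule inj_on_image_mem_iff[OF inj M W'(1)])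
    moreover have "dual_chart Q $ k \<noteq> 0" using nz by (simp add: dual_chart_k[OF that])
    ultimately show ?thesis by (simp add: cylinder_def drop_dual_chart[OF that])
  qed
  \<comment> \<open>A section over \<open>W\<close> gives the expected linear function only over
    \<open>W\<close>; the cylinder over the image of \<open>W\<close> is open, which suffices for
    first derivatives.\<close>
  have ch: "in_chart c (lin_fun s) \<zeta> = lift_fun k (loc s) \<zeta>" if "\<zeta> \<in> cylinder k (\<psi> ` W)" "s \<in> holo_sections K X L W" for s \<zeta>
  proof -
    have z: "\<zeta> \<in> cylinder k Z" using that(1) W'(3) by (auto simp: cylinder_def)
    let ?Q = "inv_into D dual_chart \<zeta>"
    have "fst ?Q \<in> W" using in_T[OF dual.chart_inv(1)[OF z]] that(1) dual.chart_inv(2)[OF z] by simp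
    then have "fst (s (fst ?Q)) = fst ?Q" using that(2) holo_sections_iff[OF W'(1)] by blast
    from lin_fun_eq[where Q = ?Q and s = s, OF dual.chart_inv(1)[OF z] this]
    show ?thesis by (simp add: in_chart_def c' dual.chart_inv(2)[OF z])
  qed
  have hs: "holo_on K (\<psi> ` W) (loc s)" if "s \<in> holo_sections K X L W" for s
    using that holo_sections_iff[OF W'(1)] by blast
  have zT: "dual_chart Q \<in> cylinder k (\<psi> ` W)" using in_T[OF QD] Q(2) by simp
  have "bf_pair UNIV dual_bivector c (lin_fun s) (lin_fun t) Q =
      bracket (homog k \<beta>) (in_chart c (lin_fun s)) (in_chart c (lin_fun t)) (dual_chart Q)"
    unfolding bf_pair_bracket by (simp add: bracket_def dual_bivector_def c')
  also have "\<dots> = bracket (homog k \<beta>) (lift_fun k (loc s)) (lift_fun k (loc t)) (dual_chart Q)"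
    by (rule bracket_cong[OF T zT ch[OF _ s] ch[OF _ t]])
  also have "\<dots> = lift_fun k (jacobi_bracket k \<beta> (loc s) (loc t)) (dual_chart Q)"
    by (rule bracket_lift_fun[OF W'(2) hs[OF s] hs[OF t]]) (use zT W'(3) in \<open>auto simp: cylinder_def intro!: skew\<close>)
  also have "\<dots> = lift_fun k (loc (J W s t)) (dual_chart Q)"
    using zT by (simp add: lift_fun_def cylinder_def loc_J[OF W])
  also have "\<dots> = lin_fun (J W s t) Q"
    by (rule lin_fun_eq[OF QD, symmetric]) (simp add: J_def Q(2))
  finally show "bf_pair (insert k K) dual_bivector c (lin_fun s) (lin_fun t) Q = lin_fun (J W s t) Q"
    unfolding ins .
qed

end

section \<open>The leaf space of a flow box\<close>

lemma sum_congruence_transform: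
  fixes A A' :: "'n::finite \<Rightarrow> complex" and J P :: "'n \<Rightarrow> 'n \<Rightarrow> complex"
  shows "(\<Sum>j\<in>UNIV. \<Sum>m\<in>UNIV. (\<Sum>l\<in>UNIV. A l * J l j) * (\<Sum>l\<in>UNIV. A' l * J l m) * P j m) =
    (\<Sum>l\<in>UNIV. \<Sum>l'\<in>UNIV. (\<Sum>j\<in>UNIV. \<Sum>m\<in>UNIV. J l j * J l' m * P j m) * A l * A' l')"
proof -
  let ?X = "\<lambda>j m l l'. A l * J l j * (A' l' * J l' m) * P j m"
  have "(\<Sum>j\<in>UNIV. \<Sum>m\<in>UNIV. (\<Sum>l\<in>UNIV. A l * J l j) * (\<Sum>l\<in>UNIV. A' l * J l m) * P j m) =
      (\<Sum>j\<in>UNIV. \<Sum>m\<in>UNIV. \<Sum>l\<in>UNIV. \<Sum>l'\<in>UNIV. ?X j m l l')"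
    unfolding sum_product by (simp only: sum_distrib_right)
  also have "\<dots> = (\<Sum>j\<in>UNIV. \<Sum>l\<in>UNIV. \<Sum>m\<in>UNIV. \<Sum>l'\<in>UNIV. ?X j m l l')"
    by (rule sum.cong[OF refl], rule sum.swap)
  also have "\<dots> = (\<Sum>l\<in>UNIV. \<Sum>j\<in>UNIV. \<Sum>m\<in>UNIV. \<Sum>l'\<in>UNIV. ?X j m l l')"
    by (rule sum.swap)
  also have "\<dots> = (\<Sum>l\<in>UNIV. \<Sum>j\<in>UNIV. \<Sum>l'\<in>UNIV. \<Sum>m\<in>UNIV. ?X j m l l')"
    by (rule sum.cong[OF refl], rule sum.cong[OF refl], rule sum.swap)
  also have "\<dots> = (\<Sum>l\<in>UNIV. \<Sum>l'\<in>UNIV. \<Sum>j\<in>UNIV. \<Sum>m\<in>UNIV. ?X j m l l')"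
    by (rule sum.cong[OF refl], rule sum.swap)
  also have "\<dots> = (\<Sum>l\<in>UNIV. \<Sum>l'\<in>UNIV. (\<Sum>j\<in>UNIV. \<Sum>m\<in>UNIV. J l j * J l' m * P j m) * A l * A' l')"
    unfolding sum_distrib_right by (intro sum.cong refl) (simp only: mult_ac)
  finally show ?thesis .
qed

lemma continuous_on_vec_componentwise:
  fixes F :: "'a::topological_space \<Rightarrow> complex ^ 'n::finite"
  assumes "\<And>i. continuous_on S (\<lambda>x. F x $ i)"
  shows "continuous_on S F"
proof -
  have "continuous_on S (\<lambda>x. \<Sum>j\<in>UNIV. axis j (F x $ j))"
    by (intro continuous_on_sum continuous_on_axis assms)
  then show ?thesis unfolding vec_eq_sum_axis[symmetric] .
qed

text \<open>\<open>H_box\<close> and \<open>P_box\<close> concern the chart \<open>c0\<close> only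
  and say that in box coordinates the field is the Euler field and the bivector is
  \<open>homog k \<beta>\<close>. The transformation laws \<open>HY\<close> and \<open>PY\<close>
  carry this to all charts of \<open>Y\<close>.\<close>

locale flow_box_chart =
  fixes Y :: "('a, 'n::finite) atlas" and P :: "('a, 'n) bfield" and H :: "('a, 'n) vfield"
    and c0 :: "('a, 'n) chart" and k :: 'n and r :: real and G g :: "complex ^ 'n \<Rightarrow> complex ^ 'n"
    and \<beta> :: "complex ^ 'n \<Rightarrow> 'n \<Rightarrow> 'n \<Rightarrow> complex"
  assumes Y: "complex_manifold UNIV Y" and c0: "c0 \<in> Y" and r: "0 < r" "r \<le> 1"
    and HY: "vector_field UNIV Y (points Y) H" and PY: "bf_related UNIV Y (points Y) Y (\<lambda>p. p) P P"
    and GS: "G ` polydisc k r \<subseteq> snd c0 ` fst c0" and oG: "open (G ` polydisc k r)"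
    and G: "\<And>i. holo_on UNIV (polydisc k r) (\<lambda>\<zeta>. G \<zeta> $ i)"
    and g: "\<And>i. holo_on UNIV (G ` polydisc k r) (\<lambda>z. g z $ i)"
    and gG: "\<And>\<zeta>. \<zeta> \<in> polydisc k r \<Longrightarrow> g (G \<zeta>) = \<zeta>"
    and H_box: "\<And>z i. z \<in> G ` polydisc k r \<Longrightarrow>
       (\<Sum>l\<in>UNIV. H c0 (inv_into (fst c0) (snd c0) z) $ l * cpartial l (\<lambda>z. g z $ i) z) = (if i = k then g z $ k else 0)"
    and P_box: "\<And>z i j. z \<in> G ` polydisc k r \<Longrightarrow>
       bracket (\<lambda>z i j. P c0 (inv_into (fst c0) (snd c0) z) $ i $ j) (\<lambda>z. g z $ i) (\<lambda>z. g z $ j) z = homog k \<beta> (g z) i j"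
    and \<beta>: "\<And>i j. holo_on (UNIV - {k}) (base_polydisc k r) (\<lambda>z. \<beta> z i j)"
    and skew: "\<And>z i j. z \<in> base_polydisc k r \<Longrightarrow> \<beta> z i j = - \<beta> z j i"
    and jac: "\<And>z i j m. z \<in> base_polydisc k r \<Longrightarrow> (\<Sum>l\<in>UNIV. \<beta> z l i * homog_deriv k \<beta> z l j m +
     \<beta> z l j * homog_deriv k \<beta> z l m i + \<beta> z l m * homog_deriv k \<beta> z l i j) = 0"
begin

abbreviation "B \<equiv> polydisc k r"
abbreviation "T \<equiv> G ` polydisc k r"

definition U :: "'a set" where "U = {p \<in> fst c0. snd c0 p \<in> T}"
definition \<eta> :: "'a \<Rightarrow> complex ^ 'n" where "\<eta> p = g (snd c0 p)"
definition \<theta> :: "complex ^ 'n \<Rightarrow> 'a" where "\<theta> \<zeta> = inv_into (fst c0) (snd c0) (G \<zeta>)"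

lemma rT: "rel_open UNIV T" using oG by simp

lemma inj_chart: "c \<in> Y \<Longrightarrow> inj_on (snd c) (fst c)"
  using Y unfolding complex_manifold_def by blast

lemma open_overlap: "c \<in> Y \<Longrightarrow> d \<in> Y \<Longrightarrow> rel_open UNIV (snd c ` (fst c \<inter> fst d))"
  using Y unfolding complex_manifold_def by blast

lemma transition: "c \<in> Y \<Longrightarrow> d \<in> Y \<Longrightarrow> holo_on UNIV (snd c ` (fst c \<inter> fst d)) (in_chart c (\<lambda>p. snd d p $ i))"
  using Y unfolding complex_manifold_def by blast

lemma in_chart_eq: "c \<in> Y \<Longrightarrow> p \<in> fst c \<Longrightarrow> in_chart c f (snd c p) = f p"
  by (simp add: in_chart_def inv_into_f_f[OF inj_chart])

lemma U_points: "p \<in> U \<Longrightarrow> p \<in> fst c0" "p \<in> U \<Longrightarrow> snd c0 p \<in> T" "p \<in> U \<Longrightarrow> p \<in> points Y"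
  using c0 by (auto simp: U_def points_def)

lemma \<theta>_in: 
  assumes "\<zeta> \<in> B"
  shows "\<theta> \<zeta> \<in> U" "snd c0 (\<theta> \<zeta>) = G \<zeta>" "\<eta> (\<theta> \<zeta>) = \<zeta>"
proof -
  have z: "G \<zeta> \<in> snd c0 ` fst c0" using GS assms by blast
  then show *: "snd c0 (\<theta> \<zeta>) = G \<zeta>" unfolding \<theta>_def by (rule f_inv_into_f)
  have "\<theta> \<zeta> \<in> fst c0" unfolding \<theta>_def using z by (rule inv_into_into)
  then show "\<theta> \<zeta> \<in> U" unfolding U_def using * assms by simp
  show "\<eta> (\<theta> \<zeta>) = \<zeta>" by (simp add: \<eta>_def * gG assms)
qed

lemma \<eta>_in:
  assumes "p \<in> U"
  shows "\<eta> p \<in> B" "G (\<eta> p) = snd c0 p" "\<theta> (\<eta> p) = p"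
proof -
  obtain \<zeta> where z: "\<zeta> \<in> B" "snd c0 p = G \<zeta>" using U_points(2)[OF assms] by blast
  then have e: "\<eta> p = \<zeta>" by (simp add: \<eta>_def gG)
  then show "\<eta> p \<in> B" "G (\<eta> p) = snd c0 p" using z by simp_all
  show "\<theta> (\<eta> p) = p"
    unfolding \<theta>_def e z(2)[symmetric] by (rule inv_into_f_f[OF inj_chart[OF c0] U_points(1)[OF assms]])
qed

lemma \<eta>_k: "p \<in> U \<Longrightarrow> \<eta> p $ k \<noteq> 0"
  by (rule polydisc_nth_nonzero[OF \<eta>_in(1) r(2)])

lemma openin_basic: "c \<in> Y \<Longrightarrow> open S \<Longrightarrow> openin (atlas_topology Y) {p \<in> fst c. snd c p \<in> S}"
  unfolding atlas_topology_def by (rule topology_generated_by_Basis) blast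

lemma openin_U: "openin (atlas_topology Y) U"
  unfolding U_def by (rule openin_basic[OF c0 oG])

lemma openin_\<eta>:
  assumes "open S"
  shows "openin (atlas_topology Y) {p \<in> U. \<eta> p \<in> S}"
proof -
  have "continuous_on T g"
    by (rule continuous_on_vec_componentwise) (rule holo_on_continuous[OF g])
  then have "open (T \<inter> g -` S)" using oG assms by (rule continuous_open_preimage)
  moreover have "{p \<in> U. \<eta> p \<in> S} = {p \<in> fst c0. snd c0 p \<in> T \<inter> g -` S}"
    by (auto simp: U_def \<eta>_def)
  ultimately show ?thesis by (simp only: openin_basic[OF c0])
qed

text \<open>The box coordinates \<open>\<eta>\<close> need not form a chart of \<open>Y\<close>, so
  holomorphy and derivatives are examined in every chart \<open>c\<close>, on this part of its
  image.\<close>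

definition dom :: "('a, 'n) chart \<Rightarrow> (complex ^ 'n) set \<Rightarrow> (complex ^ 'n) set" where
  "dom c S = snd c ` {p \<in> fst c \<inter> U. \<eta> p \<in> S}"

lemma inv_chart0: "p \<in> U \<Longrightarrow> inv_into (fst c0) (snd c0) (snd c0 p) = p"
  by (rule inv_into_f_f[OF inj_chart[OF c0] U_points(1)])

lemma continuous_on_transition:
  assumes "c \<in> Y" "d \<in> Y"
  shows "continuous_on (snd c ` (fst c \<inter> fst d)) (in_chart c (snd d))"
proof (rule continuous_on_vec_componentwise)
  fix i
  have eq: "(\<lambda>z. in_chart c (snd d) z $ i) = in_chart c (\<lambda>p. snd d p $ i)"
    by (simp add: in_chart_def fun_eq_iff)
  show "continuous_on (snd c ` (fst c \<inter> fst d)) (\<lambda>z. in_chart c (snd d) z $ i)"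
    unfolding eq by (rule holo_on_continuous[OF transition[OF assms]])
qed

lemma dom_iff:
  assumes "c \<in> Y"
  shows "z \<in> dom c S \<longleftrightarrow> z \<in> snd c ` (fst c \<inter> fst c0) \<and> in_chart c (snd c0) z \<in> T \<inter> g -` S"
proof
  assume "z \<in> dom c S"
  then obtain p where "p \<in> fst c" "p \<in> U" "\<eta> p \<in> S" "z = snd c p" unfolding dom_def by blast
  then show "z \<in> snd c ` (fst c \<inter> fst c0) \<and> in_chart c (snd c0) z \<in> T \<inter> g -` S"
    using in_chart_eq[OF assms, of p "snd c0"] U_points(1,2)[of p] by (auto simp: \<eta>_def)
next
  assume z: "z \<in> snd c ` (fst c \<inter> fst c0) \<and> in_chart c (snd c0) z \<in> T \<inter> g -` S"
  then obtain p where p: "p \<in> fst c" "p \<in> fst c0" "z = snd c p" by blast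
  then have "snd c0 p \<in> T" "g (snd c0 p) \<in> S" using z in_chart_eq[OF assms, of p "snd c0"] by auto
  then show "z \<in> dom c S" unfolding dom_def U_def \<eta>_def using p by blast
qed

lemma rel_open_dom:
  assumes "c \<in> Y" "open S"
  shows "rel_open UNIV (dom c S)"
proof -
  have "continuous_on T g"
    by (rule continuous_on_vec_componentwise) (rule holo_on_continuous[OF g])
  then have "open (T \<inter> g -` S)" using oG assms(2) by (rule continuous_open_preimage)
  moreover have "open (snd c ` (fst c \<inter> fst c0))" using open_overlap[OF assms(1) c0] by simp
  ultimately have "open (snd c ` (fst c \<inter> fst c0) \<inter> in_chart c (snd c0) -` (T \<inter> g -` S))"
    by (intro continuous_open_preimage[OF continuous_on_transition[OF assms(1) c0]])
  moreover have "dom c S = snd c ` (fst c \<inter> fst c0) \<inter> in_chart c (snd c0) -` (T \<inter> g -` S)"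
    using dom_iff[OF assms(1)] by blast
  ultimately show ?thesis by simp
qed

lemma dom_point: "p \<in> fst c \<Longrightarrow> p \<in> U \<Longrightarrow> \<eta> p \<in> S \<Longrightarrow> snd c p \<in> dom c S"
  unfolding dom_def by blast

lemma dom_subset: "dom c S \<subseteq> snd c ` (fst c \<inter> fst c0)"
  unfolding dom_def U_def by blast

lemma transition_dom:
  assumes "c \<in> Y"
  shows "holo_on UNIV (dom c S) (\<lambda>z. in_chart c (snd c0) z $ i)" "in_chart c (snd c0) ` dom c S \<subseteq> T"
proof -
  have "(\<lambda>z. in_chart c (snd c0) z $ i) = in_chart c (\<lambda>p. snd c0 p $ i)"
    by (simp add: in_chart_def fun_eq_iff)
  then show "holo_on UNIV (dom c S) (\<lambda>z. in_chart c (snd c0) z $ i)"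
    using holo_on_subset[OF transition[OF assms c0] dom_subset] by simp
  show "in_chart c (snd c0) ` dom c S \<subseteq> T" using dom_iff[OF assms] by blast
qed

lemma in_chart_\<eta>: "in_chart c \<eta> z = g (in_chart c (snd c0) z)"
  by (simp add: in_chart_def \<eta>_def)

lemma holo_in_chart_\<eta>:
  assumes "c \<in> Y" "open S"
  shows "holo_on UNIV (dom c S) (\<lambda>z. in_chart c \<eta> z $ i)" "in_chart c \<eta> ` dom c S \<subseteq> S"
  unfolding in_chart_\<eta>
  using holo_on_compose[OF rel_open_dom[OF assms] rT transition_dom[OF assms(1)] g] by simp (use dom_iff[OF assms(1)] in blast)

definition E :: "('a, 'n) chart \<Rightarrow> 'a \<Rightarrow> 'n \<Rightarrow> 'n \<Rightarrow> complex" where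
  "E c p i j = cpartial j (\<lambda>z. in_chart c \<eta> z $ i) (snd c p)"

lemma
  assumes c: "c \<in> Y" and S: "open S" and F: "holo_on UNIV S F"
    and f: "\<And>q. q \<in> U \<Longrightarrow> \<eta> q \<in> S \<Longrightarrow> f q = F (\<eta> q)"
  shows holo_chart_compose: "holo_on UNIV (dom c S) (in_chart c f)"
    and cpartial_chart_compose: "\<And>p j. p \<in> fst c \<Longrightarrow> p \<in> U \<Longrightarrow> \<eta> p \<in> S \<Longrightarrow>
      cpartial j (in_chart c f) (snd c p) = (\<Sum>i\<in>UNIV. cpartial i F (\<eta> p) * E c p i j)"
proof -
  have S': "rel_open UNIV S" using S by simp
  note h = rel_open_dom[OF c S] S' holo_in_chart_\<eta>[OF c S]
  have eq: "in_chart c f z = F (in_chart c \<eta> z)" if z: "z \<in> dom c S" for z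
  proof -
    obtain p where "p \<in> fst c" "p \<in> U" "\<eta> p \<in> S" "z = snd c p" using z unfolding dom_def by blast
    then show ?thesis using f by (simp add: in_chart_eq[OF c])
  qed
  show "holo_on UNIV (dom c S) (in_chart c f)"
    using holo_on_compose[OF h(1,2,3,4) F] holo_on_cong[of "dom c S" "in_chart c f" "\<lambda>z. F (in_chart c \<eta> z)" UNIV, OF eq] by simp
  fix p j assume p: "p \<in> fst c" "p \<in> U" "\<eta> p \<in> S"
  note z = dom_point[OF p]
  have "cpartial j (in_chart c f) (snd c p) = cpartial j (\<lambda>z. F (in_chart c \<eta> z)) (snd c p)"
    by (rule cpartial_cong[OF h(1) z UNIV_I eq])
  also have "\<dots> = (\<Sum>i\<in>UNIV. cpartial i F (in_chart c \<eta> (snd c p)) * cpartial j (\<lambda>z. in_chart c \<eta> z $ i) (snd c p))"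
    by (rule cpartial_compose[OF h(1,2,3,4) F z UNIV_I])
  finally show "cpartial j (in_chart c f) (snd c p) = (\<Sum>i\<in>UNIV. cpartial i F (\<eta> p) * E c p i j)"
    by (simp add: E_def in_chart_eq[OF c p(1)])
qed

lemma E_eq:
  assumes c: "c \<in> Y" and p: "p \<in> fst c" "p \<in> U"
  shows "E c p i j = (\<Sum>l\<in>UNIV. cpartial l (\<lambda>z. g z $ i) (snd c0 p) * jac (\<lambda>q. q) c c0 p l j)"
proof -
  have S: "open (UNIV :: (complex ^ 'n) set)" by simp
  note z = dom_point[OF p, of UNIV, OF UNIV_I]
  have "E c p i j = (\<Sum>l\<in>UNIV. cpartial l (\<lambda>z. g z $ i) (in_chart c (snd c0) (snd c p)) * cpartial j (\<lambda>z. in_chart c (snd c0) z $ l) (snd c p))"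
    unfolding E_def in_chart_\<eta>
    by (rule cpartial_compose[OF rel_open_dom[OF c S] rT transition_dom[OF c] g z UNIV_I])
  moreover have "(\<lambda>z. in_chart c (snd c0) z $ l) = in_chart c (\<lambda>p. snd c0 p $ l)" for l
    by (simp add: in_chart_def fun_eq_iff)
  ultimately show ?thesis by (simp add: jac_def in_chart_eq[OF c p(1)])
qed

text \<open>The transformation law moves the field from \<open>c\<close> to \<open>c0\<close>, where
  \<open>H_box\<close> applies.\<close>

lemma E_H:
  assumes c: "c \<in> Y" and p: "p \<in> fst c" "p \<in> U"
  shows "(\<Sum>j\<in>UNIV. E c p i j * H c p $ j) = (if i = k then \<eta> p $ k else 0)"
proof -
  have "H c0 p = push_vec UNIV (\<lambda>q. q) c c0 p (H c p)"
    using HY[unfolded vector_field_def vf_related_def, THEN conjunct2, rule_format, OF c c0, of p] p U_points[OF p(2)]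
    by (simp only: IntI simp_thms)
  then have H: "H c0 p $ l = (\<Sum>j\<in>UNIV. jac (\<lambda>q. q) c c0 p l j * H c p $ j)" for l
    by (simp add: push_vec_def)
  have "(\<Sum>j\<in>UNIV. E c p i j * H c p $ j) =
      (\<Sum>j\<in>UNIV. \<Sum>l\<in>UNIV. cpartial l (\<lambda>z. g z $ i) (snd c0 p) * (jac (\<lambda>q. q) c c0 p l j * H c p $ j))"
    by (simp only: E_eq[OF assms] sum_distrib_right mult.assoc)
  also have "\<dots> = (\<Sum>l\<in>UNIV. H c0 p $ l * cpartial l (\<lambda>z. g z $ i) (snd c0 p))"
    by (subst sum.swap) (simp only: H sum_distrib_left mult.commute)
  also have "\<dots> = (if i = k then \<eta> p $ k else 0)"
    using H_box[OF U_points(2)[OF p(2)], of i] by (simp add: inv_chart0[OF p(2)] \<eta>_def)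
  finally show ?thesis .
qed

lemma E_P:
  assumes c: "c \<in> Y" and p: "p \<in> fst c" "p \<in> U"
  shows "(\<Sum>j\<in>UNIV. \<Sum>m\<in>UNIV. E c p i j * E c p i' m * P c p $ j $ m) = homog k \<beta> (\<eta> p) i i'"
proof -
  have "P c0 p = push_biv UNIV (\<lambda>q. q) c c0 p (P c p)"
    using PY[unfolded bf_related_def, rule_format, OF c c0, of p] p U_points[OF p(2)]
    by (simp only: IntI simp_thms)
  then have "P c0 p $ l $ l' = (\<Sum>j\<in>UNIV. \<Sum>m\<in>UNIV. jac (\<lambda>q. q) c c0 p l j * jac (\<lambda>q. q) c c0 p l' m * P c p $ j $ m)" for l l'
    by (simp add: push_biv_def)
  then show ?thesis
    unfolding E_eq[OF assms] sum_congruence_transform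
    using P_box[OF U_points(2)[OF p(2)], of i i'] by (simp add: bracket_def inv_chart0[OF p(2)] \<eta>_def)
qed

definition dom\<theta> :: "('a, 'n) chart \<Rightarrow> (complex ^ 'n) set" where
  "dom\<theta> c = {\<zeta> \<in> B. \<theta> \<zeta> \<in> fst c}"

lemma
  assumes c: "c \<in> Y"
  shows rel_open_dom\<theta>: "rel_open UNIV (dom\<theta> c)"
    and holo_\<theta>: "holo_on UNIV (dom\<theta> c) (\<lambda>\<zeta>. snd c (\<theta> \<zeta>) $ i)"
proof -
  let ?O = "snd c0 ` (fst c0 \<inter> fst c)"
  have iff: "G \<zeta> \<in> ?O \<longleftrightarrow> \<theta> \<zeta> \<in> fst c" if "\<zeta> \<in> B" for \<zeta>
  proof
    assume "G \<zeta> \<in> ?O"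
    then obtain q where "q \<in> fst c0" "q \<in> fst c" "G \<zeta> = snd c0 q" by blast
    then show "\<theta> \<zeta> \<in> fst c" unfolding \<theta>_def by (simp add: inv_into_f_f[OF inj_chart[OF c0]])
  next
    assume "\<theta> \<zeta> \<in> fst c"
    then have "\<theta> \<zeta> \<in> fst c0 \<inter> fst c" using U_points(1)[OF \<theta>_in(1)[OF that]] by simp
    then have "snd c0 (\<theta> \<zeta>) \<in> ?O" by (rule imageI)
    then show "G \<zeta> \<in> ?O" unfolding \<theta>_in(2)[OF that] .
  qed
  have "continuous_on B G"
    by (rule continuous_on_vec_componentwise) (rule holo_on_continuous[OF G])
  then have "open (B \<inter> G -` ?O)"
    using open_overlap[OF c0 c] by (intro continuous_open_preimage open_polydisc) simp_all
  moreover have eq: "dom\<theta> c = B \<inter> G -` ?O" unfolding dom\<theta>_def using iff by blast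
  ultimately show r: "rel_open UNIV (dom\<theta> c)" by simp
  have "holo_on UNIV (dom\<theta> c) (\<lambda>\<zeta>. in_chart c0 (\<lambda>p. snd c p $ i) (G \<zeta>))"
  proof (rule holo_on_compose[OF r open_overlap[OF c0 c] _ _ transition[OF c0 c]])
    show "holo_on UNIV (dom\<theta> c) (\<lambda>\<zeta>. G \<zeta> $ j)" for j
      by (rule holo_on_subset[OF G]) (simp add: eq)
  qed (simp add: eq, blast)
  moreover have "in_chart c0 (\<lambda>p. snd c p $ i) (G \<zeta>) = snd c (\<theta> \<zeta>) $ i" for \<zeta>
    by (simp add: in_chart_def \<theta>_def)
  ultimately show "holo_on UNIV (dom\<theta> c) (\<lambda>\<zeta>. snd c (\<theta> \<zeta>) $ i)" by simp
qed

definition E' :: "('a, 'n) chart \<Rightarrow> 'a \<Rightarrow> 'n \<Rightarrow> 'n \<Rightarrow> complex" where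
  "E' c p j m = cpartial m (\<lambda>\<zeta>. snd c (\<theta> \<zeta>) $ j) (\<eta> p)"

lemma E_E':
  assumes c: "c \<in> Y" and p: "p \<in> fst c" "p \<in> U"
  shows "(\<Sum>j\<in>UNIV. E c p i j * E' c p j m) = (if i = m then 1 else 0)"
proof -
  have S: "open (UNIV :: (complex ^ 'n) set)" by simp
  have z: "\<eta> p \<in> dom\<theta> c" using \<eta>_in[OF p(2)] p(1) by (simp add: dom\<theta>_def)
  have im: "(\<lambda>\<zeta>. snd c (\<theta> \<zeta>)) ` dom\<theta> c \<subseteq> dom c UNIV"
    using \<theta>_in(1) by (auto simp: dom\<theta>_def intro: dom_point)
  have "cpartial m (\<lambda>\<zeta>. in_chart c \<eta> (snd c (\<theta> \<zeta>)) $ i) (\<eta> p) =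
      (\<Sum>j\<in>UNIV. cpartial j (\<lambda>z. in_chart c \<eta> z $ i) (snd c (\<theta> (\<eta> p))) * cpartial m (\<lambda>\<zeta>. snd c (\<theta> \<zeta>) $ j) (\<eta> p))"
    by (rule cpartial_compose[OF rel_open_dom\<theta>[OF c] rel_open_dom[OF c S] holo_\<theta>[OF c] im holo_in_chart_\<eta>(1)[OF c S] z UNIV_I])
  moreover have "cpartial m (\<lambda>\<zeta>. in_chart c \<eta> (snd c (\<theta> \<zeta>)) $ i) (\<eta> p) = cpartial m (\<lambda>\<zeta>. \<zeta> $ i) (\<eta> p)"
    by (rule cpartial_cong[OF rel_open_dom\<theta>[OF c] z UNIV_I]) (auto simp: dom\<theta>_def in_chart_eq[OF c] \<theta>_in)
  ultimately show ?thesis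
    by (simp add: E_def E'_def \<eta>_in[OF p(2)] cpartial_coord eq_commute[of i m])
qed

text \<open>For square matrices a right inverse is also a left inverse.\<close>

lemma E'_E:
  assumes c: "c \<in> Y" and p: "p \<in> fst c" "p \<in> U"
  shows "(\<Sum>i\<in>UNIV. E' c p j i * E c p i m) = (if j = m then 1 else 0)"
proof -
  let ?A = "(\<chi> i j. E c p i j) :: complex ^ 'n ^ 'n" and ?A' = "(\<chi> i j. E' c p i j) :: complex ^ 'n ^ 'n"
  have "?A ** ?A' = mat 1"
    unfolding matrix_matrix_mult_def mat_def vec_eq_iff vec_lambda_beta by (intro allI, rule E_E'[OF assms])
  then have "?A' ** ?A = mat 1" by (rule matrix_left_right_inverse[THEN iffD1])
  then have "(?A' ** ?A) $ j $ m = (mat 1 :: complex ^ 'n ^ 'n) $ j $ m" by (rule arg_cong)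
  then show ?thesis unfolding matrix_matrix_mult_def mat_def vec_lambda_beta .
qed

lemma H_eq:
  assumes c: "c \<in> Y" and p: "p \<in> fst c" "p \<in> U"
  shows "H c p $ j = \<eta> p $ k * E' c p j k"
proof -
  have "H c p $ j = (\<Sum>m\<in>UNIV. (\<Sum>i\<in>UNIV. E' c p j i * E c p i m) * H c p $ m)"
    unfolding E'_E[OF assms] by (simp add: mult_delta_left)
  also have "\<dots> = (\<Sum>m\<in>UNIV. \<Sum>i\<in>UNIV. E' c p j i * (E c p i m * H c p $ m))"
    by (simp only: sum_distrib_right mult.assoc)
  also have "\<dots> = (\<Sum>i\<in>UNIV. E' c p j i * (\<Sum>m\<in>UNIV. E c p i m * H c p $ m))"
    by (subst sum.swap) (simp only: sum_distrib_left)
  also have "\<dots> = E' c p j k * \<eta> p $ k"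
    unfolding E_H[OF assms] by (simp add: mult_delta_right)
  finally show ?thesis by (simp add: mult.commute)
qed

lemma continuous_map_\<theta>: "continuous_map (top_of_set B) (atlas_topology Y) \<theta>"
  unfolding atlas_topology_def
proof (rule continuous_on_generated_topo)
  show "\<theta> ` topspace (top_of_set B) \<subseteq> \<Union> {{p \<in> fst c. snd c p \<in> S} |c S. c \<in> Y \<and> open S}"
  proof (rule image_subsetI)
    fix \<zeta> assume "\<zeta> \<in> topspace (top_of_set B)"
    then have "\<zeta> \<in> B" by simp
    then have "\<theta> \<zeta> \<in> {p \<in> fst c0. snd c0 p \<in> UNIV}" using U_points(1)[OF \<theta>_in(1)] by simp
    then show "\<theta> \<zeta> \<in> \<Union> {{p \<in> fst c. snd c p \<in> S} |c S. c \<in> Y \<and> open S}"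
      by (rule UnionI[rotated]) (rule CollectI, rule exI[of _ c0], rule exI[of _ UNIV], simp add: c0)
  qed
  fix W assume "W \<in> {{p \<in> fst c. snd c p \<in> S} |c S. c \<in> Y \<and> open S}"
  then obtain c S where W: "c \<in> Y" "open S" "W = {p \<in> fst c. snd c p \<in> S}"
    unfolding mem_Collect_eq by (elim exE conjE)
  have "continuous_on (dom\<theta> c) (\<lambda>\<zeta>. snd c (\<theta> \<zeta>))"
    by (rule continuous_on_vec_componentwise) (rule holo_on_continuous[OF holo_\<theta>[OF W(1)]])
  then have "open (dom\<theta> c \<inter> (\<lambda>\<zeta>. snd c (\<theta> \<zeta>)) -` S)"
    using rel_open_dom\<theta>[OF W(1)] W(2) by (intro continuous_open_preimage) simp_all
  moreover have "\<theta> -` W \<inter> topspace (top_of_set B) = dom\<theta> c \<inter> (\<lambda>\<zeta>. snd c (\<theta> \<zeta>)) -` S"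
    by (auto simp: W(3) dom\<theta>_def)
  moreover have "dom\<theta> c \<subseteq> B" by (auto simp: dom\<theta>_def)
  ultimately have "open (\<theta> -` W \<inter> topspace (top_of_set B))" "\<theta> -` W \<inter> topspace (top_of_set B) \<subseteq> B"
    by (simp_all only:, blast)
  then show "openin (top_of_set B) (\<theta> -` W \<inter> topspace (top_of_set B))"
    by (simp only: openin_open_eq[OF open_polydisc])
qed

end

section \<open>Leaves as slices of the flow box\<close>

lemma has_vector_derivative_vec_componentwise:
  fixes F :: "real \<Rightarrow> complex ^ 'm::finite"
  assumes "\<And>j. ((\<lambda>t. F t $ j) has_vector_derivative F' $ j) net"
  shows "(F has_vector_derivative F') net"
  unfolding has_vector_derivative_def
  by (rule has_derivative_vec_componentwise) (use assms in \<open>simp add: has_vector_derivative_def\<close>)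

lemma eq_add_axis_of_drop_coord:
  assumes "drop_coord k x = drop_coord k y"
  shows "y = x + axis k (y $ k - x $ k)"
proof -
  have "x $ i = y $ i" if "i \<noteq> k" for i
    using arg_cong[OF assms, of "\<lambda>v. v $ i"] that by (simp add: drop_coord_nth)
  then show ?thesis by (simp add: vec_eq_iff axis_nth_eq)
qed

context flow_box_chart
begin

abbreviation "lf \<equiv> leaf Y H U"

text \<open>By \<open>H_box\<close> the differentials of the coordinates other than k annihilate the
  field, so these coordinates are constant along every admissible curve.\<close>

lemma leaf_subset:
  assumes p: "p \<in> U" and q: "q \<in> lf p"
  shows "q \<in> U \<and> drop_coord k (\<eta> q) = drop_coord k (\<eta> p)"
proof -
  obtain \<gamma> a where cont: "continuous_map (top_of_set {0..1}) (subtopology (atlas_topology Y) U) \<gamma>"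
    and ends: "\<gamma> 0 = p" "\<gamma> 1 = q"
    and der: "\<forall>c\<in>Y. \<forall>t\<in>{0..1}. \<gamma> t \<in> fst c \<longrightarrow>
           ((\<lambda>r. snd c (\<gamma> r)) has_vector_derivative (a t *s H c (\<gamma> t))) (at t within {0..1})"
    using q unfolding leaf_def by blast
  have inU: "\<gamma> t \<in> U" if "t \<in> {0..1}" for t
    using continuous_map_image_subset_topspace[OF cont] that by auto
  have const: "\<eta> q $ i = \<eta> p $ i" if i: "i \<noteq> k" for i
  proof -
    have d0: "((\<lambda>t. \<eta> (\<gamma> t) $ i) has_vector_derivative 0) (at t within {0..1})" if t: "t \<in> {0..1}" for t
    proof -
      let ?z = "snd c0 (\<gamma> t)"
      note U = U_points(1,2)[OF inU[OF t]]
      have 1: "((\<lambda>r. snd c0 (\<gamma> r)) has_vector_derivative (a t *s H c0 (\<gamma> t))) (at t within {0..1})"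
        using der c0 t U(1) by blast
      have "((\<lambda>z. g z $ i) has_derivative (\<lambda>h. \<Sum>l\<in>UNIV. cpartial l (\<lambda>z. g z $ i) ?z * h $ l)) (at ?z within T)"
        by (rule holo_on_has_derivative[OF g rT U(2)])
      then have 2: "((\<lambda>z. g z $ i) has_derivative (\<lambda>h. \<Sum>l\<in>UNIV. cpartial l (\<lambda>z. g z $ i) ?z * h $ l))
          (at ?z within (\<lambda>r. snd c0 (\<gamma> r)) ` {0..1})"
        by (rule has_derivative_subset) (use U_points(2)[OF inU] in blast)
      have "(\<Sum>l\<in>UNIV. cpartial l (\<lambda>z. g z $ i) ?z * (a t *s H c0 (\<gamma> t)) $ l) =
          a t * (\<Sum>l\<in>UNIV. H c0 (\<gamma> t) $ l * cpartial l (\<lambda>z. g z $ i) ?z)"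
        unfolding sum_distrib_left by (intro sum.cong refl) (simp add: mult_ac)
      also have "\<dots> = 0" using H_box[OF U(2), of i] i by (simp add: inv_chart0[OF inU[OF t]])
      finally show ?thesis
        using vector_derivative_diff_chain_within[OF 1 2] by (simp add: o_def \<eta>_def)
    qed
    have "\<exists>c. \<forall>t\<in>{0..1}. \<eta> (\<gamma> t) $ i = c"
    proof (rule has_vector_derivative_zero_constant[OF convex_real_interval(5) d0])
      fix c assume "\<And>t. t \<in> {0..1} \<Longrightarrow> \<eta> (\<gamma> t) $ i = c"
      then show "\<exists>c. \<forall>t\<in>{0..1}. \<eta> (\<gamma> t) $ i = c" by blast
    qed
    then obtain c where "\<forall>t\<in>{0..1}. \<eta> (\<gamma> t) $ i = c" ..
    then have "\<eta> (\<gamma> 1) $ i = c" "\<eta> (\<gamma> 0) $ i = c" by auto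
    then show ?thesis by (simp add: ends)
  qed
  have "q \<in> U" using inU[of 1] ends by simp
  then show ?thesis using const by (simp add: vec_eq_iff drop_coord_nth)
qed

text \<open>The straight segment in the fibre coordinate joins the two points; it stays in the box
  because discs are convex.\<close>

lemma leaf_supset:
  assumes p: "p \<in> U" and q: "q \<in> U" and d: "drop_coord k (\<eta> p) = drop_coord k (\<eta> q)"
  shows "q \<in> lf p"
proof -
  define \<Delta> where "\<Delta> = \<eta> q $ k - \<eta> p $ k"
  define \<zeta> where "\<zeta> t = \<eta> p + axis k (of_real t * \<Delta>)" for t :: real
  have qp: "\<eta> q = \<eta> p + axis k \<Delta>" unfolding \<Delta>_def by (rule eq_add_axis_of_drop_coord[OF d])
  have \<zeta>B: "\<zeta> t \<in> B" if t: "t \<in> {0..1}" for t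
    unfolding polydisc_def mem_Collect_eq
  proof
    fix i
    have e: "\<zeta> t $ i - axis k 1 $ i = (1 - t) *\<^sub>R (\<eta> p $ i - axis k 1 $ i) + t *\<^sub>R (\<eta> q $ i - axis k 1 $ i)"
      by (simp add: \<zeta>_def qp axis_nth_eq algebra_simps scaleR_conv_of_real)
    have "\<eta> p $ i - axis k 1 $ i \<in> ball 0 r" "\<eta> q $ i - axis k 1 $ i \<in> ball 0 r"
      using \<eta>_in(1)[OF p] \<eta>_in(1)[OF q] unfolding polydisc_def by auto
    then have "(1 - t) *\<^sub>R (\<eta> p $ i - axis k 1 $ i) + t *\<^sub>R (\<eta> q $ i - axis k 1 $ i) \<in> ball 0 r"
      using t by (intro convexD[OF convex_ball]) auto
    then show "norm (\<zeta> t $ i - axis k 1 $ i) < r" unfolding e by simp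
  qed
  have \<zeta>_ends: "\<zeta> 0 = \<eta> p" "\<zeta> 1 = \<eta> q" by (simp_all add: \<zeta>_def qp)
  have \<zeta>k: "\<zeta> t $ k \<noteq> 0" if "t \<in> {0..1}" for t by (rule polydisc_nth_nonzero[OF \<zeta>B[OF that] r(2)])
  have \<zeta>_cont: "continuous_on {0..1} \<zeta>" unfolding \<zeta>_def by (intro continuous_intros)
  have \<zeta>_der: "(\<zeta> has_vector_derivative axis k \<Delta>) (at t within {0..1})" for t
  proof -
    have id: "((\<lambda>t. of_real t) has_vector_derivative (1::complex)) (at t within {0..1})"
      using has_vector_derivative_of_real[OF DERIV_ident] by simp
    from bounded_linear.has_vector_derivative[OF bounded_linear_axis has_vector_derivative_mult_left[OF id, of \<Delta>], of k]
    have "((\<lambda>t. axis k (of_real t * \<Delta>)) has_vector_derivative axis k \<Delta>) (at t within {0..1})" by simp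
    then show ?thesis
      unfolding \<zeta>_def using has_vector_derivative_add[OF has_vector_derivative_const] by fastforce
  qed
  define \<gamma> where "\<gamma> t = \<theta> (\<zeta> t)" for t
  \<comment> \<open>The velocity is \<open>\<Delta>\<close> times the fibre direction, whereas the
    field is w times it.\<close>
  define a where "a t = \<Delta> / \<zeta> t $ k" for t
  have "continuous_map (top_of_set {0..1}) (top_of_set B) \<zeta>"
    using \<zeta>_cont \<zeta>B by (auto simp: continuous_map_in_subtopology continuous_map_subtopology_eu image_subset_iff)
  from continuous_map_compose[OF this continuous_map_\<theta>]
  have "continuous_map (top_of_set {0..1}) (atlas_topology Y) \<gamma>" by (simp add: o_def \<gamma>_def[abs_def])
  then have cont: "continuous_map (top_of_set {0..1}) (subtopology (atlas_topology Y) U) \<gamma>"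
    using \<theta>_in(1)[OF \<zeta>B] by (auto simp: continuous_map_in_subtopology \<gamma>_def image_subset_iff)
  have a_cont: "continuous_on {0..1} a"
    unfolding a_def by (intro continuous_on_divide continuous_on_const continuous_on_component \<zeta>_cont ballI \<zeta>k)
  have ends: "\<gamma> 0 = p" "\<gamma> 1 = q" by (simp_all add: \<gamma>_def \<zeta>_ends \<eta>_in p q)
  have der: "((\<lambda>r. snd c (\<gamma> r)) has_vector_derivative (a t *s H c (\<gamma> t))) (at t within {0..1})"
    if c: "c \<in> Y" and t: "t \<in> {0..1}" and in_c: "\<gamma> t \<in> fst c" for c t
  proof (rule has_vector_derivative_vec_componentwise)
    fix j
    let ?F = "\<lambda>\<zeta>. snd c (\<theta> \<zeta>) $ j"
    have z: "\<zeta> t \<in> dom\<theta> c" using in_c \<zeta>B[OF t] by (simp add: dom\<theta>_def \<gamma>_def)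
    have "(?F has_derivative (\<lambda>h. \<Sum>i\<in>UNIV. cpartial i ?F (\<zeta> t) * h $ i)) (at (\<zeta> t) within dom\<theta> c)"
      by (rule holo_on_has_derivative[OF holo_\<theta>[OF c] rel_open_dom\<theta>[OF c] z])
    moreover have "at (\<zeta> t) within dom\<theta> c = at (\<zeta> t)"
      by (rule at_within_open[OF z]) (use rel_open_dom\<theta>[OF c] in simp)
    ultimately have "(?F has_derivative (\<lambda>h. \<Sum>i\<in>UNIV. cpartial i ?F (\<zeta> t) * h $ i)) (at (\<zeta> t))" by simp
    from vector_derivative_diff_chain_within[OF \<zeta>_der has_derivative_at_withinI[OF this]]
    have "((\<lambda>r. snd c (\<gamma> r) $ j) has_vector_derivative (\<Sum>i\<in>UNIV. cpartial i ?F (\<zeta> t) * axis k \<Delta> $ i)) (at t within {0..1})"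
      by (simp add: o_def \<gamma>_def)
    moreover have "(\<Sum>i\<in>UNIV. cpartial i ?F (\<zeta> t) * axis k \<Delta> $ i) = cpartial k ?F (\<zeta> t) * \<Delta>"
    proof -
      have "(\<Sum>i\<in>UNIV. cpartial i ?F (\<zeta> t) * axis k \<Delta> $ i) = (\<Sum>i\<in>UNIV. if i = k then cpartial k ?F (\<zeta> t) * \<Delta> else 0)"
        by (rule sum.cong[OF refl]) (auto simp: axis_nth_eq)
      then show ?thesis by simp
    qed
    moreover have "(a t *s H c (\<gamma> t)) $ j = cpartial k ?F (\<zeta> t) * \<Delta>"
      using \<zeta>k[OF t] \<theta>_in[OF \<zeta>B[OF t]] H_eq[OF c in_c, of j]
      by (simp add: a_def \<gamma>_def E'_def)
    ultimately show "((\<lambda>r. snd c (\<gamma> r) $ j) has_vector_derivative (a t *s H c (\<gamma> t)) $ j) (at t within {0..1})" by simp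
  qed
  show ?thesis
    unfolding leaf_def mem_Collect_eq
    by (intro exI[of _ \<gamma>] exI[of _ a] conjI ballI impI) (use cont a_cont ends der in \<open>simp_all only:\<close>)
qed

lemma leaf_eq: "p \<in> U \<Longrightarrow> lf p = {q \<in> U. drop_coord k (\<eta> q) = drop_coord k (\<eta> p)}"
  by (intro set_eqI iffI CollectI) (use leaf_subset in blast, elim CollectE conjE, rule leaf_supset, simp_all)

abbreviation "M \<equiv> lf ` U"

text \<open>Any point of the leaf may be chosen, since all of them have the same base
  coordinates.\<close>

definition \<psi> :: "'a set \<Rightarrow> complex ^ 'n" where
  "\<psi> l = drop_coord k (\<eta> (SOME p. p \<in> l))"

lemma \<psi>_leaf:
  assumes p: "p \<in> U"
  shows "\<psi> (lf p) = drop_coord k (\<eta> p)"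
proof -
  have "p \<in> lf p" using p by (simp add: leaf_eq)
  then have "(SOME q. q \<in> lf p) \<in> lf p" by (rule someI)
  then show ?thesis unfolding \<psi>_def using leaf_subset[OF p] by blast
qed

lemma leaf_cong: "p \<in> U \<Longrightarrow> q \<in> U \<Longrightarrow> lf p = lf q \<longleftrightarrow> drop_coord k (\<eta> p) = drop_coord k (\<eta> q)"
  using \<psi>_leaf by (auto simp: leaf_eq)

lemma bij_\<psi>: "bij_betw \<psi> M (base_polydisc k r)"
proof (rule bij_betw_imageI)
  show "inj_on \<psi> M"
  proof (rule inj_onI)
    fix l l' assume l: "l \<in> M" "l' \<in> M" "\<psi> l = \<psi> l'"
    then obtain p q where "p \<in> U" "q \<in> U" "l = lf p" "l' = lf q" by blast
    then show "l = l'" using l(3) by (simp add: \<psi>_leaf leaf_cong)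
  qed
  show "\<psi> ` M = base_polydisc k r"
  proof
    show "\<psi> ` M \<subseteq> base_polydisc k r" using \<psi>_leaf drop_coord_base[OF \<eta>_in(1)] by auto
    show "base_polydisc k r \<subseteq> \<psi> ` M"
    proof
      fix z assume z: "z \<in> base_polydisc k r"
      then have b: "z + axis k 1 \<in> B" and zk: "z $ k = 0" by (auto simp: base_polydisc_def coord_space_def)
      have "\<psi> (lf (\<theta> (z + axis k 1))) = z"
        using \<psi>_leaf[OF \<theta>_in(1)[OF b]] zk by (auto simp: \<theta>_in[OF b] vec_eq_iff drop_coord_nth axis_nth_eq)
      then show "z \<in> \<psi> ` M" using \<theta>_in(1)[OF b] by (metis imageI)
    qed
  qed
qed

sublocale model: jacobi_model k M \<psi> "base_polydisc k r" \<beta>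
  by unfold_locales (rule rel_open_base_polydisc bij_\<psi> \<beta> skew jac; assumption?)+

text \<open>Read in box coordinates and in the chart of the slit dual this is the identity, see
  \<open>chart_\<Phi>\<close>. The properties of the embedding are therefore those of
  \<open>\<eta>\<close> and its inverse \<open>\<theta>\<close>.\<close>

definition \<Phi> :: "'a \<Rightarrow> 'a set \<times> ('a set \<times> complex \<Rightarrow> complex)" where
  "\<Phi> p = model.dual_point (lf p) (\<eta> p $ k)"

lemma \<Phi>_in: "p \<in> U \<Longrightarrow> \<Phi> p \<in> model.D"
  unfolding \<Phi>_def by (rule model.dual_point_in) (auto simp: \<eta>_k)

lemma fst_\<Phi>: "fst (\<Phi> p) = lf p"
  by (simp add: \<Phi>_def model.dual_point_def)

lemma chart_\<Phi>:
  assumes "p \<in> U"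
  shows "model.dual_chart (\<Phi> p) = \<eta> p"
proof -
  have "lf p \<in> M" using assms by blast
  from model.dual_chart_point[OF this] show ?thesis
    by (simp add: \<Phi>_def \<psi>_leaf[OF assms] drop_coord_def)
qed

end

section \<open>The embedding into the slit dual\<close>

context flow_box_chart
begin

abbreviation "X \<equiv> {(M, \<psi>)}"
abbreviation "slit \<equiv> {(model.D, model.dual_chart)}"

lemma dom_UNIV: "dom c UNIV = snd c ` (fst c \<inter> U)"
  by (auto simp: dom_def)

lemma inj_\<Phi>: "inj_on \<Phi> U"
proof (rule inj_onI)
  fix p q assume pq: "p \<in> U" "q \<in> U" "\<Phi> p = \<Phi> q"
  then have "\<eta> p = \<eta> q" using chart_\<Phi>[of p] chart_\<Phi>[of q] by simp
  then show "p = q" by (metis \<eta>_in(3) pq(1,2))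
qed

lemma chart_image_\<Phi>: "model.dual_chart ` \<Phi> ` U = B"
proof
  show "model.dual_chart ` \<Phi> ` U \<subseteq> B" using chart_\<Phi> \<eta>_in(1) by auto
  show "B \<subseteq> model.dual_chart ` \<Phi> ` U"
  proof
    fix \<zeta> assume z: "\<zeta> \<in> B"
    have "model.dual_chart (\<Phi> (\<theta> \<zeta>)) = \<zeta>" using chart_\<Phi>[OF \<theta>_in(1)[OF z]] \<theta>_in(3)[OF z] by simp
    then show "\<zeta> \<in> model.dual_chart ` \<Phi> ` U" using \<theta>_in(1)[OF z] by (metis imageI)
  qed
qed

lemma inv_\<Phi>:
  assumes "Q \<in> \<Phi> ` U"
  shows "inv_into U \<Phi> Q = \<theta> (model.dual_chart Q)"
proof -
  obtain p where p: "p \<in> U" "Q = \<Phi> p" using assms by blast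
  then show ?thesis using inv_into_f_f[OF inj_\<Phi> p(1)] chart_\<Phi>[OF p(1)] \<eta>_in(3)[OF p(1)] by simp
qed

lemma continuous_map_\<eta>: "continuous_map (subtopology (atlas_topology Y) U) euclidean \<eta>"
  unfolding continuous_map
proof (intro conjI allI impI)
  fix S :: "(complex ^ 'n) set" assume "openin euclidean S"
  then have "openin (atlas_topology Y) {p \<in> U. \<eta> p \<in> S}" by (intro openin_\<eta>) simp
  moreover have "{p \<in> topspace (subtopology (atlas_topology Y) U). \<eta> p \<in> S} = {p \<in> U. \<eta> p \<in> S}"
    using openin_subset[OF openin_U] by auto
  ultimately show "openin (subtopology (atlas_topology Y) U) {p \<in> topspace (subtopology (atlas_topology Y) U). \<eta> p \<in> S}"
    by (simp add: openin_open_subtopology[OF openin_U])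
qed simp

lemma holo_map_\<Phi>: "holo_map UNIV Y U UNIV slit \<Phi>"
  unfolding holo_map_def
proof (intro conjI ballI)
  show "continuous_map (subtopology (atlas_topology Y) U) (atlas_topology slit) \<Phi>"
  proof (rule model.dual.continuous_map_single)
    show "\<Phi> x \<in> model.D" if "x \<in> topspace (subtopology (atlas_topology Y) U)" for x
      using that by (intro \<Phi>_in) simp
    show "continuous_map (subtopology (atlas_topology Y) U) euclidean (\<lambda>x. model.dual_chart (\<Phi> x))"
      by (rule continuous_map_eq[OF continuous_map_\<eta>]) (simp add: chart_\<Phi>)
  qed
  fix c d i assume c: "c \<in> Y" and d: "d \<in> slit" and "i \<in> (UNIV :: 'n set)"
  have "{p \<in> fst c \<inter> U. \<Phi> p \<in> fst d} = fst c \<inter> U" using d \<Phi>_in by auto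
  moreover have "holo_on UNIV (dom c UNIV) (in_chart c (\<lambda>p. snd d (\<Phi> p) $ i))"
    by (rule holo_chart_compose[OF c open_UNIV, where F = "\<lambda>z. z $ i"])
      (use d in \<open>auto simp: chart_\<Phi> intro!: holo_on_coord\<close>)
  ultimately show "holo_on UNIV (snd c ` {p \<in> fst c \<inter> U. \<Phi> p \<in> fst d}) (in_chart c (\<lambda>p. snd d (\<Phi> p) $ i))"
    by (simp add: dom_UNIV)
qed

lemma openin_image_\<Phi>: "openin (atlas_topology slit) (\<Phi> ` U)"
  by (rule model.dual.openin_of_image) (use \<Phi>_in chart_image_\<Phi> open_polydisc in auto)

lemma holo_map_inv_\<Phi>: "holo_map UNIV slit (\<Phi> ` U) UNIV Y (inv_into U \<Phi>)"
  unfolding holo_map_def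
proof (intro conjI ballI)
  have "continuous_map (subtopology (atlas_topology slit) (\<Phi> ` U)) (top_of_set B) model.dual_chart"
    unfolding continuous_map_in_subtopology
  proof (intro conjI)
    have "openin (atlas_topology slit) {Q \<in> model.D. model.dual_chart Q \<in> S}" if "open S" for S
      unfolding model.dual.openin_iff using that by blast
    then have "continuous_map (atlas_topology slit) euclidean model.dual_chart"
      by (auto simp: continuous_map)
    then show "continuous_map (subtopology (atlas_topology slit) (\<Phi> ` U)) euclidean model.dual_chart"
      by (rule continuous_map_from_subtopology)
  qed (use chart_image_\<Phi> in auto)
  from continuous_map_compose[OF this continuous_map_\<theta>]
  show "continuous_map (subtopology (atlas_topology slit) (\<Phi> ` U)) (atlas_topology Y) (inv_into U \<Phi>)"
    by (rule continuous_map_eq) (simp add: inv_\<Phi>)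
  fix c d i assume c: "c \<in> slit" and d: "d \<in> Y" and "i \<in> (UNIV :: 'n set)"
  have c': "fst c = model.D" "snd c = model.dual_chart" "c = (model.D, model.dual_chart)" using c by auto
  let ?S = "snd c ` {Q \<in> fst c \<inter> \<Phi> ` U. inv_into U \<Phi> Q \<in> fst d}"
  have z: "\<zeta> \<in> dom\<theta> d \<and> in_chart c (\<lambda>p. snd d (inv_into U \<Phi> p) $ i) \<zeta> = snd d (\<theta> \<zeta>) $ i" if "\<zeta> \<in> ?S" for \<zeta>
  proof -
    obtain Q where Q: "Q \<in> model.D" "Q \<in> \<Phi> ` U" "inv_into U \<Phi> Q \<in> fst d" "\<zeta> = model.dual_chart Q"
      using \<open>\<zeta> \<in> ?S\<close> unfolding c'(1,2) by blast
    have "\<zeta> \<in> B" using Q(2,4) chart_image_\<Phi> by blast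
    then show ?thesis using Q(1,3) inv_\<Phi>[OF Q(2)] by (simp add: dom\<theta>_def c'(3) Q(4))
  qed
  have "holo_on UNIV ?S (\<lambda>\<zeta>. snd d (\<theta> \<zeta>) $ i)"
    by (rule holo_on_subset[OF holo_\<theta>[OF d]]) (rule subsetI, drule z, erule conjunct1)
  moreover have "holo_on UNIV ?S (in_chart c (\<lambda>p. snd d (inv_into U \<Phi> p) $ i)) \<longleftrightarrow> holo_on UNIV ?S (\<lambda>\<zeta>. snd d (\<theta> \<zeta>) $ i)"
    by (rule holo_on_cong) (drule z, erule conjunct2)
  ultimately show "holo_on UNIV ?S (in_chart c (\<lambda>p. snd d (inv_into U \<Phi> p) $ i))" by simp
qed

lemma embedding: "open_embedding UNIV Y U UNIV (slit_dual_atlas k X model.L) \<Phi>"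
  unfolding model.dual_atlas open_embedding_def
  by (intro conjI holo_map_\<Phi> inj_\<Phi> openin_image_\<Phi> holo_map_inv_\<Phi>)

lemma jac_\<Phi>:
  assumes c: "c \<in> Y" and p: "p \<in> fst c" "p \<in> U"
  shows "jac \<Phi> c (model.D, model.dual_chart) p i j = E c p i j"
proof -
  have "cpartial j (in_chart c (\<lambda>q. model.dual_chart (\<Phi> q) $ i)) (snd c p) = (\<Sum>l\<in>UNIV. cpartial l (\<lambda>z. z $ i) (\<eta> p) * E c p l j)"
    by (rule cpartial_chart_compose[OF c open_UNIV _ _ p UNIV_I]) (auto simp: chart_\<Phi> intro!: holo_on_coord)
  also have "\<dots> = (\<Sum>l\<in>UNIV. if l = i then E c p i j else 0)"
    by (rule sum.cong[OF refl]) (simp add: cpartial_coord)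
  finally show ?thesis by (simp add: jac_def)
qed

lemma H_related: "vf_related UNIV Y U (slit_dual_atlas k X model.L) \<Phi> H (euler_field k)"
  unfolding model.dual_atlas vf_related_def
proof (intro ballI impI)
  fix c d p assume c: "c \<in> Y" and d: "d \<in> slit" and "p \<in> fst c \<inter> U"
  then have p: "p \<in> fst c" "p \<in> U" by auto
  show "euler_field k d (\<Phi> p) = push_vec UNIV \<Phi> c d p (H c p)"
    using d E_H[OF c p] by (simp add: euler_field_def push_vec_def jac_\<Phi>[OF c p] chart_\<Phi>[OF p(2)] vec_eq_iff axis_nth_eq)
qed

lemma P_related: "bf_related UNIV Y U (slit_dual_atlas k X model.L) \<Phi> P model.dual_bivector"
  unfolding model.dual_atlas bf_related_def
proof (intro ballI impI)
  fix c d p assume c: "c \<in> Y" and d: "d \<in> slit" and "p \<in> fst c \<inter> U"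
  then have p: "p \<in> fst c" "p \<in> U" by auto
  show "model.dual_bivector d (\<Phi> p) = push_biv UNIV \<Phi> c d p (P c p)"
    using d E_P[OF c p] by (simp add: model.dual_bivector_def push_biv_def jac_\<Phi>[OF c p] chart_\<Phi>[OF p(2)] vec_eq_iff)
qed

lemma leaf_space: "is_leaf_space UNIV Y H U (UNIV - {k}) X"
  unfolding is_leaf_space_def
proof (intro conjI ballI impI)
  fix p assume p: "p \<in> U"
  show "nonzero_at Y H p"
    unfolding nonzero_at_def
  proof (intro ballI impI notI)
    fix c assume "c \<in> Y" "p \<in> fst c" "H c p = 0"
    then show False using E_H[of c p k] \<eta>_k[OF p] p by simp
  qed
next
  show "points X = M" by simp
next
  show "holo_map UNIV Y U (UNIV - {k}) X lf"
    unfolding holo_map_def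
  proof (intro conjI ballI)
    show "continuous_map (subtopology (atlas_topology Y) U) (atlas_topology X) lf"
    proof (rule model.continuous_map_single)
      have "continuous_map (subtopology (atlas_topology Y) U) euclidean (drop_coord k \<circ> \<eta>)"
        by (rule continuous_map_compose[OF continuous_map_\<eta>]) (simp add: continuous_on_drop_coord)
      then show "continuous_map (subtopology (atlas_topology Y) U) euclidean (\<lambda>p. \<psi> (lf p))"
        by (rule continuous_map_eq) (simp add: \<psi>_leaf)
    qed simp
    fix c d i assume c: "c \<in> Y" and d: "d \<in> X" and i: "i \<in> UNIV - {k}"
    have "{p \<in> fst c \<inter> U. lf p \<in> fst d} = fst c \<inter> U" using d by auto
    moreover have "holo_on UNIV (dom c UNIV) (in_chart c (\<lambda>p. snd d (lf p) $ i))"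
      by (rule holo_chart_compose[OF c open_UNIV, where F = "\<lambda>z. z $ i"])
        (use d i in \<open>auto simp: \<psi>_leaf drop_coord_nth intro!: holo_on_coord\<close>)
    ultimately show "holo_on UNIV (snd c ` {p \<in> fst c \<inter> U. lf p \<in> fst d}) (in_chart c (\<lambda>p. snd d (lf p) $ i))"
      by (simp add: dom_UNIV)
  qed
next
  fix c d p assume c: "c \<in> Y" and d: "d \<in> X" and "p \<in> fst c \<inter> U" and "lf p \<in> fst d"
  then have p: "p \<in> fst c" "p \<in> U" by auto
  have jl: "jac lf c d p i j = (if i = k then 0 else E c p i j)" for i j
  proof -
    have "cpartial j (in_chart c (\<lambda>q. \<psi> (lf q) $ i)) (snd c p) =
        (\<Sum>l\<in>UNIV. cpartial l (\<lambda>z. if i = k then 0 else z $ i) (\<eta> p) * E c p l j)"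
    proof (rule cpartial_chart_compose[OF c open_UNIV _ _ p UNIV_I])
      show "holo_on UNIV UNIV (\<lambda>z :: complex ^ 'n. if i = k then 0 else z $ i)"
        by (cases "i = k") (simp_all add: holo_on_const holo_on_coord)
    qed (simp add: \<psi>_leaf drop_coord_nth)
    also have "\<dots> = (\<Sum>l\<in>UNIV. if l = i then if i = k then 0 else E c p i j else 0)"
      by (rule sum.cong[OF refl]) (cases "i = k"; simp add: cpartial_coord)
    finally show ?thesis using d by (simp add: jac_def)
  qed
  show "push_vec UNIV lf c d p ` coord_space UNIV = coord_space (UNIV - {k})"
  proof
    show "push_vec UNIV lf c d p ` coord_space UNIV \<subseteq> coord_space (UNIV - {k})"
      by (auto simp: push_vec_def coord_space_def jl)
    show "coord_space (UNIV - {k}) \<subseteq> push_vec UNIV lf c d p ` coord_space UNIV"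
    proof
      fix v :: "complex ^ 'n" assume v: "v \<in> coord_space (UNIV - {k})"
      \<comment> \<open>A preimage: \<open>v\<close> is read as a vector in box coordinates and
        taken back to the chart \<open>c\<close>; the projection only forgets the entry k, which is
        zero in \<open>v\<close>.\<close>
      define u where "u = (\<chi> j. \<Sum>m\<in>UNIV. E' c p j m * v $ m)"
      have "(\<Sum>j\<in>UNIV. jac lf c d p i j * u $ j) = v $ i" for i
      proof (cases "i = k")
        case True
        then show ?thesis using v by (simp add: jl coord_space_def)
      next
        case False
        have "(\<Sum>j\<in>UNIV. jac lf c d p i j * u $ j) = (\<Sum>j\<in>UNIV. \<Sum>m\<in>UNIV. E c p i j * E' c p j m * v $ m)"
          using False by (simp add: jl u_def sum_distrib_left mult.assoc)
        also have "\<dots> = (\<Sum>m\<in>UNIV. (\<Sum>j\<in>UNIV. E c p i j * E' c p j m) * v $ m)"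
          by (subst sum.swap) (simp only: sum_distrib_right)
        also have "\<dots> = (\<Sum>m\<in>UNIV. if i = m then v $ m else 0)"
          unfolding E_E'[OF c p] by (intro sum.cong refl) simp
        finally show ?thesis by simp
      qed
      then have "v = push_vec UNIV lf c d p u" by (simp add: push_vec_def vec_eq_iff)
      then show "v \<in> push_vec UNIV lf c d p ` coord_space UNIV" by simp
    qed
  qed
qed

section \<open>Sections of the line bundle as solutions of the Euler equation\<close>

context
  fixes V assumes V: "openin (atlas_topology X) V"
begin

private abbreviation "Z \<equiv> \<psi> ` V"
private abbreviation "W \<equiv> {p \<in> U. lf p \<in> V}"

text \<open>The box coordinates of the points over \<open>V\<close>. With each point this set
  contains the fibre segment to the slice w = 1, as \<open>fibre_constant_within\<close>
  requires.\<close>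

definition base_box :: "(complex ^ 'n) set" where "base_box = B \<inter> drop_coord k -` Z"

private lemma V': "V \<subseteq> M" "rel_open (UNIV - {k}) Z" "Z \<subseteq> base_polydisc k r"
  using model.openin_image[OF V] by auto

private lemma open_box: "open base_box"
  unfolding base_box_def using open_polydisc open_drop_coord_vimage[OF V'(2)] by (rule open_Int)

private lemma rel_open_box: "rel_open UNIV base_box" using open_box by simp

private lemma in_V: "p \<in> U \<Longrightarrow> drop_coord k (\<eta> p) \<in> Z \<longleftrightarrow> lf p \<in> V"
  using inj_on_image_mem_iff[OF model.inj _ V'(1), of "lf p"] by (simp add: \<psi>_leaf)

private lemma box_iff: "p \<in> U \<Longrightarrow> \<eta> p \<in> base_box \<longleftrightarrow> lf p \<in> V"
  using in_V \<eta>_in(1) by (simp add: base_box_def)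

private lemma dom_box: "dom c base_box = snd c ` (fst c \<inter> W)"
  unfolding dom_def using box_iff by blast

private lemma shrink_in_box:
  assumes "\<zeta> \<in> base_box" "0 \<le> s" "s \<le> 1"
  shows "shrink k s \<zeta> \<in> base_box"
proof -
  have "drop_coord k (shrink k s \<zeta>) = drop_coord k \<zeta>" unfolding shrink_def drop_coord_axis by simp
  then show ?thesis using assms shrink_in_polydisc[of \<zeta> k r s] by (simp add: base_box_def)
qed

private lemma hs: "s \<in> holo_sections (UNIV - {k}) X model.L V \<Longrightarrow> holo_on (UNIV - {k}) Z (model.loc s)"
  using model.holo_sections_iff[OF V'(1)] by blast

private lemma lift_holo:
  assumes "holo_on (UNIV - {k}) Z f"
  shows "holo_on UNIV base_box (lift_fun k f)"
  by (rule holo_on_lift_fun[OF rel_open_box V'(2) _ assms]) (auto simp: base_box_def)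

private lemma lin_fun_\<Phi>:
  assumes s: "s \<in> holo_sections (UNIV - {k}) X model.L V" and p: "p \<in> U" "lf p \<in> V"
  shows "lin_fun s (\<Phi> p) = lift_fun k (model.loc s) (\<eta> p)"
proof -
  have "fst (s (lf p)) = lf p" using s p(2) model.holo_sections_iff[OF V'(1)] by blast
  then show ?thesis using model.lin_fun_eq[OF \<Phi>_in[OF p(1)], of s] by (simp add: fst_\<Phi> chart_\<Phi>[OF p(1)])
qed

private lemma euler_chart:
  assumes F: "holo_on UNIV base_box F" and f: "\<And>q. q \<in> U \<Longrightarrow> \<eta> q \<in> base_box \<Longrightarrow> f q = F (\<eta> q)"
    and c: "c \<in> Y" and p: "p \<in> fst c" "p \<in> U" "\<eta> p \<in> base_box"
  shows "vf_holo UNIV H c f p = \<eta> p $ k * cpartial k F (\<eta> p)"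
proof -
  have cp: "cpartial j (in_chart c f) (snd c p) = (\<Sum>i\<in>UNIV. cpartial i F (\<eta> p) * E c p i j)" for j
    by (rule cpartial_chart_compose[OF c open_box F f p])
  have "vf_holo UNIV H c f p = (\<Sum>j\<in>UNIV. \<Sum>i\<in>UNIV. cpartial i F (\<eta> p) * (E c p i j * H c p $ j))"
    unfolding vf_holo_def cp sum_distrib_left
    by (intro sum.cong refl) (simp only: mult_ac)
  also have "\<dots> = (\<Sum>i\<in>UNIV. cpartial i F (\<eta> p) * (if i = k then \<eta> p $ k else 0))"
    by (subst sum.swap) (simp only: sum_distrib_left[symmetric] E_H[OF c p(1,2)])
  also have "\<dots> = (\<Sum>i\<in>UNIV. if i = k then \<eta> p $ k * cpartial k F (\<eta> p) else 0)"
    by (rule sum.cong[OF refl]) simp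
  finally show ?thesis by simp
qed

text \<open>A linear function determines its section because w is nonzero. Conversely, a function
  equal to its derivative along \<open>H\<close> becomes constant along the fibres after division by
  w; its restriction to the slice w = 1 is the coefficient of the wanted section.\<close>

lemma sections_bij:
  "bij_betw (\<lambda>s. \<lambda>p\<in>W. lin_fun s (\<Phi> p)) (holo_sections (UNIV - {k}) X model.L V)
     {f \<in> extensional W. holo_fun UNIV Y W f \<and> (\<forall>c\<in>Y. \<forall>p\<in>fst c \<inter> W. vf_holo UNIV H c f p = f p)}"
proof (rule bij_betw_imageI)
  let ?\<O> = "holo_sections (UNIV - {k}) X model.L V"
  let ?L = "\<lambda>s. \<lambda>p\<in>W. lin_fun s (\<Phi> p)"
  let ?R = "{f \<in> extensional W. holo_fun UNIV Y W f \<and> (\<forall>c\<in>Y. \<forall>p\<in>fst c \<inter> W. vf_holo UNIV H c f p = f p)}"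
  have Lp: "?L s p = p' \<longleftrightarrow> lift_fun k (model.loc s) (\<eta> p) = p'" if "s \<in> ?\<O>" "p \<in> U" "lf p \<in> V" for s p p'
    using that lin_fun_\<Phi> by simp
  show "inj_on ?L ?\<O>"
  proof (rule inj_onI)
    fix s t assume s: "s \<in> ?\<O>" and t: "t \<in> ?\<O>" and st: "?L s = ?L t"
    show "s = t"
    proof (rule model.section_eqI)
      show "s \<in> extensional V" "t \<in> extensional V" using s t model.holo_sections_iff[OF V'(1)] by blast+
      fix l assume l: "l \<in> V"
      show "fst (s l) = fst (t l)" using s t l model.holo_sections_iff[OF V'(1)] by simp
      obtain p where p: "p \<in> U" "l = lf p" using V'(1) l by blast
      have "lift_fun k (model.loc s) (\<eta> p) = lift_fun k (model.loc t) (\<eta> p)"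
        using fun_cong[OF st, of p] p l lin_fun_\<Phi>[OF s] lin_fun_\<Phi>[OF t] by simp
      then have "model.loc s (\<psi> l) = model.loc t (\<psi> l)"
        using \<eta>_k[OF p(1)] p by (simp add: lift_fun_def \<psi>_leaf)
      then show "snd (s l) = snd (t l)" using p by simp
    qed
  qed
  show "?L ` ?\<O> = ?R"
  proof
    show "?L ` ?\<O> \<subseteq> ?R"
    proof (rule image_subsetI)
      fix s assume s: "s \<in> ?\<O>"
      have f: "?L s q = lift_fun k (model.loc s) (\<eta> q)" if "q \<in> U" "\<eta> q \<in> base_box" for q
        using that lin_fun_\<Phi>[OF s] by (simp add: box_iff)
      have "holo_fun UNIV Y W (?L s)"
        unfolding holo_fun_def dom_box[symmetric]
        by (intro ballI holo_chart_compose[OF _ open_box lift_holo[OF hs[OF s]] f])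
      moreover have "vf_holo UNIV H c (?L s) p = ?L s p" if c: "c \<in> Y" and p: "p \<in> fst c \<inter> W" for c p
      proof -
        have p': "p \<in> fst c" "p \<in> U" "\<eta> p \<in> base_box" using p box_iff by auto
        have d: "drop_coord k (\<eta> p) \<in> Z" using p'(3) by (simp add: base_box_def)
        have "vf_holo UNIV H c (?L s) p = \<eta> p $ k * cpartial k (lift_fun k (model.loc s)) (\<eta> p)"
          by (rule euler_chart[OF lift_holo[OF hs[OF s]] f c p'])
        also have "\<dots> = lift_fun k (model.loc s) (\<eta> p)"
          by (simp add: cpartial_lift_fun[OF V'(2) hs[OF s] d] lift_fun_def ext_deriv_def)
        finally show ?thesis using f[OF p'(2,3)] by simp
      qed
      ultimately show "?L s \<in> ?R" by simp
    qed
    show "?R \<subseteq> ?L ` ?\<O>"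
    proof
      fix f assume "f \<in> ?R"
      then have ext: "f \<in> extensional W" and hf: "holo_fun UNIV Y W f"
        and Hf': "\<forall>c\<in>Y. \<forall>p\<in>fst c \<inter> W. vf_holo UNIV H c f p = f p"
        unfolding mem_Collect_eq by - (elim conjE, assumption)+
      have Hf: "vf_holo UNIV H c f p = f p" if "c \<in> Y" "p \<in> fst c" "p \<in> W" for c p
        by (rule Hf'[rule_format, OF that(1) IntI[OF that(2,3)]])
      define F where "F \<zeta> = f (\<theta> \<zeta>)" for \<zeta>
      have boxB: "\<zeta> \<in> B" if "\<zeta> \<in> base_box" for \<zeta> using that by (simp add: base_box_def)
      have \<theta>W: "\<theta> \<zeta> \<in> W" "\<theta> \<zeta> \<in> fst c0" if "\<zeta> \<in> base_box" for \<zeta>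
      proof -
        note t = \<theta>_in[OF boxB[OF that]]
        have "lf (\<theta> \<zeta>) \<in> V" using box_iff[OF t(1)] that unfolding t(3) by (rule iffD1)
        then show "\<theta> \<zeta> \<in> W" using t(1) by (intro CollectI conjI)
        show "\<theta> \<zeta> \<in> fst c0" by (rule U_points(1)[OF t(1)])
      qed
      have fF: "f q = F (\<eta> q)" if "q \<in> U" "\<eta> q \<in> base_box" for q 
        unfolding F_def \<eta>_in(3)[OF that(1)] by (rule refl)
      have hF: "holo_on UNIV base_box F"
      proof -
        have Gbox: "holo_on UNIV base_box (\<lambda>\<zeta>. G \<zeta> $ i)" for i
          by (rule holo_on_subset[OF G]) (rule subsetI, erule boxB)
        have "holo_on UNIV (dom c0 base_box) (in_chart c0 f)"
          using bspec[OF hf[unfolded holo_fun_def] c0] unfolding dom_box .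
        moreover have "G ` base_box \<subseteq> dom c0 base_box"
        proof (rule image_subsetI)
          fix \<zeta> assume z: "\<zeta> \<in> base_box"
          then show "G \<zeta> \<in> dom c0 base_box"
            unfolding dom_box \<theta>_in(2)[OF boxB[OF z], symmetric] by (intro imageI IntI \<theta>W[OF z])
        qed
        ultimately have "holo_on UNIV base_box (\<lambda>\<zeta>. in_chart c0 f (G \<zeta>))"
          by (intro holo_on_compose[OF rel_open_box rel_open_dom[OF c0 open_box] Gbox])
        then show ?thesis by (simp add: F_def[abs_def] in_chart_def \<theta>_def)
      qed
      have eul: "\<zeta> $ k * cpartial k F \<zeta> = F \<zeta>" if z: "\<zeta> \<in> base_box" for \<zeta>
      proof -
        note t = \<theta>_in[OF boxB[OF z]]
        have zb: "\<eta> (\<theta> \<zeta>) \<in> base_box" unfolding t(3) by (rule z)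
        have "vf_holo UNIV H c0 f (\<theta> \<zeta>) = \<eta> (\<theta> \<zeta>) $ k * cpartial k F (\<eta> (\<theta> \<zeta>))"
          by (rule euler_chart[OF hF fF c0 \<theta>W(2)[OF z] t(1) zb])
        then show ?thesis unfolding t(3) Hf[OF c0 \<theta>W(2)[OF z] \<theta>W(1)[OF z]] F_def by (rule sym)
      qed
      have nz: "\<zeta> $ k \<noteq> 0" if "\<zeta> \<in> base_box" for \<zeta> by (rule polydisc_nth_nonzero[OF boxB[OF that] r(2)])
      have hk: "holo_on UNIV base_box (\<lambda>\<zeta>. \<zeta> $ k)" by (rule holo_on_coord[OF rel_open_box])
      have F_lin: "F \<zeta> = \<zeta> $ k * F (shrink k 0 \<zeta>)" if z: "\<zeta> \<in> base_box" for \<zeta>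
      proof -
        \<comment> \<open>The Euler equation is exactly the vanishing of the fibre derivative of
          this quotient.\<close>
        have "F \<zeta> / \<zeta> $ k = F (shrink k 0 \<zeta>) / shrink k 0 \<zeta> $ k"
        proof (rule fibre_constant_within[OF rel_open_box])
          show "holo_on UNIV base_box (\<lambda>\<zeta>. F \<zeta> / \<zeta> $ k)" by (rule holo_on_divide[OF rel_open_box hF hk nz])
          show "cpartial k (\<lambda>\<zeta>. F \<zeta> / \<zeta> $ k) \<xi> = 0" if x: "\<xi> \<in> base_box" for \<xi>
          proof -
            have "cpartial k (\<lambda>\<zeta>. F \<zeta> / \<zeta> $ k) \<xi> =
                (cpartial k F \<xi> * \<xi> $ k - F \<xi> * cpartial k (\<lambda>\<zeta>. \<zeta> $ k) \<xi>) / (\<xi> $ k * \<xi> $ k)"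
              by (rule cpartial_divide[OF rel_open_box hF hk x UNIV_I nz[OF x]])
            also have "cpartial k F \<xi> * \<xi> $ k = F \<xi>" using eul[OF x] by (simp only: mult.commute)
            finally show ?thesis by (simp add: cpartial_coord)
          qed
          show "shrink k s \<zeta> \<in> base_box" if "0 \<le> s" "s \<le> 1" for s by (rule shrink_in_box[OF z that])
        qed
        moreover have "shrink k 0 \<zeta> $ k = 1" by (simp add: shrink_0_nth)
        ultimately have "F \<zeta> / \<zeta> $ k = F (shrink k 0 \<zeta>)" by (simp only: div_by_1)
        moreover have "F \<zeta> = \<zeta> $ k * (F \<zeta> / \<zeta> $ k)" using nz[OF z] by simp
        ultimately show ?thesis by (simp only:)
      qed
      define s where "s = (\<lambda>l\<in>V. (l, F (\<psi> l + axis k 1)))"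
      have locs: "model.loc s z = F (z + axis k 1)" if "z \<in> Z" for z
      proof -
        obtain l where l: "l \<in> V" "z = \<psi> l" using \<open>z \<in> Z\<close> by blast
        then have "l \<in> M" using V'(1) by blast
        then show ?thesis using l(1) unfolding l(2) by (simp add: s_def)
      qed
      have zbox: "z + axis k 1 \<in> base_box" if "z \<in> Z" for z
      proof -
        have "z \<in> base_polydisc k r" using that V'(3) by blast
        then have "z + axis k 1 \<in> B" "drop_coord k (z + axis k 1) = z"
          by (auto simp: base_polydisc_def coord_space_def vec_eq_iff drop_coord_nth axis_nth_eq)
        then show ?thesis using that by (simp add: base_box_def)
      qed
      have "holo_on (UNIV - {k}) Z (\<lambda>z. F (z + axis k 1))"
      proof (rule holo_on_compose[OF V'(2) rel_open_box _ _ hF])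
        show "holo_on (UNIV - {k}) Z (\<lambda>z. (z + axis k 1) $ j)" for j
          using holo_on_add[OF V'(2) holo_on_coord[OF V'(2)] holo_on_const] by simp
      qed (use zbox in auto)
      moreover have "holo_on (UNIV - {k}) Z (model.loc s) \<longleftrightarrow> holo_on (UNIV - {k}) Z (\<lambda>z. F (z + axis k 1))"
        by (rule holo_on_cong) (rule locs)
      ultimately have "holo_on (UNIV - {k}) Z (model.loc s)" by (simp only:)
      then have sO: "s \<in> ?\<O>" by (simp add: model.holo_sections_iff[OF V'(1)] s_def)
      have "?L s = f"
      proof (rule extensionalityI[OF restrict_extensional ext])
        fix p assume "p \<in> W"
        then have p: "p \<in> U" "lf p \<in> V" "\<eta> p \<in> base_box" using box_iff by auto
        have "?L s p = \<eta> p $ k * F (drop_coord k (\<eta> p) + axis k 1)"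
          using lin_fun_\<Phi>[OF sO p(1,2)] locs[of "drop_coord k (\<eta> p)"] in_V[OF p(1)] p(1,2) by (simp add: lift_fun_def)
        also have "\<dots> = f p" using F_lin[OF p(3)] fF[OF p(1,3)] by (simp add: shrink_0_eq)
        finally show "?L s p = f p" .
      qed
      then show "f \<in> ?L ` ?\<O>" using sO by blast
    qed
  qed
qed

text \<open>The Jacobian of \<open>\<eta>\<close> carries the pairing from the chart
  \<open>c\<close> to box coordinates, where \<open>bracket_lift_fun\<close> identifies it.\<close>

lemma sections_bracket:
  assumes s: "s \<in> holo_sections (UNIV - {k}) X model.L V" and t: "t \<in> holo_sections (UNIV - {k}) X model.L V"
    and c: "c \<in> Y" and p: "p \<in> fst c \<inter> W"
  shows "lin_fun (model.J V s t) (\<Phi> p) = bf_pair UNIV P c (\<lambda>q. lin_fun s (\<Phi> q)) (\<lambda>q. lin_fun t (\<Phi> q)) p"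
proof -
  have p': "p \<in> fst c" "p \<in> U" "\<eta> p \<in> base_box" "lf p \<in> V" using p box_iff by auto
  have d: "drop_coord k (\<eta> p) \<in> Z" using p'(3) by (simp add: base_box_def)
  have cp: "cpartial j (in_chart c (\<lambda>q. lin_fun s (\<Phi> q))) (snd c p) =
      (\<Sum>i\<in>UNIV. cpartial i (lift_fun k (model.loc s)) (\<eta> p) * E c p i j)"
    if s: "s \<in> holo_sections (UNIV - {k}) X model.L V" for s j
    by (rule cpartial_chart_compose[OF c open_box lift_holo[OF hs[OF s]] _ p'(1-3)]) (simp add: box_iff lin_fun_\<Phi>[OF s])
  have "bf_pair UNIV P c (\<lambda>q. lin_fun s (\<Phi> q)) (\<lambda>q. lin_fun t (\<Phi> q)) p =
      (\<Sum>j\<in>UNIV. \<Sum>m\<in>UNIV. (\<Sum>i\<in>UNIV. cpartial i (lift_fun k (model.loc s)) (\<eta> p) * E c p i j) *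
         (\<Sum>i\<in>UNIV. cpartial i (lift_fun k (model.loc t)) (\<eta> p) * E c p i m) * P c p $ j $ m)"
    unfolding bf_pair_def cp[OF s] cp[OF t] by (intro sum.cong refl) (simp only: mult_ac)
  also have "\<dots> = bracket (homog k \<beta>) (lift_fun k (model.loc s)) (lift_fun k (model.loc t)) (\<eta> p)"
    unfolding sum_congruence_transform E_P[OF c p'(1,2)] bracket_def ..
  also have "\<dots> = lift_fun k (jacobi_bracket k \<beta> (model.loc s) (model.loc t)) (\<eta> p)"
    by (rule bracket_lift_fun[OF V'(2) hs[OF s] hs[OF t] d \<eta>_k[OF p'(2)]]) (rule skew, use d V'(3) in blast)
  also have "\<dots> = lift_fun k (model.loc (model.J V s t)) (\<eta> p)"
    by (simp add: lift_fun_def model.loc_J[OF V d])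
  also have "\<dots> = lin_fun (model.J V s t) (\<Phi> p)"
    by (rule lin_fun_\<Phi>[OF model.J_holo[OF V s t] p'(2,4), symmetric])
  finally show ?thesis ..
qed

end

lemma canonical: "canonical_jacobi UNIV Y P H U (UNIV - {k}) X model.L model.J \<Phi>"
  unfolding canonical_jacobi_def Let_def
  by (intro conjI allI impI ballI leaf_space fst_\<Phi> sections_bij sections_bracket; assumption)

end

section \<open>Assembly in a chart around the given point\<close>

theorem proposition58:
  fixes Y :: "('a, 'n::finite) atlas"
    and P\<^sub>N :: "('a, 'n) bfield" and H\<^sub>N :: "('a, 'n) vfield" and x :: 'a
  assumes "complex_manifold UNIV Y"
    and "homogeneous_poisson UNIV Y P\<^sub>N H\<^sub>N"
    and "x \<in> points Y"
    and "nonzero_at Y H\<^sub>N x"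
  shows "\<exists>U (k :: 'n) (X :: ('a set, 'n) atlas) (L :: ('a set, 'a set \<times> complex) line_bundle) J P H \<Phi>.
           openin (atlas_topology Y) U \<and> x \<in> U \<and>
           holo_jacobi_manifold (UNIV - {k}) X L J \<and>
           is_poissonization (UNIV - {k}) k X L J P H \<and>
           open_embedding UNIV Y U UNIV (slit_dual_atlas k X L) \<Phi> \<and>
           bf_related UNIV Y U (slit_dual_atlas k X L) \<Phi> P\<^sub>N P \<and>
           vf_related UNIV Y U (slit_dual_atlas k X L) \<Phi> H\<^sub>N H \<and>
           canonical_jacobi UNIV Y P\<^sub>N H\<^sub>N U (UNIV - {k}) X L J \<Phi>"
proof -
  obtain c0 where c0: "c0 \<in> Y" "x \<in> fst c0" using assms(3) unfolding points_def by blast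
  let ?q = "inv_into (fst c0) (snd c0)"
  define S where "S = snd c0 ` fst c0"
  define V where "V z = H\<^sub>N c0 (?q z)" for z
  define b where "b z i j = P\<^sub>N c0 (?q z) $ i $ j" for z i j
  have P: "holo_bivector_field UNIV Y (points Y) P\<^sub>N" and H: "holo_vector_field UNIV Y (points Y) H\<^sub>N"
    and PP: "\<forall>c\<in>Y. \<forall>p\<in>fst c. \<forall>i\<in>UNIV. \<forall>j\<in>UNIV. \<forall>k\<in>UNIV. schouten UNIV P\<^sub>N P\<^sub>N c p i j k = 0"
    and HP: "\<forall>c\<in>Y. \<forall>p\<in>fst c. \<forall>i\<in>UNIV. \<forall>j\<in>UNIV. lie_bivector UNIV H\<^sub>N P\<^sub>N c p i j = - P\<^sub>N c p $ i $ j"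
    using assms(2) unfolding homogeneous_poisson_def by - (elim conjE, assumption)+
  have inj: "inj_on (snd c0) (fst c0)"
    and "\<forall>d\<in>Y. rel_open UNIV (snd c0 ` (fst c0 \<inter> fst d))"
    using assms(1) c0(1) unfolding complex_manifold_def by blast+
  then have S: "open S" using c0(1) unfolding S_def by force
  have q: "?q z \<in> fst c0" "snd c0 (?q z) = z" if "z \<in> S" for z
    using that unfolding S_def by (auto intro: inv_into_into f_inv_into_f)
  have pts: "fst c0 \<inter> points Y = fst c0" using c0(1) by (auto simp: points_def)
  have H_chart: "in_chart c0 (\<lambda>p. H\<^sub>N c0 p $ i) = (\<lambda>z. V z $ i)" for i
    by (simp add: in_chart_def V_def fun_eq_iff)
  have P_chart: "in_chart c0 (\<lambda>p. P\<^sub>N c0 p $ i $ j) = (\<lambda>z. b z i j)" for i j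
    by (simp add: in_chart_def b_def fun_eq_iff)
  have V: "holo_on UNIV S (\<lambda>z. V z $ i)" for i
    using H[unfolded holo_vector_field_def, THEN conjunct2, rule_format, OF c0(1) UNIV_I, of i]
    unfolding H_chart pts S_def .
  have b: "holo_on UNIV S (\<lambda>z. b z i j)" for i j
    using P[unfolded holo_bivector_field_def, THEN conjunct2, THEN conjunct2, rule_format, OF c0(1) UNIV_I UNIV_I, of i j]
    unfolding P_chart pts S_def .
  have skew: "b z i j = - b z j i" if z: "z \<in> S" for z i j
  proof -
    have "?q z \<in> fst c0 \<inter> points Y" unfolding pts by (rule q(1)[OF z])
    from P[unfolded holo_bivector_field_def, THEN conjunct1, THEN bspec, OF c0(1), THEN bspec, OF this, THEN conjunct1]
    show ?thesis unfolding b_def by blast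
  qed
  have schouten: "(\<Sum>l\<in>UNIV. b z l i * cpartial l (\<lambda>z. b z j m) z +
      b z l j * cpartial l (\<lambda>z. b z m i) z + b z l m * cpartial l (\<lambda>z. b z i j) z) = 0" if z: "z \<in> S" for z i j m
  proof -
    \<comment> \<open>The Schouten bracket of a bivector with itself counts every term
      twice.\<close>
    let ?t = "\<lambda>i j m. \<Sum>l\<in>UNIV. b z l i * cpartial l (\<lambda>z. b z j m) z"
    have "?t i j m + ?t i j m + (?t j m i + ?t j m i) + (?t m i j + ?t m i j) = 0"
      using PP[rule_format, OF c0(1) q(1)[OF z] UNIV_I UNIV_I UNIV_I, of i j m]
      unfolding schouten_def Let_def P_chart q(2)[OF z] b_def[symmetric] .
    then have "2 * (?t i j m + ?t j m i + ?t m i j) = 0" by (simp only: mult_2 add_ac)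
    then show ?thesis by (simp only: sum.distrib mult_eq_0_iff zero_neq_numeral[symmetric] simp_thms)
  qed
  have lie: "(\<Sum>l\<in>UNIV. V z $ l * cpartial l (\<lambda>z. b z i j) z
      - b z l j * cpartial l (\<lambda>z. V z $ i) z - b z i l * cpartial l (\<lambda>z. V z $ j) z) = - b z i j" if z: "z \<in> S" for z i j
    using HP[rule_format, OF c0(1) q(1)[OF z] UNIV_I UNIV_I, of i j]
    unfolding lie_bivector_def P_chart H_chart q(2)[OF z] V_def[symmetric] b_def[symmetric] .
  have p: "snd c0 x \<in> S" using c0(2) by (simp add: S_def)
  have "V (snd c0 x) = H\<^sub>N c0 x" by (simp add: V_def inv_into_f_f[OF inj c0(2)])
  then have Vp: "V (snd c0 x) \<noteq> 0" using assms(4) c0 by (simp add: nonzero_at_def)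
  show ?thesis
  proof (rule flow_box[OF S p V Vp])
    fix k :: 'n and r and G g :: "complex ^ 'n \<Rightarrow> complex ^ 'n"
    assume r: "0 < r" "r \<le> 1 / 2" and GS: "G ` polydisc k r \<subseteq> S" and Gp: "G (axis k 1) = snd c0 x"
      and oG: "open (G ` polydisc k r)"
      and G: "\<And>i. holo_on UNIV (polydisc k r) (\<lambda>\<zeta>. G \<zeta> $ i)"
      and g: "\<And>i. holo_on UNIV (G ` polydisc k r) (\<lambda>z. g z $ i)"
      and gG: "\<And>\<zeta>. \<zeta> \<in> polydisc k r \<Longrightarrow> g (G \<zeta>) = \<zeta>"
      and GV: "\<And>\<zeta> i. \<zeta> \<in> polydisc k r \<Longrightarrow> \<zeta> $ k * cpartial k (\<lambda>\<zeta>. G \<zeta> $ i) \<zeta> = V (G \<zeta>) $ i"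
    have r1: "r \<le> 1" using r(2) by simp
    interpret C: flow_box_components S k r G g V b
      by (rule flow_box_components.intro[OF r1 GS oG G g gG GV V b skew schouten lie])
    have HY: "vector_field UNIV Y (points Y) H\<^sub>N" using H unfolding holo_vector_field_def by (rule conjunct1)
    have PY: "bf_related UNIV Y (points Y) Y (\<lambda>p. p) P\<^sub>N P\<^sub>N"
      using P unfolding holo_bivector_field_def by (elim conjE)
    have H_box: "(\<Sum>l\<in>UNIV. H\<^sub>N c0 (?q z) $ l * cpartial l (\<lambda>z. g z $ i) z) = (if i = k then g z $ k else 0)"
      if "z \<in> G ` polydisc k r" for z i
      using C.euler_coord[OF that, of i] unfolding V_def .
    have P_box: "bracket (\<lambda>z i j. P\<^sub>N c0 (?q z) $ i $ j) (\<lambda>z. g z $ i) (\<lambda>z. g z $ j) z = homog k C.reduced (g z) i j"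
      if "z \<in> G ` polydisc k r" for z i j
    proof -
      obtain \<zeta> where z: "\<zeta> \<in> polydisc k r" "z = G \<zeta>" using \<open>z \<in> G ` polydisc k r\<close> by blast
      have "(\<lambda>z i j. P\<^sub>N c0 (?q z) $ i $ j) = b" by (simp add: b_def fun_eq_iff)
      then show ?thesis using C.pushed_eq_homog[OF z(1), of i j] by (simp add: C.pushed_def z(2) gG[OF z(1)])
    qed
    interpret F: flow_box_chart Y P\<^sub>N H\<^sub>N c0 k r G g C.reduced
      by (rule flow_box_chart.intro[OF assms(1) c0(1) r(1) r1 HY PY GS[unfolded S_def] oG G g gG H_box P_box
            C.holo_on_reduced C.reduced_skew C.reduced_jacobi])
    have "axis k 1 \<in> polydisc k r" using r(1) by (simp add: polydisc_def)
    then have xU: "x \<in> F.U" unfolding F.U_def using c0(2) Gp by force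
    show ?thesis
      by (rule exI[where x = F.U], rule exI[where x = k], rule exI[where x = F.X], rule exI[where x = F.model.L],
          rule exI[where x = F.model.J], rule exI[where x = F.model.dual_bivector],
          rule exI[where x = "euler_field k"], rule exI[where x = F.\<Phi>])
        (intro conjI F.openin_U xU F.model.jacobi_manifold F.model.poissonization F.embedding F.P_related F.H_related F.canonical)
  qed
qed

end
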